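(* Let $n\ge 1$. If $Z:\mathrm{Conv}_{\mathrm{cd}}(\mathbb{R}^n)\to\mathbb{R}$ is a continuous, epi-translation invariant valuation which is epi-homogeneous of degree $n$, then there exists a unique continuous function $\eta:\mathbb{S}^n\to\mathbb{R}$ with support compactly contained in $\mathbb{S}^n_-$ such that $$Z(\lfloor K\rfloor)=\int_{\mathbb{S}^n}\eta(\nu)\,dS_n(K,\nu)$$ for all $K\in\mathcal{K}^{n+1}$. In particular, $$Z(u)=\int_{\mathrm{dom}(u)}\eta\left(\frac{(\nabla u(x),-1)}{\sqrt{1+|\nabla u(x)|^2}}\right)\sqrt{1+|\nabla u(x)|^2}\,dx$$ for all $u\in\mathrm{Conv}_{\mathrm{cd}}(\mathbb{R}^n)$, where the function $y\mapsto\eta\left(\frac{(y,-1)}{\sqrt{1+|y|^2}}\right)\sqrt{1+|y|^2}$ on $\mathbb{R}^n$ has compact support.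
   Context: $\mathrm{Conv}(\mathbb{R}^n)$ is the set of all convex, lower semi-continuous, proper (not identically $+\infty$) functions $u:\mathbb{R}^n\to(-\infty,+\infty]$, and $\mathrm{dom}(u)=\{x\in\mathbb{R}^n:u(x)<+\infty\}$. $\mathrm{Conv}_{\mathrm{sc}}(\mathbb{R}^n)=\{u\in\mathrm{Conv}(\mathbb{R}^n):\lim_{|x|\to\infty}u(x)/|x|=+\infty\}$ is the set of super-coercive functions, and $\mathrm{Conv}_{\mathrm{cd}}(\mathbb{R}^n)$ is the set of all $u\in\mathrm{Conv}_{\mathrm{sc}}(\mathbb{R}^n)$ such that $\mathrm{dom}(u)$ is compact. All these spaces carry the (metrizable) topology of epi-convergence: $u_j$ epi-converges to $u$ if for every $x\in\mathbb{R}^n$ (i) $u(x)\le\liminf_j u_j(x_j)$ for every sequence $x_j\to x$, and (ii) there is a sequence $x_j\to x$ with $u(x)=\lim_j u_j(x_j)$. A functional $Z:\mathrm{Conv}_{\mathrm{cd}}(\mathbb{R}^n)\to\mathbb{R}$ is a valuation if $Z(u\wedge v)+Z(u\vee v)=Z(u)+Z(v)$ whenever $u,v$, their pointwise minimum $u\wedge v$ and their pointwise maximum $u\vee v$ all belong to $\mathrm{Conv}_{\mathrm{cd}}(\mathbb{R}^n)$. It is epi-translation invariant if $Z(u(\cdot-x)+c)=Z(u)$ for all $u$, all $x\in\mathbb{R}^n$ and $c\in\mathbb{R}$. It is epi-homogeneous of degree $i$ if $Z(t\cdot u(\cdot/t))=t^iZ(u)$ for all $u$ and all $t>0$, where $t\cdot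 u(\cdot/t)$ denotes the function $x\mapsto t\,u(x/t)$. $\mathcal{K}^{n+1}$ is the set of non-empty compact convex subsets of $\mathbb{R}^{n+1}=\mathbb{R}^n\times\mathbb{R}$. For $K\in\mathcal{K}^{n+1}$, $\lfloor K\rfloor:\mathbb{R}^n\to(-\infty,+\infty]$ is the function $\lfloor K\rfloor(x)=\inf\{t\in\mathbb{R}:(x,t)\in K\}$ (with $\inf\emptyset=+\infty$); it belongs to $\mathrm{Conv}_{\mathrm{cd}}(\mathbb{R}^n)$. $S_n(K,\cdot)$ is the surface area measure of $K$ on the unit sphere $\mathbb{S}^n\subset\mathbb{R}^{n+1}$, and $\mathbb{S}^n_-=\{N\in\mathbb{S}^n:N\cdot e_{n+1}<0\}$ is the open lower half-sphere, where $e_{n+1}$ is the last standard basis vector. A convex function is differentiable almost everywhere on the interior of its domain, and the boundary of the (convex) domain has Lebesgue measure zero, so $\nabla u(x)$ is defined for a.e. $x\in\mathrm{dom}(u)$. *)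

theory Defs
  imports "HOL-Analysis.Analysis"
begin

section \<open>Spaces of convex functions\<close>

text \<open>Functions with values in \<open>(-\<infinity>, \<infinity>]\<close> are \<^typ>\<open>ereal\<close>-valued functions that avoid \<open>-\<infinity>\<close>.
  In \<^typ>\<open>ereal\<close> one has \<open>0 * \<infinity> = 0\<close>, so the endpoints of \<open>{0..1}\<close> are harmless in \<open>ereal_convex\<close>.\<close>

definition ereal_convex :: "('a::real_vector \<Rightarrow> ereal) \<Rightarrow> bool" where
  "ereal_convex u \<longleftrightarrow>
     (\<forall>x y. \<forall>t\<in>{0..1::real}.
        u ((1 - t) *\<^sub>R x + t *\<^sub>R y) \<le> ereal (1 - t) * u x + ereal t * u y)"

definition lower_semicont :: "('a::topological_space \<Rightarrow> ereal) \<Rightarrow> bool" where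
  "lower_semicont u \<longleftrightarrow> (\<forall>x. u x \<le> Liminf (at x) u)"

definition edom :: "('a \<Rightarrow> ereal) \<Rightarrow> 'a set" where
  "edom u = {x. u x < \<infinity>}"

definition Conv :: "('a::euclidean_space \<Rightarrow> ereal) set" where
  "Conv = {u. (\<forall>x. u x \<noteq> -\<infinity>) \<and> (\<exists>x. u x \<noteq> \<infinity>) \<and> ereal_convex u \<and> lower_semicont u}"

definition Conv_sc :: "('a::euclidean_space \<Rightarrow> ereal) set" where
  "Conv_sc = {u \<in> Conv. ((\<lambda>x. u x / ereal (norm x)) \<longlongrightarrow> \<infinity>) at_infinity}"

definition Conv_cd :: "('a::euclidean_space \<Rightarrow> ereal) set" where
  "Conv_cd = {u \<in> Conv_sc. compact (edom u)}"

definition epi_converges ::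
    "(nat \<Rightarrow> 'a::topological_space \<Rightarrow> ereal) \<Rightarrow> ('a \<Rightarrow> ereal) \<Rightarrow> bool" where
  "epi_converges U u \<longleftrightarrow>
     (\<forall>x. (\<forall>X. X \<longlonglongrightarrow> x \<longrightarrow> u x \<le> liminf (\<lambda>j. U j (X j))) \<and>
          (\<exists>X. X \<longlonglongrightarrow> x \<and> (\<lambda>j. U j (X j)) \<longlonglongrightarrow> u x))"


section \<open>Functionals on \<open>Conv_cd\<close>\<close>

text \<open>A functional on \<open>Conv_cd\<close> is a total function of which only the values on \<open>Conv_cd\<close> matter.
  The topology of epi-convergence being metrizable, continuity is sequential continuity.\<close>

definition epi_continuous :: "(('a::euclidean_space \<Rightarrow> ereal) \<Rightarrow> real) \<Rightarrow> bool" where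
  "epi_continuous Z \<longleftrightarrow>
     (\<forall>U u. (\<forall>j. U j \<in> Conv_cd) \<and> u \<in> Conv_cd \<and> epi_converges U u
        \<longrightarrow> (\<lambda>j. Z (U j)) \<longlonglongrightarrow> Z u)"

definition valuation :: "(('a::euclidean_space \<Rightarrow> ereal) \<Rightarrow> real) \<Rightarrow> bool" where
  "valuation Z \<longleftrightarrow>
     (\<forall>u\<in>Conv_cd. \<forall>v\<in>Conv_cd.
        (\<lambda>x. min (u x) (v x)) \<in> Conv_cd \<and> (\<lambda>x. max (u x) (v x)) \<in> Conv_cd
        \<longrightarrow> Z (\<lambda>x. min (u x) (v x)) + Z (\<lambda>x. max (u x) (v x)) = Z u + Z v)"

definition epi_translation_invariant :: "(('a::euclidean_space \<Rightarrow> ereal) \<Rightarrow> real) \<Rightarrow> bool" where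
  "epi_translation_invariant Z \<longleftrightarrow>
     (\<forall>u\<in>Conv_cd. \<forall>x. \<forall>c::real. Z (\<lambda>y. u (y - x) + ereal c) = Z u)"

definition epi_homogeneous :: "nat \<Rightarrow> (('a::euclidean_space \<Rightarrow> ereal) \<Rightarrow> real) \<Rightarrow> bool" where
  "epi_homogeneous i Z \<longleftrightarrow>
     (\<forall>u\<in>Conv_cd. \<forall>t>0. Z (\<lambda>x. ereal t * u (x /\<^sub>R t)) = t ^ i * Z u)"


section \<open>Convex bodies and surface area measures\<close>

definition convex_bodies :: "'b::euclidean_space set set" where
  "convex_bodies = {K. K \<noteq> {} \<and> compact K \<and> convex K}"

definition lower_boundary_fun :: "('a \<times> real) set \<Rightarrow> 'a \<Rightarrow> ereal" (\<open>\<lfloor>_\<rfloor>\<^sub>b\<close>) where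
  "\<lfloor>K\<rfloor>\<^sub>b = (\<lambda>x. INF t\<in>{t. (x, t) \<in> K}. ereal t)"

text \<open>The points at distance in \<open>(0, \<rho>]\<close> from \<open>K\<close> whose metric projection to \<open>K\<close> leaves \<open>K\<close>
  in a direction belonging to \<open>\<omega>\<close>.\<close>

definition local_parallel_set ::
    "'b::euclidean_space set \<Rightarrow> real \<Rightarrow> 'b set \<Rightarrow> 'b set" where
  "local_parallel_set K \<rho> \<omega> =
     {x. 0 < infdist x K \<and> infdist x K \<le> \<rho> \<and>
         (x - closest_point K x) /\<^sub>R infdist x K \<in> \<omega>}"

text \<open>In a space of dimension \<open>d\<close> the local Steiner formula reads
  \<open>vol (local_parallel_set K \<rho> \<omega>) = (1/d) * (\<Sum>m<d. \<rho>^(d-m) * (d choose m) * S_m(K,\<omega>))\<close>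
  and defines the area measures \<open>S_0(K,\<cdot>), \<dots>, S_{d-1}(K,\<cdot>)\<close>. The top one, the surface area measure,
  is therefore the coefficient of \<open>\<rho>\<close>, that is, the limit below.
  This covers bodies with empty interior: if \<open>K\<close> is \<open>(d-1)\<close>-dimensional with unit normals \<open>v, -v\<close>,
  the measure is \<open>H^{d-1}(K)\<close> times the sum of the Dirac measures at \<open>v\<close> and \<open>-v\<close>; if \<open>dim K < d-1\<close>,
  it is zero.\<close>

definition surface_area_measure :: "'b::euclidean_space set \<Rightarrow> 'b measure" where
  "surface_area_measure K =
     measure_of (sphere 0 1) (sets (restrict_space borel (sphere 0 1)))
       (\<lambda>\<omega>. Lim (at_right 0)
              (\<lambda>\<rho>. emeasure lborel (local_parallel_set K \<rho> \<omega>) / ennreal \<rho>))"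

definition lower_half_sphere :: "('a::euclidean_space \<times> real) set" where
  "lower_half_sphere = {N \<in> sphere 0 1. N \<bullet> (0, 1) < 0}"


section \<open>Gradients\<close>

text \<open>Only meaningful where \<open>u\<close> is differentiable, which is almost everywhere on \<open>edom u\<close> for
  \<open>u \<in> Conv\<close>. The conversion \<^const>\<open>real_of_ereal\<close> sends \<open>\<infinity>\<close> to \<open>0\<close>; in the interior of \<open>edom u\<close> this
  plays no role, and the boundary of \<open>edom u\<close> is a null set.\<close>

definition grad :: "('a::euclidean_space \<Rightarrow> ereal) \<Rightarrow> 'a \<Rightarrow> 'a" where
  "grad u x = (THE D. GDERIV (\<lambda>y. real_of_ereal (u y)) x :> D)"

end

theory Submission
  imports Defs "HOL-Complex_Analysis.Great_Picard"
begin

text \<open>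
  For fixed \<open>y\<close> write \<open>\<zeta> y\<close> for the value of \<open>Z\<close> on the linear function with slope \<open>y\<close> over the
  half-open unit cube, half-open cubes being handled by inclusion and exclusion. Cutting the domain
  of a Lipschitz function \<open>u\<close> along a grid of mesh \<open>\<epsilon>\<close> and rescaling each cell to unit size,
  homogeneity of degree \<open>n\<close> turns \<open>Z u\<close> into the integral of a step function. Its value at \<open>x\<close> is
  \<open>Z\<close> of a blow-up of \<open>u\<close> near \<open>x\<close>, so it tends to \<open>\<zeta> (\<nabla>u x)\<close> wherever \<open>u\<close> is differentiable, and
  it is bounded because the blow-ups range over an epi-compact family. Dominated convergence gives
  \<open>Z u = \<integral> \<zeta> (\<nabla>u)\<close>, and the restrictions to \<open>dom u\<close> of the Lipschitz envelopes of \<open>u\<close> carry this over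
  to all \<open>u\<close>. If \<open>\<zeta>\<close> did not vanish near infinity, linear functions of slopes \<open>y\<^sub>k\<close> tending to infinity on
  cylinders of length about \<open>1 / \<bar>\<zeta> y\<^sub>k\<bar>\<close> in direction \<open>y\<^sub>k\<close> would epi-converge to the indicator of
  a disc, on which \<open>Z\<close> vanishes, while the values of \<open>Z\<close> stay away from zero.

  For the surface area measure, let \<open>d\<close> be the distance to \<open>K\<close> and \<open>\<nu>\<close> its gradient outside of \<open>K\<close>.
  Since \<open>\<nu>\<close> is monotone, \<open>x \<mapsto> x + h \<nu> x\<close> is expanding and maps the part of the shell \<open>a < d \<le> b\<close> with
  normals in \<open>\<omega>\<close> onto the part of the shell \<open>a + h < d \<le> b + h\<close> with normals in \<open>\<omega>\<close>. The volume of
  the local parallel set is therefore convex in the radius, so that the quotient that defines the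
  measure decreases with the radius; this yields its limit and countable additivity. Integrals
  against it are computed by Fubini, blowing up vertical lines at points of differentiability.
\<close>

section \<open>Surface area measures\<close>

text \<open>Nothing is known beforehand about \<open>Z\<close> on functions with lower-dimensional
  domain, so when a function is cut along a hyperplane, the term on the hyperplane cannot be
  dropped. Inclusion and exclusion carries these terms along and makes half-open cells exactly
  additive; only the resulting formula for linear functions shows that \<open>Z\<close> vanishes on
  a disc. The integral over the domain is proved for all of \<open>Conv_cd\<close>, and the integral
  over the sphere is deduced from it: a function of \<open>Conv_cd\<close> may be unbounded above on
  its domain and is then the lower boundary of no body. Lipschitz functions precede general ones
  because their blow-ups have uniformly bounded oscillation. The passage to general functions relies
  on boundedness of \<open>\<zeta>\<close>, which is obtained from linear functions alone. The
  surface area measure is given by \<open>measure_of\<close>, which yields the zero measure unless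
  the prescribed set function is a measure. Existence of the limit is therefore not enough;
  countable additivity has to be established as well.\<close>

lemma emeasure_UN_countable_le:
  assumes X: "\<And>i. i \<in> I \<Longrightarrow> X i \<in> sets M" and I: "countable I"
  shows "emeasure M (\<Union>i\<in>I. X i) \<le> (\<integral>\<^sup>+i. emeasure M (X i) \<partial>count_space I)"
proof -
  have U: "(\<Union>i\<in>I. X i) \<in> sets M" using X I by (intro sets.countable_UN') auto
  have le: "indicator (\<Union>i\<in>I. X i) x \<le> (\<integral>\<^sup>+ i. indicator (X i) x \<partial>count_space I)" for x
  proof (cases "x \<in> (\<Union>i\<in>I. X i)")
    case True
    then obtain j where j: "j \<in> I" "x \<in> X j" by blast
    have "(1::ennreal) = (\<integral>\<^sup>+ i. indicator {j} i \<partial>count_space I)"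
      using j by simp
    also have "\<dots> \<le> (\<integral>\<^sup>+ i. indicator (X i) x \<partial>count_space I)"
      using j by (intro nn_integral_mono) (auto simp: indicator_def)
    finally show ?thesis using True by simp
  qed simp
  have "emeasure M (\<Union>i\<in>I. X i) \<le> (\<integral>\<^sup>+ x. \<integral>\<^sup>+ i. indicator (X i) x \<partial>count_space I \<partial>M)"
    unfolding nn_integral_indicator[OF U, symmetric] by (rule nn_integral_mono) (rule le)
  also have "\<dots> = (\<integral>\<^sup>+ i. \<integral>\<^sup>+ x. indicator (X i) x \<partial>M \<partial>count_space I)"
    using X I by (intro nn_integral_count_space_nn_integral) auto
  also have "\<dots> = (\<integral>\<^sup>+i. emeasure M (X i) \<partial>count_space I)"
    using X by (intro nn_integral_cong) auto
  finally show ?thesis .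
qed

text \<open>Vitali's theorem covers \<open>A\<close> up to a null set by disjoint balls centred in
  \<open>A\<close> and contained in an open set of nearly the same measure. The part of
  \<open>A\<close> in such a ball is mapped into the ball of the same radius about the image of its
  centre, and \<open>f\<close> maps null sets to null sets.\<close>

lemma emeasure_lipschitz_image_le:
  fixes f :: "'a::euclidean_space \<Rightarrow> 'a"
  assumes A: "A \<in> sets lebesgue"
    and f: "\<And>x y. x \<in> A \<Longrightarrow> y \<in> A \<Longrightarrow> dist (f x) (f y) \<le> dist x y"
  shows "emeasure lebesgue (f ` A) \<le> emeasure lebesgue A"
proof (cases "f ` A \<in> sets lebesgue")
  case fA: True
  show ?thesis
  proof (rule ennreal_le_epsilon)
    fix e :: real assume e: "e > 0"
    obtain U where U: "open U" "A \<subseteq> U" "U - A \<in> lmeasurable" "emeasure lebesgue (U - A) < ennreal e"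
      using sets_lebesgue_outer_open[OF A e] .
    define K where "K = {(x, r). x \<in> A \<and> 0 < r \<and> ball x r \<subseteq> U}"
    have ex: "\<exists>i. i \<in> K \<and> x \<in> ball (fst i) (snd i) \<and> snd i < d" if "x \<in> A" "0 < d" for x d
    proof -
      obtain r where r: "0 < r" "ball x r \<subseteq> U"
        using U(1,2) \<open>x \<in> A\<close> open_contains_ball by (metis subsetD)
      define s where "s = min r (d/2)"
      have "0 < s" "s < d" "s \<le> r" using r(1) that by (auto simp: s_def)
      moreover have "ball x s \<subseteq> U" using \<open>s \<le> r\<close> r(2) by (meson order_trans subset_ball)
      ultimately show ?thesis using \<open>x \<in> A\<close> by (intro exI[of _ "(x, s)"]) (auto simp: K_def)
    qed
    obtain C where C: "countable C" "C \<subseteq> K"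
      and dis: "pairwise (\<lambda>i j. disjnt (ball (fst i) (snd i)) (ball (fst j) (snd j))) C"
      and neg: "negligible (A - (\<Union>i\<in>C. ball (fst i) (snd i)))"
      using Vitali_covering_theorem_balls[of A K fst snd, OF ex] by blast
    have neg': "negligible (f ` (A - (\<Union>i\<in>C. ball (fst i) (snd i))))"
    proof (rule negligible_locally_Lipschitz_image[OF _ neg])
      fix x assume x: "x \<in> A - (\<Union>i\<in>C. ball (fst i) (snd i))"
      show "\<exists>T B. open T \<and> x \<in> T \<and> (\<forall>y\<in>(A - (\<Union>i\<in>C. ball (fst i) (snd i))) \<inter> T. norm (f y - f x) \<le> B * norm (y - x))"
        using f x by (intro exI[of _ UNIV] exI[of _ 1]) (auto simp: dist_norm)
    qed simp
    have sub: "f ` A \<subseteq> f ` (A - (\<Union>i\<in>C. ball (fst i) (snd i))) \<union> (\<Union>i\<in>C. ball (f (fst i)) (snd i))"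
    proof clarify
      fix x assume x: "x \<in> A" and nb: "f x \<notin> (\<Union>i\<in>C. ball (f (fst i)) (snd i))"
      have "x \<notin> ball (fst i) (snd i)" if "i \<in> C" for i
      proof
        assume b: "x \<in> ball (fst i) (snd i)"
        have "fst i \<in> A" using C(2) that by (auto simp: K_def)
        then have "f x \<in> ball (f (fst i)) (snd i)" using f[of "fst i" x] x b by auto
        then show False using nb that by blast
      qed
      then show "f x \<in> f ` (A - (\<Union>i\<in>C. ball (fst i) (snd i)))" using x by blast
    qed
    have meas: "(\<Union>i\<in>C. ball (f (fst i)) (snd i)) \<in> sets lebesgue"
      using C(1) by (intro sets.countable_UN') auto
    have "emeasure lebesgue (f ` A) \<le> emeasure lebesgue (f ` (A - (\<Union>i\<in>C. ball (fst i) (snd i))) \<union> (\<Union>i\<in>C. ball (f (fst i)) (snd i)))"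
      by (rule emeasure_mono[OF sub]) (use neg' meas in \<open>auto intro!: sets.Un simp: negligible_imp_sets\<close>)
    also have "\<dots> \<le> emeasure lebesgue (f ` (A - (\<Union>i\<in>C. ball (fst i) (snd i)))) + emeasure lebesgue (\<Union>i\<in>C. ball (f (fst i)) (snd i))"
      by (rule emeasure_subadditive) (use neg' meas in \<open>auto simp: negligible_imp_sets\<close>)
    also have "emeasure lebesgue (f ` (A - (\<Union>i\<in>C. ball (fst i) (snd i)))) = 0"
      using neg' negligible_iff_emeasure0 negligible_imp_sets by blast
    also have "0 + emeasure lebesgue (\<Union>i\<in>C. ball (f (fst i)) (snd i)) \<le> (\<integral>\<^sup>+ i. emeasure lebesgue (ball (f (fst i)) (snd i)) \<partial>count_space C)"
      unfolding add_0 using C(1) by (intro emeasure_UN_countable_le) auto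
    also have "\<dots> = (\<integral>\<^sup>+ i. emeasure lebesgue (ball (fst i) (snd i)) \<partial>count_space C)"
      using C(2) by (intro nn_integral_cong) (auto simp: K_def emeasure_ball)
    also have "\<dots> = emeasure lebesgue (\<Union>i\<in>C. ball (fst i) (snd i))"
      using C(1) dis
      by (intro emeasure_UN_countable[symmetric])
        (auto simp: disjoint_family_on_def pairwise_def disjnt_def)
    also have "\<dots> \<le> emeasure lebesgue U"
      using C(2) U(1) by (intro emeasure_mono) (auto simp: K_def simp del: mem_ball, blast)
    also have "\<dots> = emeasure lebesgue A + emeasure lebesgue (U - A)"
      using A U by (subst plus_emeasure) (auto intro!: arg_cong[where f="emeasure lebesgue"] simp: Un_absorb1)
    also have "\<dots> \<le> emeasure lebesgue A + ennreal e"
      using U(4) by (intro add_left_mono) auto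
    finally show "emeasure lebesgue (f ` A) \<le> emeasure lebesgue A + ennreal e" .
  qed
\<comment> \<open>\<open>emeasure\<close> is 0 on a set that is not measurable, so this case is
  trivial.\<close>
qed (simp add: emeasure_notin_sets)

text \<open>Growing increments stand for convexity. Cut \<open>[0, s]\<close> into \<open>N\<close>
  steps of length \<open>h\<close>: the last increment \<open>c\<close> dominates the earlier ones,
  whence \<open>G s \<le> N * c\<close>, and is dominated by each later one, whence \<open>G\<close>
  grows beyond \<open>s\<close> by at least \<open>c\<close> per step. Rounding the number of steps
  between \<open>s\<close> and \<open>r\<close> costs \<open>G s / N\<close>, which disappears in
  the limit; monotonicity of \<open>G\<close> bridges the gap between the last step and
  \<open>r\<close>.\<close>

lemma slope_mono_of_increments:
  fixes G :: "real \<Rightarrow> real"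
  assumes G0: "G 0 = 0"
    and mono: "\<And>a b. 0 \<le> a \<Longrightarrow> a \<le> b \<Longrightarrow> G a \<le> G b"
    and inc: "\<And>a b h. 0 \<le> a \<Longrightarrow> a \<le> b \<Longrightarrow> 0 \<le> h \<Longrightarrow> G b - G a \<le> G (b + h) - G (a + h)"
    and "0 < s" "s \<le> r"
  shows "G s / s \<le> G r / r"
proof -
  have step: "G s * (r - s) / s - G s / real N \<le> G r - G s" if N: "N > 0" for N :: nat
  proof -
    define h where "h = s / N"
    have h: "h > 0" using \<open>0 < s\<close> N by (simp add: h_def)
    have sN: "s = N * h" using N by (simp add: h_def)
    define c where "c = G s - G (s - h)"
    have hs: "h \<le> s" using N \<open>0 < s\<close> by (simp add: h_def divide_le_eq)
    have low: "G (real k * h) \<le> real k * c" if "k \<le> N" for k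
      using that
    proof (induction k)
      case (Suc k)
      have "real (Suc k) * h \<le> real N * h" using Suc.prems h by (intro mult_right_mono) auto
      then have kn: "real k * h \<le> s - h" by (simp add: sN algebra_simps)
      have "G (real k * h + h) - G (real k * h) \<le> c"
        using inc[of "real k * h" "real k * h + h" "s - h - real k * h"] h kn by (simp add: c_def)
      then show ?case using Suc by (simp add: algebra_simps)
    qed (simp add: G0)
    have up: "G s + real m * c \<le> G (s + real m * h)" for m
    proof (induction m)
      case (Suc m)
      have "c \<le> G (s + real m * h + h) - G (s + real m * h)"
        using inc[of "s - h" s "h + real m * h"] h hs by (simp add: c_def algebra_simps)
      then show ?case using Suc by (simp add: algebra_simps)
    qed simp
    have Gc: "G s \<le> N * c" using low[of N] sN by simp
    have c0: "c \<ge> 0" using mono[of "s - h" s] hs h by (simp add: c_def)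
    define m where "m = nat \<lfloor>(r - s) / h\<rfloor>"
    have m: "real m \<le> (r - s) / h" "(r - s) / h - 1 \<le> real m"
      using h \<open>s \<le> r\<close> by (auto simp: m_def)
    have "s + real m * h \<le> r" using m(1) h by (simp add: field_simps)
    then have "G (s + real m * h) \<le> G r" using h \<open>0 < s\<close> by (intro mono) auto
    with up[of m] have "real m * c \<le> G r - G s" by linarith
    moreover have "real m * c \<ge> ((r - s) / h - 1) * c" using m(2) c0 by (rule mult_right_mono)
    moreover have "(r - s) / h * c - c = ((r - s) / s - 1 / N) * (N * c)"
      using N \<open>0 < s\<close> by (simp add: h_def field_simps)
    moreover have "((r - s) / s - 1 / N) * (N * c) \<ge> ((r - s) / s - 1 / N) * G s" if "(r - s) / s - 1 / N \<ge> 0"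
      using Gc that by (rule mult_left_mono)
    moreover have "((r - s) / s - 1 / N) * G s \<le> 0" if "(r - s) / s - 1 / N < 0"
      using mono[of 0 s] \<open>0 < s\<close> G0 that by (simp add: mult_nonpos_nonneg)
    moreover have "G r - G s \<ge> 0" using mono \<open>0 < s\<close> \<open>s \<le> r\<close> by simp
    ultimately have "((r - s) / s - 1 / N) * G s \<le> G r - G s"
      by (cases "(r - s) / s - 1 / N \<ge> 0") (auto simp: algebra_simps)
    then show ?thesis using \<open>0 < s\<close> by (simp add: algebra_simps diff_divide_distrib)
  qed
  have "(\<lambda>N. G s * (r - s) / s - G s / real N) \<longlonglongrightarrow> G s * (r - s) / s - 0"
    by (intro tendsto_intros lim_const_over_n)
  then have "G s * (r - s) / s - 0 \<le> G r - G s"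
    by (rule LIMSEQ_le_const2) (use step in \<open>auto intro!: exI[of _ 1]\<close>)
  then have "G s * r / s \<le> G r" using \<open>0 < s\<close> by (simp add: field_simps)
  then show ?thesis using assms(4,5) by (simp add: field_simps)
qed

text \<open>With \<open>a = 0\<close> this is \<open>local_parallel_set\<close>; a positive inner
  radius serves to express increments of its volume.\<close>

definition shell :: "'b::euclidean_space set \<Rightarrow> real \<Rightarrow> real \<Rightarrow> 'b set \<Rightarrow> 'b set" where
  "shell K a b \<omega> = {x. a < infdist x K \<and> infdist x K \<le> b \<and>
     (x - closest_point K x) /\<^sub>R infdist x K \<in> \<omega>}"

section \<open>Metric projection onto a convex body and its unit normals\<close>

lemma closest_pointI:
  assumes "convex S" "closed S" "p \<in> S" "\<And>y. y \<in> S \<Longrightarrow> (x - p) \<bullet> (y - p) \<le> 0"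
  shows "closest_point S x = p"
proof -
  have "dist x p \<le> dist x z" if "z \<in> S" for z
  proof -
    have "(norm (x - z))\<^sup>2 = (norm (x - p))\<^sup>2 - 2 * ((x - p) \<bullet> (z - p)) + (norm (z - p))\<^sup>2"
      by (simp add: power2_norm_eq_inner algebra_simps inner_commute)
    also have "\<dots> \<ge> (norm (x - p))\<^sup>2" using assms(4)[OF that] zero_le_power2[of "norm (z - p)"] by linarith
    finally show ?thesis by (simp add: dist_norm power2_le_iff_abs_le)
  qed
  then show ?thesis using closest_point_unique[OF assms(1-3)] by simp
qed

lemma infdist_closest_point:
  assumes "closed S" "S \<noteq> {}"
  shows "infdist x S = norm (x - closest_point S x)"
  using setdist_closest_point[OF assms] by (simp add: infdist_eq_setdist dist_norm)

locale convex_body =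
  fixes K :: "'b::euclidean_space set"
  assumes K_ne: "K \<noteq> {}" and K_compact: "compact K" and K_convex: "convex K"
begin

abbreviation "d x \<equiv> infdist x K"
abbreviation "p \<equiv> closest_point K"
definition "\<nu> x = (x - p x) /\<^sub>R d x"

lemma K_closed: "closed K" using K_compact by (rule compact_imp_closed)

lemma d_eq: "d x = norm (x - p x)"
  by (rule infdist_closest_point[OF K_closed K_ne])

lemma p_in: "p x \<in> K"
  by (rule closest_point_in_set[OF K_closed K_ne])

lemma p_dot: "y \<in> K \<Longrightarrow> (x - p x) \<bullet> (y - p x) \<le> 0"
  by (rule closest_point_dot[OF K_convex K_closed])

lemma d_pos_iff: "0 < d x \<longleftrightarrow> x \<notin> K"
  using infdist_pos_not_in_closed[OF K_closed K_ne] by auto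

lemma eq_p_plus: "0 < d x \<Longrightarrow> x = p x + d x *\<^sub>R \<nu> x"
  by (simp add: \<nu>_def)

lemma norm_nu: "0 < d x \<Longrightarrow> norm (\<nu> x) = 1"
  by (simp add: \<nu>_def d_eq)

lemma nu_dot: "0 < d x \<Longrightarrow> y \<in> K \<Longrightarrow> \<nu> x \<bullet> (y - p x) \<le> 0"
  using p_dot[of y x] by (simp add: \<nu>_def mult_nonneg_nonpos)

text \<open>The variational inequality at \<open>p x\<close> depends only on the direction of
  \<open>x - p x\<close>, so \<open>p x\<close> remains the projection along the whole open ray that
  starts at \<open>p x\<close>.\<close>

lemma move_along:
  assumes x: "0 < d x" and c: "d x + c > 0"
  shows "p (x + c *\<^sub>R \<nu> x) = p x" "d (x + c *\<^sub>R \<nu> x) = d x + c" "\<nu> (x + c *\<^sub>R \<nu> x) = \<nu> x"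
proof -
  have e: "x + c *\<^sub>R \<nu> x - p x = (d x + c) *\<^sub>R \<nu> x"
    using eq_p_plus[OF x] by (metis (no_types, lifting) add.commute add_diff_cancel_left' group_cancel.add1 scaleR_left_distrib)
  show p: "p (x + c *\<^sub>R \<nu> x) = p x"
  proof (rule closest_pointI[OF K_convex K_closed p_in])
    fix y assume "y \<in> K"
    then show "(x + c *\<^sub>R \<nu> x - p x) \<bullet> (y - p x) \<le> 0"
      unfolding e using nu_dot[OF x, of y] c by (simp add: mult_nonneg_nonpos)
  qed
  show d: "d (x + c *\<^sub>R \<nu> x) = d x + c"
    unfolding d_eq[of "x + c *\<^sub>R \<nu> x"] p e using c norm_nu[OF x] by simp
  show "\<nu> (x + c *\<^sub>R \<nu> x) = \<nu> x"
    unfolding \<nu>_def[of "x + c *\<^sub>R \<nu> x"] p d e using c by simp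
qed

text \<open>Substitute \<open>x = p x + d x *\<^sub>R \<nu> x\<close>. The projections contribute
  nonnegative terms by their variational inequalities, and the rest is
  \<open>(d x + d y) * (1 - \<nu> x \<bullet> \<nu> y)\<close>.\<close>

lemma nu_monotone:
  assumes "0 < d x" "0 < d y"
  shows "0 \<le> (x - y) \<bullet> (\<nu> x - \<nu> y)"
proof -
  have 1: "\<nu> x \<bullet> (p y - p x) \<le> 0" "\<nu> y \<bullet> (p x - p y) \<le> 0"
    using nu_dot assms p_in by auto
  have 2: "\<nu> x \<bullet> \<nu> y \<le> 1"
    using norm_cauchy_schwarz[of "\<nu> x" "\<nu> y"] norm_nu assms by simp
  have 3: "\<nu> x \<bullet> \<nu> x = 1" "\<nu> y \<bullet> \<nu> y = 1"
    using norm_nu assms by (simp_all add: dot_square_norm)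
  have "(x - y) \<bullet> (\<nu> x - \<nu> y) =
    ((p x + d x *\<^sub>R \<nu> x) - (p y + d y *\<^sub>R \<nu> y)) \<bullet> (\<nu> x - \<nu> y)"
    using eq_p_plus assms by metis
  also have "\<dots> = - (\<nu> x \<bullet> (p y - p x)) - \<nu> y \<bullet> (p x - p y) + (d x + d y) * (1 - \<nu> x \<bullet> \<nu> y)"
    using 3 by (simp add: algebra_simps inner_commute)
  also have "\<dots> \<ge> 0"
    using 1 mult_nonneg_nonneg[of "d x + d y" "1 - \<nu> x \<bullet> \<nu> y"] 2 assms by simp
  finally show ?thesis .
qed

text \<open>Monotonicity of \<open>\<nu>\<close> makes the mixed term of the expanded square
  nonnegative.\<close>

lemma dist_move_along:
  assumes "0 < d x" "0 < d y" "0 \<le> c"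
  shows "dist x y \<le> dist (x + c *\<^sub>R \<nu> x) (y + c *\<^sub>R \<nu> y)"
proof -
  have "(norm (x - y + c *\<^sub>R (\<nu> x - \<nu> y)))\<^sup>2 =
    (norm (x - y))\<^sup>2 + 2 * c * ((x - y) \<bullet> (\<nu> x - \<nu> y)) + (norm (c *\<^sub>R (\<nu> x - \<nu> y)))\<^sup>2"
    unfolding power2_norm_eq_inner by (simp add: algebra_simps inner_commute)
  then have "(norm (x - y))\<^sup>2 \<le> (norm (x - y + c *\<^sub>R (\<nu> x - \<nu> y)))\<^sup>2"
    using nu_monotone[OF assms(1,2)] \<open>0 \<le> c\<close> by simp
  then have "norm (x - y) \<le> norm (x - y + c *\<^sub>R (\<nu> x - \<nu> y))" by (rule power2_le_imp_le) simp
  then show ?thesis by (simp add: dist_norm algebra_simps)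
qed

lemma shell_eq: "0 \<le> a \<Longrightarrow> shell K a b \<omega> = {x. a < d x \<and> d x \<le> b \<and> \<nu> x \<in> \<omega>}"
  by (simp add: shell_def \<nu>_def)

lemma continuous_on_nu: "continuous_on (- K) \<nu>"
  unfolding \<nu>_def using K_ne d_pos_iff
  by (intro continuous_intros continuous_on_closest_point[OF K_convex K_closed K_ne])
    (auto simp: infdist_nonneg less_le)

lemma borel_shell: 
  assumes "\<omega> \<in> sets borel" "0 \<le> a"
  shows "shell K a b \<omega> \<in> sets borel"
proof -
  have [measurable]: "(\<lambda>x. d x) \<in> borel_measurable borel"
    by (intro borel_measurable_continuous_onI continuous_intros)
  have 1: "{x. a < d x \<and> d x \<le> b} \<in> sets borel"
    by measurable
  have 2: "\<nu> \<in> borel_measurable (restrict_space borel (- K))"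
    using continuous_on_nu by (rule borel_measurable_continuous_on_restrict)
  have "- K \<in> sets borel" using K_closed by auto
  moreover have "\<nu> -` \<omega> \<inter> space (restrict_space borel (- K)) = {x \<in> - K. \<nu> x \<in> \<omega>}"
    unfolding space_restrict_space by auto
  ultimately have "{x \<in> - K. \<nu> x \<in> \<omega>} \<in> sets borel"
    using measurable_sets[OF 2 assms(1)] sets_restrict_space_iff[of "- K" "borel :: 'b measure"] by simp
  with 1 have "{x. a < d x \<and> d x \<le> b} \<inter> {x \<in> - K. \<nu> x \<in> \<omega>} \<in> sets borel" by (rule sets.Int)
  also have "{x. a < d x \<and> d x \<le> b} \<inter> {x \<in> - K. \<nu> x \<in> \<omega>} = shell K a b \<omega>"
    using assms(2) by (force simp: shell_eq d_pos_iff[symmetric])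
  finally show ?thesis .
qed

text \<open>Volumes are compared by maps that do not increase distances, so the outer shell is
  mapped back onto the inner one by \<open>x - h \<nu> x\<close>, the inverse of the expanding
  map.\<close>

lemma shell_shift_le:
  assumes "\<omega> \<in> sets borel" "0 \<le> a" "0 \<le> h"
  shows "emeasure lborel (shell K a b \<omega>) \<le> emeasure lborel (shell K (a + h) (b + h) \<omega>)"
proof -
  let ?S = "shell K (a + h) (b + h) \<omega>"
  have im: "(\<lambda>x. x + (- h) *\<^sub>R \<nu> x) ` ?S = shell K a b \<omega>"
  proof safe
    fix x assume "x \<in> ?S"
    then show "x + (- h) *\<^sub>R \<nu> x \<in> shell K a b \<omega>"
      using assms move_along[of x "- h"] by (auto simp: shell_eq)
  next
    fix x assume x: "x \<in> shell K a b \<omega>"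
    then have "x + h *\<^sub>R \<nu> x \<in> ?S" "x = (x + h *\<^sub>R \<nu> x) + (- h) *\<^sub>R \<nu> (x + h *\<^sub>R \<nu> x)"
      using assms move_along[of x h] by (auto simp: shell_eq)
    then show "x \<in> (\<lambda>x. x + (- h) *\<^sub>R \<nu> x) ` ?S" by blast
  qed
  have "emeasure lebesgue ((\<lambda>x. x + (- h) *\<^sub>R \<nu> x) ` ?S) \<le> emeasure lebesgue ?S"
  proof (rule emeasure_lipschitz_image_le)
    show "?S \<in> sets lebesgue" using borel_shell[OF assms(1), of "a + h"] assms by simp
    fix x y assume xy: "x \<in> ?S" "y \<in> ?S"
    then have "0 < d x - h" "0 < d y - h" "0 < d x" "0 < d y" using assms by (auto simp: shell_eq)
    then show "dist (x + (- h) *\<^sub>R \<nu> x) (y + (- h) *\<^sub>R \<nu> y) \<le> dist x y"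
      using dist_move_along[of "x + (- h) *\<^sub>R \<nu> x" "y + (- h) *\<^sub>R \<nu> y" h] assms
        move_along[of x "- h"] move_along[of y "- h"] by simp
  qed
  then show ?thesis
    unfolding im using borel_shell assms by simp
qed

section \<open>Volume of the local parallel set as a function of the radius\<close>

definition shell_volume :: "'b set \<Rightarrow> real \<Rightarrow> real" where "shell_volume \<omega> r = measure lborel (shell K 0 r \<omega>)"

lemma shell_finite: "0 \<le> a \<Longrightarrow> emeasure lborel (shell K a b \<omega>) < \<infinity>"
proof -
  assume "0 \<le> a"
  obtain R where R: "\<And>x. x \<in> K \<Longrightarrow> norm x \<le> R"
    using K_compact compact_imp_bounded bounded_iff by metis
  have "norm x \<le> R + b" if "x \<in> shell K a b \<omega>" for x
    using R[OF p_in[of x]] norm_triangle_ineq[of "p x" "x - p x"] that \<open>0 \<le> a\<close>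
    by (auto simp: shell_eq d_eq)
  then have "bounded (shell K a b \<omega>)" unfolding bounded_iff by blast
  then show ?thesis by (rule emeasure_bounded_finite)
qed

lemma emeasure_shell: "emeasure lborel (shell K 0 r \<omega>) = ennreal (shell_volume \<omega> r)"
  unfolding shell_volume_def using shell_finite[of 0 r \<omega>] by (intro emeasure_eq_ennreal_measure) auto

lemma shell_volume_diff:
  assumes "\<omega> \<in> sets borel" "0 \<le> a" "a \<le> b"
  shows "shell_volume \<omega> b - shell_volume \<omega> a = measure lborel (shell K a b \<omega>)"
proof -
  have "shell K 0 b \<omega> = shell K 0 a \<omega> \<union> shell K a b \<omega>" "shell K 0 a \<omega> \<inter> shell K a b \<omega> = {}"
    using assms by (auto simp: shell_eq)
  moreover have "emeasure lborel (shell K 0 a \<omega>) \<noteq> \<infinity>" "emeasure lborel (shell K a b \<omega>) \<noteq> \<infinity>"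
    using shell_finite[of 0 a \<omega>] shell_finite[of a b \<omega>] assms by auto
  ultimately have "measure lborel (shell K 0 b \<omega>) = measure lborel (shell K 0 a \<omega>) + measure lborel (shell K a b \<omega>)"
    using assms borel_shell[OF assms(1)] by (simp add: measure_Union)
  then show ?thesis by (simp add: shell_volume_def)
qed

lemma shell_volume_slope_mono:
  assumes w: "\<omega> \<in> sets borel" and "0 < s" "s \<le> r"
  shows "shell_volume \<omega> s / s \<le> shell_volume \<omega> r / r"
proof (rule slope_mono_of_increments[OF _ _ _ assms(2,3)])
  have "shell K 0 0 \<omega> = {}" by (auto simp: shell_def)
  then show "shell_volume \<omega> 0 = 0" by (simp add: shell_volume_def)
  show "shell_volume \<omega> a \<le> shell_volume \<omega> b" if "0 \<le> a" "a \<le> b" for a b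
    using shell_volume_diff[OF w that] measure_nonneg[of lborel "shell K a b \<omega>"] by linarith
  show "shell_volume \<omega> b - shell_volume \<omega> a \<le> shell_volume \<omega> (b + h) - shell_volume \<omega> (a + h)" if "0 \<le> a" "a \<le> b" "0 \<le> h" for a b h
  proof -
    have "measure lborel (shell K a b \<omega>) \<le> measure lborel (shell K (a + h) (b + h) \<omega>)"
      using shell_shift_le[OF w that(1,3), of b] shell_finite[of "a + h" "b + h" \<omega>] that
      by (auto simp: measure_def intro!: enn2real_mono)
    then show ?thesis using that by (simp add: shell_volume_diff[OF w])
  qed
qed

lemma shell_volume_nonneg: "0 \<le> shell_volume \<omega> r" by (simp add: shell_volume_def)

text \<open>As the quotients are monotone in the radius, the limit at 0 is an infimum, and the radii
  \<open>1 / Suc k\<close> suffice. This countable form is the one to which monotone convergence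
  applies.\<close>

definition surface_area :: "'b set \<Rightarrow> ennreal" where "surface_area \<omega> = (INF k. ennreal (shell_volume \<omega> (1 / Suc k) / (1 / Suc k)))"

lemma decseq_shell_volume: "\<omega> \<in> sets borel \<Longrightarrow> decseq (\<lambda>k. ennreal (shell_volume \<omega> (1 / Suc k) / (1 / Suc k)))"
  by (intro decseq_SucI ennreal_leI shell_volume_slope_mono) (auto simp: field_simps)

lemma surface_area_lim: "\<omega> \<in> sets borel \<Longrightarrow> (\<lambda>k. ennreal (shell_volume \<omega> (1 / Suc k) / (1 / Suc k))) \<longlonglongrightarrow> surface_area \<omega>"
  unfolding surface_area_def by (intro LIMSEQ_INF decseq_shell_volume)

lemma surface_area_le: "\<omega> \<in> sets borel \<Longrightarrow> 0 < r \<Longrightarrow> surface_area \<omega> \<le> ennreal (shell_volume \<omega> r / r)"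
proof -
  assume w: "\<omega> \<in> sets borel" and r: "0 < r"
  obtain k where k: "1 / Suc k < r" using r reals_Archimedean by (metis inverse_eq_divide)
  have "surface_area \<omega> \<le> ennreal (shell_volume \<omega> (1 / Suc k) / (1 / Suc k))" unfolding surface_area_def by (rule INF_lower) simp
  also have "\<dots> \<le> ennreal (shell_volume \<omega> r / r)"
    using k by (intro ennreal_leI shell_volume_slope_mono w) auto
  finally show ?thesis .
qed

lemma surface_area_tendsto:
  assumes w: "\<omega> \<in> sets borel"
  shows "((\<lambda>r. emeasure lborel (local_parallel_set K r \<omega>) / ennreal r) \<longlongrightarrow> surface_area \<omega>) (at_right 0)"
proof -
  have eq: "emeasure lborel (local_parallel_set K r \<omega>) / ennreal r = ennreal (shell_volume \<omega> r / r)" if "0 < r" for r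
    using that emeasure_shell[of r \<omega>] shell_volume_nonneg[of \<omega> r]
    by (simp add: local_parallel_set_def shell_def divide_ennreal)
  have "((\<lambda>r. ennreal (shell_volume \<omega> r / r)) \<longlongrightarrow> surface_area \<omega>) (at_right 0)"
  proof (rule order_tendstoI)
    fix a assume "a < surface_area \<omega>"
    then show "\<forall>\<^sub>F r in at_right 0. a < ennreal (shell_volume \<omega> r / r)"
      using surface_area_le[OF w] by (auto intro!: eventually_mono[OF eventually_at_right_less] elim: less_le_trans)
  next
    fix a assume "surface_area \<omega> < a"
    then obtain k where k: "ennreal (shell_volume \<omega> (1 / Suc k) / (1 / Suc k)) < a"
      unfolding surface_area_def by (auto simp: INF_less_iff)
    have "\<forall>\<^sub>F r in at_right 0. r < 1 / real (Suc k)"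
      by (auto simp: eventually_at_right_field intro!: exI[of _ "1 / real (Suc k)"])
    then show "\<forall>\<^sub>F r in at_right 0. ennreal (shell_volume \<omega> r / r) < a"
      using eventually_at_right_less[of 0]
    proof eventually_elim
      case (elim r)
      then have "ennreal (shell_volume \<omega> r / r) \<le> ennreal (shell_volume \<omega> (1 / Suc k) / (1 / Suc k))"
        by (intro ennreal_leI shell_volume_slope_mono w) auto
      then show ?case using k by (rule le_less_trans)
    qed
  qed
  then show ?thesis
    by (rule Lim_transform_eventually) (auto intro!: eventually_mono[OF eventually_at_right_less] simp: eq)
qed

section \<open>The surface area measure as a measure on the sphere\<close>

abbreviation "\<Sigma> \<equiv> sets (restrict_space borel (sphere 0 1) :: 'b measure)"

lemma sphere_sets: "\<omega> \<in> \<Sigma> \<longleftrightarrow> \<omega> \<subseteq> sphere 0 1 \<and> \<omega> \<in> sets borel"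
  by (subst sets_restrict_space_iff) auto

lemma shell_volume_countably_additive:
  assumes "range A \<subseteq> sets borel" "disjoint_family A" "0 < r"
  shows "(\<Sum>i. ennreal (shell_volume (A i) r / r)) = ennreal (shell_volume (\<Union>i. A i) r / r)"
proof -
  have "(\<Sum>i. ennreal (shell_volume (A i) r)) = (\<Sum>i. emeasure lborel (shell K 0 r (A i)))"
    by (simp add: emeasure_shell)
  also have "\<dots> = emeasure lborel (\<Union>i. shell K 0 r (A i))"
    using assms borel_shell by (intro suminf_emeasure) (auto simp: disjoint_family_on_def shell_def image_subset_iff)
  also have "(\<Union>i. shell K 0 r (A i)) = shell K 0 r (\<Union>i. A i)" by (auto simp: shell_def)
  finally have "(\<Sum>i. ennreal (shell_volume (A i) r)) = ennreal (shell_volume (\<Union>i. A i) r)" by (simp add: emeasure_shell)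
  then have "(\<Sum>i. ennreal (shell_volume (A i) r)) / ennreal r = ennreal (shell_volume (\<Union>i. A i) r) / ennreal r" by simp
  then show ?thesis using assms(3) shell_volume_nonneg
    by (simp add: divide_ennreal[symmetric] ennreal_divide_times divide_ennreal_def ennreal_suminf_multc)
qed

text \<open>\<open>measure_of\<close> takes the prescribed values once they form a measure.
  Countable additivity passes from each radius to the infimum by reading the sum as an integral over
  the counting measure and letting the integrands decrease.\<close>

lemma emeasure_surface_area_measure:
  assumes "\<omega> \<in> \<Sigma>"
  shows "emeasure (surface_area_measure K) \<omega> = surface_area \<omega>"
proof -
  let ?\<mu> = "\<lambda>\<omega>. Lim (at_right 0) (\<lambda>r. emeasure lborel (local_parallel_set K r \<omega>) / ennreal r)"
  have \<mu>: "?\<mu> \<omega> = surface_area \<omega>" if "\<omega> \<in> \<Sigma>" for \<omega>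
    using surface_area_tendsto[of \<omega>] that by (intro tendsto_Lim) (auto simp: sphere_sets)
  have sa: "sigma_algebra (sphere 0 1) \<Sigma>"
    using sets.sigma_algebra_axioms[of "restrict_space borel (sphere 0 1) :: 'b measure"]
    by (simp add: space_restrict_space)
  have "positive \<Sigma> surface_area"
  proof -
    have "shell_volume {} r = 0" for r by (simp add: shell_volume_def shell_def)
    then show ?thesis by (simp add: positive_def surface_area_def)
  qed
  have ca: "countably_additive \<Sigma> surface_area"
  proof (rule countably_additiveI)
    fix A :: "nat \<Rightarrow> 'b set"
    assume A: "range A \<subseteq> \<Sigma>" "disjoint_family A" "\<Union> (range A) \<in> \<Sigma>"
    then have Ab: "range A \<subseteq> sets borel" by (auto simp: sphere_sets)
    have "(\<Sum>i. surface_area (A i)) = (\<integral>\<^sup>+ i. (INF k. ennreal (shell_volume (A i) (1 / Suc k) / (1 / Suc k))) \<partial>count_space UNIV)"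
      unfolding surface_area_def by (simp add: nn_integral_count_space_nat)
    also have "\<dots> = (INF k. \<integral>\<^sup>+ i. ennreal (shell_volume (A i) (1 / Suc k) / (1 / Suc k)) \<partial>count_space UNIV)"
    proof (rule nn_integral_monotone_convergence_INF_decseq)
      show "decseq (\<lambda>k i. ennreal (shell_volume (A i) (1 / Suc k) / (1 / Suc k)))"
        using decseq_shell_volume Ab by (auto simp: monotone_def le_fun_def image_subset_iff)
      \<comment> \<open>Decreasing convergence needs one finite integral; for radius 1 it is the
        volume of a bounded set.\<close>
      show "(\<integral>\<^sup>+ i. ennreal (shell_volume (A i) (1 / Suc 0) / (1 / Suc 0)) \<partial>count_space UNIV) < \<infinity>"
        using shell_volume_countably_additive[OF Ab A(2), of 1] by (simp add: nn_integral_count_space_nat)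
    qed simp
    also have "\<dots> = (INF k. ennreal (shell_volume (\<Union>i. A i) (1 / Suc k) / (1 / Suc k)))"
    proof -
      have "(\<Sum>i. ennreal (shell_volume (A i) (1 / Suc k) / (1 / Suc k))) = ennreal (shell_volume (\<Union>i. A i) (1 / Suc k) / (1 / Suc k))" for k
        by (rule shell_volume_countably_additive[OF Ab A(2)]) simp
      then show ?thesis by (simp only: nn_integral_count_space_nat)
    qed
    finally show "(\<Sum>i. surface_area (A i)) = surface_area (\<Union>i. A i)" by (simp add: surface_area_def)
  qed
  have eq: "surface_area_measure K = measure_of (sphere 0 1) \<Sigma> surface_area"
    unfolding surface_area_measure_def
  proof (rule measure_of_eq)
    show "\<Sigma> \<subseteq> Pow (sphere 0 1)" using sphere_sets by blast
    show "?\<mu> a = surface_area a" if "a \<in> sigma_sets (sphere 0 1) \<Sigma>" for a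
      using \<mu> that sigma_algebra.sigma_sets_eq[OF sa] by simp
  qed
  show ?thesis unfolding eq
    by (rule emeasure_measure_of_sigma[OF sa \<open>positive \<Sigma> surface_area\<close> ca assms])
qed

lemma sets_surface_area_measure: "sets (surface_area_measure K) = \<Sigma>"
  and space_surface_area_measure: "space (surface_area_measure K) = sphere 0 1"
proof -
  have sa: "sigma_algebra (sphere 0 1) \<Sigma>"
    using sets.sigma_algebra_axioms[of "restrict_space borel (sphere 0 1) :: 'b measure"]
    by (simp add: space_restrict_space)
  show "sets (surface_area_measure K) = \<Sigma>" "space (surface_area_measure K) = sphere 0 1"
    unfolding surface_area_measure_def
    using sa by (simp_all add: sigma_algebra.sets_measure_of_eq sigma_algebra.space_measure_of_eq)
qed


text \<open>The distribution of the normal over the outer shell of width \<open>r\<close>, divided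
  by \<open>r\<close>: a measure on the sphere whose values decrease to those of the surface area
  measure as \<open>r\<close> tends to 0.\<close>

definition scaled_normals :: "real \<Rightarrow> 'b measure" where
  "scaled_normals r = density (distr (restrict_space lborel (shell K 0 r UNIV)) (restrict_space borel (sphere 0 1)) \<nu>)
     (\<lambda>_. ennreal (1 / r))"

lemma sets_scaled_normals: "sets (scaled_normals r) = \<Sigma>" and space_scaled_normals: "space (scaled_normals r) = sphere 0 1"
  by (simp_all add: scaled_normals_def space_restrict_space)

lemma nu_measurable:
  "\<nu> \<in> measurable (restrict_space lborel (shell K 0 r UNIV)) (restrict_space borel (sphere 0 1))"
proof -
  have "\<nu> \<in> borel_measurable (restrict_space borel (shell K 0 r UNIV))"
    by (rule borel_measurable_continuous_on_restrict, rule continuous_on_subset[OF continuous_on_nu])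
      (auto simp: shell_eq d_pos_iff[symmetric])
  moreover have "\<nu> x \<in> sphere 0 1" if "x \<in> shell K 0 r UNIV" for x
    using that norm_nu by (auto simp: shell_eq)
  ultimately show ?thesis
    by (intro measurable_restrict_space2)
      (auto simp: space_restrict_space cong: measurable_cong_sets sets_restrict_space_cong)
qed

lemma emeasure_scaled_normals:
  assumes "\<omega> \<in> \<Sigma>" "0 < r"
  shows "emeasure (scaled_normals r) \<omega> = ennreal (shell_volume \<omega> r / r)"
proof -
  have "\<nu> -` \<omega> \<inter> shell K 0 r UNIV = shell K 0 r \<omega>" by (auto simp: shell_eq)
  moreover have "\<omega> \<in> sets borel" using assms(1) by (simp add: sphere_sets)
  moreover have "shell K 0 r \<omega> \<subseteq> shell K 0 r UNIV" by (auto simp: shell_def)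
  ultimately have "emeasure (distr (restrict_space lborel (shell K 0 r UNIV)) (restrict_space borel (sphere 0 1)) \<nu>) \<omega>
      = emeasure lborel (shell K 0 r \<omega>)"
    using borel_shell[of UNIV 0 r] assms
    by (simp add: emeasure_distr[OF nu_measurable] emeasure_restrict_space space_restrict_space)
  then show ?thesis
    using assms shell_volume_nonneg by (simp add: scaled_normals_def emeasure_density_const emeasure_shell ennreal_mult[symmetric])
qed

lemma surface_area_measure_le_scaled_normals: "0 < r \<Longrightarrow> surface_area_measure K \<le> scaled_normals r"
proof (rule less_eq_measure.intros(3))
  assume r: "0 < r"
  show "space (surface_area_measure K) = space (scaled_normals r)" "sets (surface_area_measure K) = sets (scaled_normals r)"
    by (simp_all add: sets_surface_area_measure space_surface_area_measure sets_scaled_normals space_scaled_normals)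
  show "emeasure (surface_area_measure K) \<le> emeasure (scaled_normals r)"
  proof (rule le_funI)
    fix \<omega>
    show "emeasure (surface_area_measure K) \<omega> \<le> emeasure (scaled_normals r) \<omega>"
    proof (cases "\<omega> \<in> \<Sigma>")
      case True
      then show ?thesis
        using surface_area_le[of \<omega> r] r by (simp add: emeasure_surface_area_measure emeasure_scaled_normals sphere_sets)
    next
      case False
      then show ?thesis by (simp add: emeasure_notin_sets sets_surface_area_measure)
    qed
  qed
qed

lemma sphere_in_Sigma: "sphere 0 1 \<in> \<Sigma>" by (simp add: sphere_sets)

lemma finite_measure_scaled_normals: "0 < r \<Longrightarrow> finite_measure (scaled_normals r)"
  by (rule finite_measureI) (simp add: space_scaled_normals emeasure_scaled_normals sphere_in_Sigma)

lemma finite_measure_surface_area: "finite_measure (surface_area_measure K)"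
proof (rule finite_measureI)
  have "emeasure (surface_area_measure K) (sphere 0 1) \<le> ennreal (shell_volume (sphere 0 1) 1 / 1)"
    using surface_area_le[of "sphere 0 1" 1] by (simp add: emeasure_surface_area_measure sphere_in_Sigma)
  then show "emeasure (surface_area_measure K) (space (surface_area_measure K)) \<noteq> \<infinity>"
    by (auto simp: space_surface_area_measure top_unique)
qed

lemma integral_surface_le_scaled_normals:
  fixes f :: "'b \<Rightarrow> real"
  assumes f: "f \<in> borel_measurable (restrict_space borel (sphere 0 1))"
    and B: "\<And>x. x \<in> sphere 0 1 \<Longrightarrow> 0 \<le> f x \<and> f x \<le> B" and r: "0 < r"
  shows "(LINT x|surface_area_measure K. f x) \<le> (LINT x|scaled_normals r. f x)"
proof -
  interpret scaled_normals: finite_measure "scaled_normals r" using r by (rule finite_measure_scaled_normals)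
  have m: "f \<in> borel_measurable (scaled_normals r)" "f \<in> borel_measurable (surface_area_measure K)"
    using f by (simp_all add: sets_scaled_normals sets_surface_area_measure cong: measurable_cong_sets)
  have i: "integrable (scaled_normals r) f"
    using B by (intro scaled_normals.integrable_const_bound[of _ B] m) (auto simp: space_scaled_normals)
  have "(\<integral>\<^sup>+ x. ennreal (f x) \<partial>surface_area_measure K) \<le> (\<integral>\<^sup>+ x. ennreal (f x) \<partial>scaled_normals r)"
    by (rule nn_integral_mono_measure)
      (simp_all add: sets_scaled_normals sets_surface_area_measure surface_area_measure_le_scaled_normals r)
  moreover have "(\<integral>\<^sup>+ x. ennreal (f x) \<partial>scaled_normals r) < \<infinity>"
    using i by (rule integrable_iff_bounded[THEN iffD1, THEN conjunct2, THEN le_less_trans[rotated]])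
      (auto intro!: nn_integral_mono ennreal_leI)
  ultimately show ?thesis
    using B by (subst (1 2) integral_eq_nn_integral)
      (auto simp: m space_scaled_normals space_surface_area_measure intro!: enn2real_mono)
qed

lemma integral_scaled_normals:
  fixes f :: "'b \<Rightarrow> real"
  assumes f: "f \<in> borel_measurable (restrict_space borel (sphere 0 1))" and r: "0 < r"
  shows "(LINT x|scaled_normals r. f x) = (LINT x|lborel. indicator (shell K 0 r UNIV) x * f (\<nu> x)) / r"
proof -
  have sh: "shell K 0 r UNIV \<in> sets lborel" using borel_shell[of UNIV 0 r] by simp
  have "(LINT x|scaled_normals r. f x) = (1 / r) * (LINT x|restrict_space lborel (shell K 0 r UNIV). f (\<nu> x))"
    unfolding scaled_normals_def using r f
    by (subst integral_real_density) (auto simp: integral_distr[OF nu_measurable])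
  also have "(LINT x|restrict_space lborel (shell K 0 r UNIV). f (\<nu> x)) =
      (LINT x|lborel. indicator (shell K 0 r UNIV) x * f (\<nu> x))"
    using sh by (subst integral_restrict_space) auto
  finally show ?thesis by simp
qed

text \<open>The measures \<open>scaled_normals\<close> dominate the surface area measure on every
  set, and their total masses converge to its total mass. Applying the domination to the nonnegative
  functions \<open>\<eta> + B\<close> and \<open>B - \<eta>\<close> bounds the difference of the
  integrals by \<open>B\<close> times the difference of the masses.\<close>

lemma integral_surface_area_measure_LIMSEQ:
  fixes \<eta> :: "'b \<Rightarrow> real"
  assumes cont: "continuous_on (sphere 0 1) \<eta>"
  shows "(\<lambda>k. (LINT x|lborel. indicator (shell K 0 (1 / Suc k) UNIV) x * \<eta> (\<nu> x)) * Suc k)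
    \<longlonglongrightarrow> (LINT x|surface_area_measure K. \<eta> x)"
proof -
  let ?S = "surface_area_measure K"
  let ?scaled_normals = "\<lambda>k. scaled_normals (1 / Suc k)"
  interpret surface_area: finite_measure ?S by (rule finite_measure_surface_area)
  have \<eta>: "\<eta> \<in> borel_measurable (restrict_space borel (sphere 0 1))"
    using cont by (rule borel_measurable_continuous_on_restrict)
  have "bounded (\<eta> ` sphere 0 1)"
    using cont by (intro compact_imp_bounded compact_continuous_image) auto
  then obtain B where "\<forall>y\<in>\<eta> ` sphere 0 1. norm y \<le> B"
    unfolding bounded_iff by blast
  then have B: "\<And>x. x \<in> sphere 0 1 \<Longrightarrow> \<bar>\<eta> x\<bar> \<le> B" by simp
  have mS: "\<eta> \<in> borel_measurable ?S" using \<eta> by (simp add: sets_surface_area_measure cong: measurable_cong_sets)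
  have iS: "integrable ?S \<eta>"
    using B by (intro surface_area.integrable_const_bound[of _ B] mS) (auto simp: space_surface_area_measure)
  have key: "\<bar>(LINT x|?scaled_normals k. \<eta> x) - (LINT x|?S. \<eta> x)\<bar> \<le> B * (measure (?scaled_normals k) (sphere 0 1) - measure ?S (sphere 0 1))" for k
  proof -
    have r: "0 < 1 / real (Suc k)" by simp
    interpret scaled_normals: finite_measure "?scaled_normals k" by (rule finite_measure_scaled_normals[OF r])
    have mN: "\<eta> \<in> borel_measurable (?scaled_normals k)" using \<eta> by (simp add: sets_scaled_normals cong: measurable_cong_sets)
    have iN: "integrable (?scaled_normals k) \<eta>"
      using B by (intro scaled_normals.integrable_const_bound[of _ B] mN) (auto simp: space_scaled_normals)
    have bd: "0 \<le> \<eta> x + B \<and> \<eta> x + B \<le> 2 * B" "0 \<le> B - \<eta> x \<and> B - \<eta> x \<le> 2 * B" if "x \<in> sphere 0 1" for x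
      using B[OF that] by auto
    have "(LINT x|?S. \<eta> x + B) \<le> (LINT x|?scaled_normals k. \<eta> x + B)"
      by (rule integral_surface_le_scaled_normals[OF _ bd(1) r]) (use \<eta> in simp)
    moreover have "(LINT x|?S. B - \<eta> x) \<le> (LINT x|?scaled_normals k. B - \<eta> x)"
      by (rule integral_surface_le_scaled_normals[OF _ bd(2) r]) (use \<eta> in simp)
    ultimately show ?thesis
      using iS iN by (simp add: space_scaled_normals space_surface_area_measure algebra_simps abs_le_iff del: of_nat_Suc)
  qed
  have conv: "(\<lambda>k. measure (?scaled_normals k) (sphere 0 1)) \<longlonglongrightarrow> measure ?S (sphere 0 1)"
  proof -
    have "(\<lambda>k. emeasure (?scaled_normals k) (sphere 0 1)) \<longlonglongrightarrow> emeasure ?S (sphere 0 1)"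
      using surface_area_lim[of "sphere 0 1"] by (simp add: emeasure_surface_area_measure emeasure_scaled_normals sphere_in_Sigma del: of_nat_Suc)
    then have "(\<lambda>k. emeasure (?scaled_normals k) (sphere 0 1)) \<longlonglongrightarrow> ennreal (measure ?S (sphere 0 1))"
      by (simp only: surface_area.emeasure_eq_measure)
    from tendsto_enn2real[OF this] show ?thesis
      by (simp only: measure_def[symmetric] measure_nonneg)
  qed
  have "(\<lambda>k. (LINT x|?scaled_normals k. \<eta> x) - (LINT x|?S. \<eta> x)) \<longlonglongrightarrow> 0"
  proof (rule Lim_null_comparison)
    show "\<forall>\<^sub>F k in sequentially. norm ((LINT x|?scaled_normals k. \<eta> x) - (LINT x|?S. \<eta> x))
        \<le> B * (measure (?scaled_normals k) (sphere 0 1) - measure ?S (sphere 0 1))"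
      using key by (simp add: del: of_nat_Suc)
    show "(\<lambda>k. B * (measure (?scaled_normals k) (sphere 0 1) - measure ?S (sphere 0 1))) \<longlonglongrightarrow> 0"
      using tendsto_mult[OF tendsto_const[of B] tendsto_diff[OF conv tendsto_const[of "measure ?S (sphere 0 1)"]]] by simp
  qed
  then have "(\<lambda>k. (LINT x|?scaled_normals k. \<eta> x)) \<longlonglongrightarrow> (LINT x|?S. \<eta> x)"
    by (rule LIM_zero_cancel)
  then show ?thesis using \<eta> by (simp add: integral_scaled_normals del: of_nat_Suc)
qed

end

section \<open>Almost everywhere differentiability of convex functions\<close>

lemma convex_on_slope_mono:
  fixes f :: "'a::real_vector \<Rightarrow> real"
  assumes f: "convex_on S f" and S: "\<And>t. h \<le> t \<Longrightarrow> t \<le> h' \<Longrightarrow> x + t *\<^sub>R e \<in> S" "x \<in> S"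
    and h: "h \<noteq> 0" "h' \<noteq> 0" "h \<le> h'"
  shows "(f (x + h *\<^sub>R e) - f x) / h \<le> (f (x + h' *\<^sub>R e) - f x) / h'"
proof -
  have aux: "(f (x + s *\<^sub>R e) - f x) / s \<le> (f (x + s' *\<^sub>R e) - f x) / s'"
    if "0 < s" "s \<le> s'" "x + s' *\<^sub>R e \<in> S" for s s' e
  proof -
    have "f ((1 - s / s') *\<^sub>R x + (s / s') *\<^sub>R (x + s' *\<^sub>R e)) \<le> (1 - s / s') * f x + (s / s') * f (x + s' *\<^sub>R e)"
      using f that S(2) by (intro convex_onD) auto
    also have "(1 - s / s') *\<^sub>R x + (s / s') *\<^sub>R (x + s' *\<^sub>R e) = x + s *\<^sub>R e"
      using that by (simp add: algebra_simps)
    finally show ?thesis using that by (simp add: field_simps)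
  qed
  consider "0 < h" | "h < 0" "0 < h'" | "h < 0" "h' < 0" using h by linarith
  then show ?thesis
  proof cases
    case 1
    then show ?thesis using aux[of h h' e] h S by auto
  next
    case 2
    \<comment> \<open>The weight that writes \<open>x\<close> as a convex combination of the points
      on its two sides.\<close>
    define w where "w = h' / (h' - h)"
    have w: "0 \<le> w" "w \<le> 1" using 2 by (auto simp: w_def)
    have w1: "1 - w = - h / (h' - h)" using 2 by (simp add: w_def field_simps)
    have "f ((1 - w) *\<^sub>R (x + h' *\<^sub>R e) + w *\<^sub>R (x + h *\<^sub>R e)) \<le> (1 - w) * f (x + h' *\<^sub>R e) + w * f (x + h *\<^sub>R e)"
      using f w S h by (intro convex_onD) auto
    also have "(1 - w) *\<^sub>R (x + h' *\<^sub>R e) + w *\<^sub>R (x + h *\<^sub>R e) = x + ((1 - w) * h' + w * h) *\<^sub>R e"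
      by (simp add: algebra_simps)
    also have "(1 - w) * h' + w * h = 0" unfolding w1 using 2 by (simp add: w_def)
    finally have "f x \<le> (1 - w) * f (x + h' *\<^sub>R e) + w * f (x + h *\<^sub>R e)" by simp
    then have "f x * (h' - h) \<le> ((1 - w) * f (x + h' *\<^sub>R e) + w * f (x + h *\<^sub>R e)) * (h' - h)"
      using 2 by (intro mult_right_mono) auto
    also have "\<dots> = - h * f (x + h' *\<^sub>R e) + h' * f (x + h *\<^sub>R e)"
      unfolding w1 using 2 by (simp add: w_def diff_divide_distrib[symmetric])
    finally show ?thesis using 2 by (simp add: field_simps)
  next
    case 3
    then have "(f (x + (- h') *\<^sub>R (- e)) - f x) / (- h') \<le> (f (x + (- h) *\<^sub>R (- e)) - f x) / (- h)"
      using S h by (intro aux) auto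
    then show ?thesis by simp
  qed
qed

text \<open>Difference quotients are monotone, so a small symmetric second difference at some step
  size forces the one-sided derivatives along the axis together. Jensen's inequality along the
  coordinate axes turns this into the upper half of differentiability, and convexity at the midpoint
  of \<open>x + v\<close> and \<open>x - v\<close> gives the lower half.\<close>

lemma GDERIV_convex_on:
  fixes f :: "'a::euclidean_space \<Rightarrow> real"
  assumes f: "convex_on S f" and r: "0 < r" "cball x r \<subseteq> S"
    and small: "\<And>e \<delta>. e \<in> Basis \<Longrightarrow> 0 < \<delta> \<Longrightarrow>
      \<exists>h. 0 < h \<and> h \<le> r \<and> f (x + h *\<^sub>R e) - 2 * f x + f (x - h *\<^sub>R e) < \<delta> * h"
  shows "\<exists>D. GDERIV f x :> D"
proof -
  define q where "q e h = (f (x + h *\<^sub>R e) - f x) / h" for e h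
  have inS: "x + t *\<^sub>R e \<in> S" if "e \<in> Basis" "\<bar>t\<bar> \<le> r" for e t
    using that r by (intro subsetD[OF r(2)]) (auto simp: dist_norm)
  have xS: "x \<in> S" using r by auto
  have q: "q e h \<le> q e h'" if "e \<in> Basis" "h \<le> h'" "h \<noteq> 0" "h' \<noteq> 0" "\<bar>h\<bar> \<le> r" "\<bar>h'\<bar> \<le> r" for e h h'
    unfolding q_def using that by (intro convex_on_slope_mono[OF f _ xS] inS) auto
  \<comment> \<open>The right partial derivative, as the infimum of the right difference quotients;
    the left quotients stay below it.\<close>
  define a where "a e = (INF h\<in>{0<..r}. q e h)" for e
  have a1: "a e \<le> q e h" if "e \<in> Basis" "0 < h" "h \<le> r" for e h
    unfolding a_def using that r
    by (intro cINF_lower bdd_belowI2[of _ "q e (- r)"] q) auto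
  have a2: "q e (- h) \<le> a e" if "e \<in> Basis" "0 < h" "h \<le> r" for e h
    unfolding a_def using that r by (intro cINF_greatest q) auto
  define D where "D = (\<Sum>e\<in>Basis. a e *\<^sub>R e)"
  have De: "D \<bullet> e = a e" if "e \<in> Basis" for e
    unfolding D_def using that by simp
  have Dv: "D \<bullet> v = (\<Sum>e\<in>Basis. a e * (v \<bullet> e))" for v
    unfolding D_def inner_sum_left by (intro sum.cong) (auto simp: inner_commute)
  have "(f has_derivative (\<lambda>v. v \<bullet> D)) (at x)"
    unfolding has_derivative_at_alt
  proof (intro conjI allI impI)
    show "bounded_linear (\<lambda>v. v \<bullet> D)" by (rule bounded_linear_inner_left)
    fix \<epsilon> :: real assume \<epsilon>: "0 < \<epsilon>"
    define n where "n = real DIM('a)"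
    have n: "n > 0" by (simp add: n_def)
    define \<delta> where "\<delta> = \<epsilon> / n"
    have \<delta>: "0 < \<delta>" using \<epsilon> n by (simp add: \<delta>_def)
    obtain H where H: "\<And>e. e \<in> Basis \<Longrightarrow> 0 < H e \<and> H e \<le> r \<and> f (x + H e *\<^sub>R e) - 2 * f x + f (x - H e *\<^sub>R e) < \<delta> * H e"
      using small[OF _ \<delta>] by metis
    have osc: "q e (H e) - q e (- H e) < \<delta>" if "e \<in> Basis" for e
    proof -
      have "q e (H e) - q e (- H e) = (f (x + H e *\<^sub>R e) - 2 * f x + f (x - H e *\<^sub>R e)) / H e"
        by (simp add: q_def diff_divide_distrib add_divide_distrib)
      then show ?thesis using H[OF that] by (simp add: divide_less_eq)
    qed
    define m where "m = Min (H ` Basis)"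
    have m: "0 < m" "\<And>e. e \<in> Basis \<Longrightarrow> m \<le> H e" using H by (auto simp: m_def)
    have one: "f (x + t *\<^sub>R e) - f x \<le> t * a e + \<delta> * \<bar>t\<bar>" if e: "e \<in> Basis" and t: "\<bar>t\<bar> \<le> m" for e t
    proof -
      consider "t = 0" | "0 < t" | "t < 0" by linarith
      then show ?thesis
      proof cases
        case 2
        have "q e t \<le> q e (H e)" using e t m(2)[OF e] H[OF e] 2 by (intro q) auto
        also have "\<dots> \<le> a e + \<delta>" using osc[OF e] a2[OF e, of "H e"] H[OF e] by linarith
        finally have "q e t * t \<le> (a e + \<delta>) * t" using 2 by (intro mult_right_mono) auto
        moreover have "q e t * t = f (x + t *\<^sub>R e) - f x" using 2 by (simp add: q_def)
        ultimately show ?thesis using 2 by (simp add: algebra_simps)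
      next
        case 3
        have "q e t \<ge> q e (- H e)" using e t m(2)[OF e] H[OF e] 3 by (intro q) auto
        moreover have "q e (- H e) \<ge> a e - \<delta>" using osc[OF e] a1[OF e, of "H e"] H[OF e] by linarith
        ultimately have "q e t * t \<le> (a e - \<delta>) * t" using 3 by (intro mult_right_mono_neg) auto
        moreover have "q e t * t = f (x + t *\<^sub>R e) - f x" using 3 by (simp add: q_def)
        ultimately show ?thesis using 3 by (simp add: algebra_simps)
      qed simp
    qed
    have up: "f (x + v) - f x - v \<bullet> D \<le> \<epsilon> * norm v" if v: "norm v \<le> m / n" for v
    proof -
      have ve: "\<bar>n * (v \<bullet> e)\<bar> \<le> m" if "e \<in> Basis" for e
      proof -
        have "n * \<bar>v \<bullet> e\<bar> \<le> n * norm v" using Basis_le_norm[OF that, of v] n by (intro mult_left_mono) auto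
        moreover have "n * norm v \<le> m" using v n by (simp add: field_simps)
        ultimately have "n * \<bar>v \<bullet> e\<bar> \<le> m" by (rule order_trans)
        then show ?thesis using n by (simp add: abs_mult)
      qed
      \<comment> \<open>\<open>x + v\<close> is the average of \<open>n\<close> points on the
        coordinate axes through \<open>x\<close>, each displaced by \<open>n\<close> times the
        respective coordinate of \<open>v\<close>; this is why \<open>norm v\<close> is restricted
        to \<open>m / n\<close>.\<close>
      have "x + v = (\<Sum>e\<in>Basis. (1 / n) *\<^sub>R (x + (n * (v \<bullet> e)) *\<^sub>R e))"
        using n by (simp add: scaleR_add_right sum.distrib euclidean_representation n_def sum_constant_scaleR)
      also have "f \<dots> \<le> (\<Sum>e\<in>Basis. (1 / n) * f (x + (n * (v \<bullet> e)) *\<^sub>R e))"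
      proof (rule convex_on_sum[OF _ _ f])
        show "(\<Sum>e::'a\<in>Basis. 1 / n) = 1" by (simp add: n_def)
        show "x + (n * (v \<bullet> i)) *\<^sub>R i \<in> S" if "i \<in> Basis" for i
          using ve[OF that] m(2)[OF that] H[OF that] that by (intro inS) auto
      qed (use n in auto)
      also have "\<dots> \<le> (\<Sum>e\<in>Basis. (1 / n) * (f x + n * (v \<bullet> e) * a e + \<delta> * \<bar>n * (v \<bullet> e)\<bar>))"
      proof (intro sum_mono mult_left_mono)
        fix e :: 'a assume e: "e \<in> Basis"
        show "f (x + (n * (v \<bullet> e)) *\<^sub>R e) \<le> f x + n * (v \<bullet> e) * a e + \<delta> * \<bar>n * (v \<bullet> e)\<bar>"
          using one[OF e ve[OF e]] by linarith
      qed (use n in auto)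
      also have "\<dots> = f x + v \<bullet> D + \<delta> * (\<Sum>e\<in>Basis. \<bar>v \<bullet> e\<bar>)"
        using n by (simp add: distrib_left sum.distrib inner_commute[of v D] Dv abs_mult sum_distrib_left n_def mult_ac)
      also have "\<dots> \<le> f x + v \<bullet> D + \<delta> * (\<Sum>e::'a\<in>Basis. norm v)"
        using \<delta> by (intro add_left_mono mult_left_mono sum_mono Basis_le_norm) auto
      finally show ?thesis using n by (simp add: \<delta>_def n_def)
    qed
    show "\<exists>d>0. \<forall>y. norm (y - x) < d \<longrightarrow> norm (f y - f x - (y - x) \<bullet> D) \<le> \<epsilon> * norm (y - x)"
    proof (intro exI[of _ "min (m / n) r"] conjI allI impI)
      show "0 < min (m / n) r" using m n r by simp
      fix y assume y: "norm (y - x) < min (m / n) r"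
      define v where "v = y - x"
      have v: "norm v \<le> m / n" "norm v \<le> r" using y by (auto simp: v_def)
      have "x + v \<in> S" "x - v \<in> S" using v by (auto intro!: subsetD[OF r(2)] simp: dist_norm)
      then have "f ((1 - 1/2) *\<^sub>R (x + v) + (1/2) *\<^sub>R (x - v)) \<le> (1 - 1/2) * f (x + v) + (1/2) * f (x - v)"
        using f by (intro convex_onD) auto
      moreover have "(1 - 1/2) *\<^sub>R (x + v) + (1/2) *\<^sub>R (x - v) = x"
        by (simp add: algebra_simps flip: scaleR_left_distrib)
      ultimately have "2 * f x \<le> f (x + v) + f (x - v)" by simp
      moreover have "f (x + v) - f x - v \<bullet> D \<le> \<epsilon> * norm v" "f (x - v) - f x + v \<bullet> D \<le> \<epsilon> * norm v"
        using up[of v] up[of "- v"] v by auto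
      ultimately have "\<bar>f (x + v) - f x - v \<bullet> D\<bar> \<le> \<epsilon> * norm v" by linarith
      then show "norm (f y - f x - (y - x) \<bullet> D) \<le> \<epsilon> * norm (y - x)"
        by (simp add: v_def)
    qed
  qed
  then show ?thesis unfolding gderiv_def by blast
qed

lemma lborel_integral_shift:
  fixes g :: "'a::euclidean_space \<Rightarrow> real"
  assumes "g \<in> borel_measurable borel"
  shows "(LINT x|lborel. g (x + c)) = (LINT x|lborel. g x)"
proof -
  have "(LINT x|lborel. g x) = (LINT x|distr lborel borel ((+) c). g x)" by (simp add: lborel_distr_plus)
  also have "\<dots> = (LINT x|lborel. g (c + x))" using assms by (subst integral_distr) auto
  finally show ?thesis by (simp add: add.commute)
qed

text \<open>The second difference is \<open>Q x - Q (x - h e)\<close> for the first difference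
  \<open>Q\<close>, so its integral over a ball is the integral of \<open>Q\<close> over the ball
  minus that over a translate. The ball and its translate differ within a thin annulus, where
  \<open>Q\<close> is at most \<open>h * L\<close>. Hence the measure of \<open>T h\<close>, which
  contains the given set, is at most a constant times that of the annulus and tends to 0 with
  \<open>h\<close>.\<close>

lemma negligible_convex_second_difference:
  fixes f :: "'a::euclidean_space \<Rightarrow> real"
  assumes f: "convex_on S f" and S: "open S" and r: "0 < r" "cball x0 (3 * r) \<subseteq> S"
    and e: "norm e = 1" and \<delta>: "0 < \<delta>"
  shows "negligible {x \<in> ball x0 r. \<forall>h. 0 < h \<and> h \<le> r \<longrightarrow> \<delta> * h \<le> f (x + h *\<^sub>R e) - 2 * f x + f (x - h *\<^sub>R e)}"
proof -
  define B where "B = cball x0 (3 * r)"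
  define C where "C = cball x0 r"
  have cont: "continuous_on B f"
    using convex_on_continuous[OF S f] r continuous_on_subset by (auto simp: B_def)
  obtain M where M: "\<And>x. x \<in> B \<Longrightarrow> \<bar>f x\<bar> \<le> M"
  proof -
    have "bounded (f ` B)" by (intro compact_imp_bounded compact_continuous_image cont) (simp add: B_def)
    then obtain M where "\<forall>y\<in>f ` B. norm y \<le> M" unfolding bounded_iff by blast
    then show ?thesis by (intro that[of M]) auto
  qed
  \<comment> \<open>Secants of length \<open>r\<close> from points within \<open>2 * r\<close> of
    the centre stay in \<open>B\<close>, so slopes in direction \<open>e\<close> are at most
    \<open>2 * M / r\<close> there.\<close>
  define L where "L = 2 * M / r"
  \<comment> \<open>Cut off outside of \<open>B\<close> to have a bounded Borel function on the
    whole space.\<close>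
  define F where "F x = indicator B x * f x" for x
  have F: "F \<in> borel_measurable borel"
  proof -
    have "(\<lambda>x. indicator B x *\<^sub>R f x) \<in> borel_measurable borel"
      by (rule borel_measurable_continuous_on_indicator[OF _ cont]) (simp add: B_def)
    then show ?thesis by (simp add: F_def[abs_def])
  qed
  have Mnn: "0 \<le> M" using M[of x0] r by (auto simp: B_def)
  have FM: "\<bar>F x\<bar> \<le> M" for x using M[of x] Mnn by (auto simp: F_def indicator_def)
  have near: "x + t *\<^sub>R e \<in> B" if "dist x0 x \<le> 2 * r" "\<bar>t\<bar> \<le> r" for x t
  proof -
    have "dist x0 (x + t *\<^sub>R e) \<le> dist x0 x + dist x (x + t *\<^sub>R e)" by (rule dist_triangle)
    also have "dist x (x + t *\<^sub>R e) = \<bar>t\<bar>" using e by (simp add: dist_norm)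
    finally show ?thesis using that by (simp add: B_def)
  qed
  have lip: "\<bar>F (y + h *\<^sub>R e) - F y\<bar> \<le> h * L" if y: "dist x0 y \<le> 2 * r" and h: "0 < h" "h \<le> r" for y h
  proof -
    have yS: "y \<in> S" "y \<in> B" using y r by (auto simp: B_def subset_eq)
    have S': "y + t *\<^sub>R e \<in> S" if "\<bar>t\<bar> \<le> r" for t using near[OF y that] r by (auto simp: B_def)
    have "(f (y + h *\<^sub>R e) - f y) / h \<le> (f (y + r *\<^sub>R e) - f y) / r"
      using h by (intro convex_on_slope_mono[OF f _ yS(1)] S') auto
    also have "\<dots> \<le> L"
      using M[of "y + r *\<^sub>R e"] M[of y] near[OF y, of r] yS r by (auto simp: L_def intro!: divide_right_mono)
    finally have u: "f (y + h *\<^sub>R e) - f y \<le> h * L" using h by (simp add: field_simps)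
    have "- L = (- 2 * M) / r" by (simp add: L_def)
    also have "\<dots> \<le> (f y - f (y + (- r) *\<^sub>R e)) / r"
      using M[of "y + (- r) *\<^sub>R e"] M[of y] near[OF y, of "- r"] yS r by (intro divide_right_mono) auto
    also have "\<dots> = (f (y + (- r) *\<^sub>R e) - f y) / (- r)"
      by (simp add: diff_divide_distrib)
    also have "\<dots> \<le> (f (y + h *\<^sub>R e) - f y) / h"
      using h by (intro convex_on_slope_mono[OF f _ yS(1)] S') auto
    finally have "- (h * L) \<le> f (y + h *\<^sub>R e) - f y" using h by (simp add: field_simps)
    with u show ?thesis using near[OF y, of h] h yS by (simp add: F_def)
  qed
  define V where "V = measure lborel (ball (0::'a) 1)"
  define n where "n = DIM('a)"
  define T where "T h = {x \<in> C. \<delta> * h \<le> F (x + h *\<^sub>R e) - 2 * F x + F (x - h *\<^sub>R e)}" for h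
  have Tm: "T h \<in> sets borel" for h
    unfolding T_def C_def using F by measurable
  have Tf: "T h \<in> lmeasurable" for h
    by (rule bounded_set_imp_lmeasurable) (use Tm in \<open>auto simp: T_def C_def intro: bounded_subset[OF bounded_cball]\<close>)
  have est: "\<delta> * measure lebesgue (T h) \<le> L * (measure lborel (cball x0 (r + h)) - measure lborel (ball x0 (r - h)))"
    if h: "0 < h" "h < r" for h
  proof -
    define Q where "Q x = F (x + h *\<^sub>R e) - F x" for x
    have Q: "Q \<in> borel_measurable borel" unfolding Q_def using F by measurable
    have QM: "\<bar>Q x\<bar> \<le> 2 * M" for x using FM[of x] FM[of "x + h *\<^sub>R e"] by (simp add: Q_def)
    have ib: "integrable lborel (\<lambda>x. indicator A x * g x)" if "A \<in> sets borel" "bounded A" "g \<in> borel_measurable borel" "\<And>x. \<bar>g x\<bar> \<le> c"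
      for A and g :: "'a \<Rightarrow> real" and c
    proof -
      have "integrable lborel (\<lambda>x. indicator A x * c)"
        using that emeasure_bounded_finite by (intro integrable_mult_left) (auto simp: integrable_indicator_iff)
      then show ?thesis
      proof (rule Bochner_Integration.integrable_bound)
        show "AE x in lborel. norm (indicator A x * g x) \<le> norm (indicator A x * c)"
          using that(4) by (intro AE_I2) (auto simp: indicator_def intro: order_trans[OF _ abs_ge_self])
      qed (use that in auto)
    qed
    have iT: "integrable lborel (\<lambda>x. indicator (T h) x * (\<delta> * h))"
      using Tm by (intro ib[of _ _ "\<delta> * h"]) (use \<delta> h in \<open>auto simp: T_def C_def intro: bounded_subset[OF bounded_cball]\<close>)
    have i1: "integrable lborel (\<lambda>x. indicator C x * Q x)"
      by (rule ib[OF _ _ Q QM]) (auto simp: C_def)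
    have Q2: "(\<lambda>x. Q (x + (- h) *\<^sub>R e)) \<in> borel_measurable borel" using Q by measurable
    have i2: "integrable lborel (\<lambda>x. indicator C x * Q (x + (- h) *\<^sub>R e))"
      by (rule ib[OF _ _ Q2 QM]) (auto simp: C_def)
    let ?C' = "(\<lambda>x. x - h *\<^sub>R e) ` C"
    have C': "indicator C (x + h *\<^sub>R e) = (indicator ?C' x :: real)" for x
      by (auto simp: indicator_def image_iff algebra_simps)
    have C'c: "?C' = cball (x0 - h *\<^sub>R e) r" unfolding C_def
      using cball_translation_subtract by (metis (no_types, lifting) image_cong)
    have m3: "(\<lambda>x. indicator C (x + h *\<^sub>R e) * Q x) \<in> borel_measurable borel"
      unfolding C' C'c by (intro borel_measurable_times borel_measurable_indicator Q) simp
    have eq3: "(\<lambda>x. indicator C x * Q (x + (- h) *\<^sub>R e)) = (\<lambda>x. (\<lambda>x. indicator C (x + h *\<^sub>R e) * Q x) (x + (- h) *\<^sub>R e))"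
      by (simp add: algebra_simps)
    have shift: "(LINT x|lborel. indicator C x * Q (x + (- h) *\<^sub>R e)) = (LINT x|lborel. indicator C (x + h *\<^sub>R e) * Q x)"
      unfolding eq3 by (rule lborel_integral_shift[OF m3])
    have i3: "integrable lborel (\<lambda>x. indicator C (x + h *\<^sub>R e) * Q x)"
      unfolding C' by (rule ib[OF _ _ Q QM]) (auto simp: C'c)
    define A where "A = cball x0 (r + h) - ball x0 (r - h)"
    have iA: "integrable lborel (\<lambda>x. indicator A x * (h * L))"
      by (rule ib[of _ _ "\<bar>h * L\<bar>"]) (auto simp: A_def intro: bounded_subset[OF bounded_cball])
    have "\<delta> * h * measure lebesgue (T h) = (LINT x|lborel. indicator (T h) x * (\<delta> * h))"
      using Tm by simp
    also have "\<dots> \<le> (LINT x|lborel. indicator C x * Q x - indicator C x * Q (x + (- h) *\<^sub>R e))"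
    proof (rule integral_mono[OF iT Bochner_Integration.integrable_diff[OF i1 i2]])
      fix x
      have "0 \<le> F (x + h *\<^sub>R e) - 2 * F x + F (x - h *\<^sub>R e)" if x: "x \<in> C"
      proof -
        have d: "dist x0 x \<le> 2 * r" using x r by (simp add: C_def)
        have B: "x + h *\<^sub>R e \<in> B" "x + (- h) *\<^sub>R e \<in> B" "x \<in> B"
          using near[OF d, of h] near[OF d, of "- h"] near[OF d, of 0] h by auto
        have "f ((1 - 1/2) *\<^sub>R (x + h *\<^sub>R e) + (1/2) *\<^sub>R (x + (- h) *\<^sub>R e)) \<le> (1 - 1/2) * f (x + h *\<^sub>R e) + (1/2) * f (x + (- h) *\<^sub>R e)"
          using B r by (intro convex_onD[OF f]) (auto simp: B_def)
        moreover have "(1 - 1/2) *\<^sub>R (x + h *\<^sub>R e) + (1/2) *\<^sub>R (x + (- h) *\<^sub>R e) = x"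
          by (simp add: algebra_simps flip: scaleR_left_distrib)
        ultimately show ?thesis using B by (simp add: F_def)
      qed
      then show "indicator (T h) x * (\<delta> * h) \<le> indicator C x * Q x - indicator C x * Q (x + (- h) *\<^sub>R e)"
        by (auto simp: T_def indicator_def Q_def)
    qed
    also have "\<dots> = (LINT x|lborel. indicator C x * Q x - indicator C (x + h *\<^sub>R e) * Q x)"
      using i1 i2 i3 shift by simp
    also have "\<dots> \<le> (LINT x|lborel. indicator A x * (h * L))"
    proof (rule integral_mono[OF Bochner_Integration.integrable_diff[OF i1 i3] iA])
      fix x
      have d: "\<bar>dist x0 (x + h *\<^sub>R e) - dist x0 x\<bar> \<le> h"
        using dist_triangle[of x0 "x + h *\<^sub>R e" x] dist_triangle[of x0 x "x + h *\<^sub>R e"] e h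
        by (simp add: dist_norm abs_le_iff)
      show "indicator C x * Q x - indicator C (x + h *\<^sub>R e) * Q x \<le> indicator A x * (h * L)"
      proof (cases "x \<in> A")
        case True
        then have "\<bar>Q x\<bar> \<le> h * L" unfolding Q_def using h by (intro lip) (auto simp: A_def)
        then show ?thesis using True by (auto simp: indicator_def)
      next
        case False
        then have "dist x0 x < r - h \<or> r + h < dist x0 x" by (auto simp: A_def)
        then show ?thesis using d False h by (auto simp: C_def indicator_def)
      qed
    qed
    also have "\<dots> = h * L * measure lborel A" by (simp add: A_def)
    also have "measure lborel A = measure lborel (cball x0 (r + h)) - measure lborel (ball x0 (r - h))"
      unfolding A_def using h by (intro measure_Diff) (use emeasure_bounded_finite[OF bounded_cball[of x0 "r + h"]] in auto)
    finally show ?thesis using h by (simp add: mult.assoc mult.left_commute)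
  qed
  have lim: "((\<lambda>h. L * (measure lborel (cball x0 (r + h)) - measure lborel (ball x0 (r - h))) / \<delta>) \<longlongrightarrow> 0) (at_right 0)"
  proof -
    have "((\<lambda>h. L * (V * (r + h) ^ n - V * (r - h) ^ n) / \<delta>) \<longlongrightarrow> L * (V * (r + 0) ^ n - V * (r - 0) ^ n) / \<delta>) (at_right 0)"
      using \<delta> by (intro tendsto_intros) auto
    then have "((\<lambda>h. L * (V * (r + h) ^ n - V * (r - h) ^ n) / \<delta>) \<longlongrightarrow> 0) (at_right 0)" by simp
    moreover have "\<forall>\<^sub>F h in at_right 0. L * (V * (r + h) ^ n - V * (r - h) ^ n) / \<delta> =
        L * (measure lborel (cball x0 (r + h)) - measure lborel (ball x0 (r - h))) / \<delta>"
      unfolding eventually_at_right_field using r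
      by (intro exI[of _ r]) (simp add: V_def n_def content_ball content_cball)
    ultimately show ?thesis by (rule Lim_transform_eventually)
  qed
  show ?thesis unfolding negligible_outer_le
  proof (intro allI impI)
    fix \<epsilon> :: real assume \<epsilon>: "0 < \<epsilon>"
    have "\<forall>\<^sub>F h in at_right 0. L * (measure lborel (cball x0 (r + h)) - measure lborel (ball x0 (r - h))) / \<delta> < \<epsilon> \<and> 0 < h \<and> h < r"
      using order_tendstoD(2)[OF lim \<epsilon>] r
      by (intro eventually_conj) (auto simp: eventually_at_right_field)
    then obtain h where h: "L * (measure lborel (cball x0 (r + h)) - measure lborel (ball x0 (r - h))) / \<delta> < \<epsilon>" "0 < h" "h < r"
      using eventually_happens trivial_limit_at_right_real by blast
    have "\<delta> * measure lebesgue (T h) \<le> \<delta> * \<epsilon>"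
    proof -
      have "L * (measure lborel (cball x0 (r + h)) - measure lborel (ball x0 (r - h))) < \<epsilon> * \<delta>"
        using h(1) \<delta> by (simp only: pos_divide_less_eq)
      then show ?thesis using est[OF h(2,3)] by (simp only: mult.commute[of \<epsilon>])
    qed
    then have "measure lebesgue (T h) \<le> \<epsilon>" using \<delta> by simp
    moreover have "{x \<in> ball x0 r. \<forall>h. 0 < h \<and> h \<le> r \<longrightarrow> \<delta> * h \<le> f (x + h *\<^sub>R e) - 2 * f x + f (x - h *\<^sub>R e)} \<subseteq> T h"
    proof clarify
      fix x assume x: "x \<in> ball x0 r" and a: "\<forall>h. 0 < h \<and> h \<le> r \<longrightarrow> \<delta> * h \<le> f (x + h *\<^sub>R e) - 2 * f x + f (x - h *\<^sub>R e)"
      have d: "dist x0 x \<le> 2 * r" using x r by simp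
      show "x \<in> T h"
        using near[OF d, of h] near[OF d, of "- h"] near[OF d, of 0] h a x by (auto simp: T_def C_def F_def)
    qed
    ultimately show "\<exists>T. {x \<in> ball x0 r. \<forall>h. 0 < h \<and> h \<le> r \<longrightarrow> \<delta> * h \<le> f (x + h *\<^sub>R e) - 2 * f x + f (x - h *\<^sub>R e)} \<subseteq> T
        \<and> T \<in> lmeasurable \<and> measure lebesgue T \<le> \<epsilon>"
      using Tf by blast
  qed
qed

text \<open>At a point where \<open>f\<close> is not differentiable, second differences in some
  coordinate direction stay above \<open>h / Suc m\<close> for some \<open>m\<close>; near any given
  point this leaves countably many null sets.\<close>

theorem negligible_convex_not_differentiable:
  fixes f :: "'a::euclidean_space \<Rightarrow> real"
  assumes f: "convex_on S f" and S: "open S"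
  shows "negligible {x \<in> S. \<nexists>D. GDERIV f x :> D}"
  unfolding locally_negligible_alt[of "{x \<in> S. \<nexists>D. GDERIV f x :> D}"]
proof
  fix x0 assume x0: "x0 \<in> {x \<in> S. \<nexists>D. GDERIV f x :> D}"
  then obtain R where R: "0 < R" "cball x0 R \<subseteq> S" using S open_contains_cball by blast
  define r where "r = R / 3"
  have r: "0 < r" "cball x0 (3 * r) \<subseteq> S" using R by (auto simp: r_def)
  define bad where "bad e m = {x \<in> ball x0 r. \<forall>h. 0 < h \<and> h \<le> r \<longrightarrow> (1 / real (Suc m)) * h \<le> f (x + h *\<^sub>R e) - 2 * f x + f (x - h *\<^sub>R e)}" for e m
  have "negligible (\<Union>e\<in>Basis. \<Union>m. bad e m)"
  proof -
    have "negligible (bad e m)" if "e \<in> Basis" for e m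
      unfolding bad_def using that
      by (intro negligible_convex_second_difference[OF f S r]) auto
    then show ?thesis
      by (intro negligible_Union finite_imageI finite_Basis) (auto intro: negligible_Union_nat)
  qed
  moreover have "{x \<in> S. \<nexists>D. GDERIV f x :> D} \<inter> ball x0 r \<subseteq> (\<Union>e\<in>Basis. \<Union>m. bad e m)"
  proof (rule ccontr)
    assume "\<not> ?thesis"
    then obtain x where x': "x \<in> {x \<in> S. \<nexists>D. GDERIV f x :> D} \<inter> ball x0 r" "x \<notin> (\<Union>e\<in>Basis. \<Union>m. bad e m)"
      unfolding subset_iff not_all not_imp by (elim exE conjE)
    from x'(1) have x: "x \<in> ball x0 r" "\<nexists>D. GDERIV f x :> D" by simp_all
    from x'(2) have nb: "\<And>e m. e \<in> Basis \<Longrightarrow> x \<notin> bad e m" by simp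
    have "cball x r \<subseteq> S"
    proof
      fix y assume "y \<in> cball x r"
      then have "dist x0 y \<le> 3 * r" using dist_triangle[of x0 y x] x(1) r by simp
      then show "y \<in> S" using r by auto
    qed
    moreover have "\<exists>h. 0 < h \<and> h \<le> r \<and> f (x + h *\<^sub>R e) - 2 * f x + f (x - h *\<^sub>R e) < \<delta> * h"
      if e: "e \<in> Basis" and \<delta>: "0 < \<delta>" for e \<delta>
    proof -
      obtain m where m: "1 / real (Suc m) < \<delta>" using \<delta> reals_Archimedean by (metis inverse_eq_divide)
      obtain h where h: "0 < h" "h \<le> r" "f (x + h *\<^sub>R e) - 2 * f x + f (x - h *\<^sub>R e) < (1 / real (Suc m)) * h"
        using nb[OF e, of m] x(1) by (auto simp: bad_def not_le simp del: of_nat_Suc)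
      moreover have "(1 / real (Suc m)) * h \<le> \<delta> * h" using m h by (intro mult_right_mono) auto
      ultimately show ?thesis by force
    qed
    ultimately have "\<exists>D. GDERIV f x :> D" by (rule GDERIV_convex_on[OF f r(1)])
    with x(2) show False by (rule notE)
  qed
  ultimately have "negligible ({x \<in> S. \<nexists>D. GDERIV f x :> D} \<inter> ball x0 r)" by (rule negligible_subset)
  then show "\<exists>U. openin (top_of_set {x \<in> S. \<nexists>D. GDERIV f x :> D}) U \<and> x0 \<in> U \<and> negligible U"
    using x0 r by (intro exI[of _ "{x \<in> S. \<nexists>D. GDERIV f x :> D} \<inter> ball x0 r"]) (auto intro: openin_open_Int)
qed

section \<open>Functions with compact domain and epi-convergence\<close>

definition restr :: "('a \<Rightarrow> ereal) \<Rightarrow> 'a set \<Rightarrow> 'a \<Rightarrow> ereal" where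
  "restr u A = (\<lambda>x. if x \<in> A then u x else \<infinity>)"

lemma restr_restr: "restr (restr u A) B = restr u (A \<inter> B)"
  by (auto simp: restr_def)

lemma edom_restr: "edom (restr u A) = edom u \<inter> A"
  by (auto simp: edom_def restr_def)

lemma not_edom: "x \<notin> edom u \<Longrightarrow> u x = \<infinity>"
  by (simp add: edom_def)

lemma restr_edom: "edom u \<subseteq> A \<Longrightarrow> restr u A = u"
  by (rule ext) (metis not_edom restr_def subsetD)

text \<open>The definition uses the punctured filter \<open>at x\<close>; \<open>nhds x\<close> may
  replace it because the inequality holds at \<open>x\<close> itself.\<close>

lemma lower_semicont_iff:
  "lower_semicont u \<longleftrightarrow> (\<forall>x c. c < u x \<longrightarrow> (\<forall>\<^sub>F y in nhds x. c < u y))"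
  unfolding lower_semicont_def le_Liminf_iff eventually_nhds_conv_at by meson

lemma lower_semicont_open:
  assumes "lower_semicont u"
  shows "open {x. c < u x}"
proof (subst open_subopen, rule ballI)
  fix x assume "x \<in> {x. c < u x}"
  then have "\<forall>\<^sub>F y in nhds x. c < u y" using assms by (simp add: lower_semicont_iff)
  then obtain S where "open S" "x \<in> S" "\<forall>y\<in>S. c < u y" unfolding eventually_nhds by (elim exE conjE)
  then show "\<exists>T. open T \<and> x \<in> T \<and> T \<subseteq> {x. c < u x}" by (intro exI[of _ S]) (simp add: subset_eq)
qed

lemma lower_semicont_LIMSEQ:
  assumes "lower_semicont u" "X \<longlonglongrightarrow> x"
  shows "u x \<le> liminf (\<lambda>j. u (X j))"
  unfolding le_Liminf_iff
  using assms(1) by (auto simp: lower_semicont_iff intro: eventually_compose_filterlim[OF _ assms(2)])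

text \<open>Super-coercivity follows from the compact domain: outside of a ball the function, and
  with it the quotient, is infinite.\<close>

lemma Conv_cdI:
  fixes u :: "'a::euclidean_space \<Rightarrow> ereal"
  assumes "\<And>x. u x \<noteq> -\<infinity>" "edom u \<noteq> {}" "ereal_convex u" "lower_semicont u" "compact (edom u)"
  shows "u \<in> Conv_cd"
proof -
  obtain R where R: "\<And>x. x \<in> edom u \<Longrightarrow> norm x \<le> R"
    using assms(5) compact_imp_bounded bounded_iff by metis
  have "\<forall>\<^sub>F x in at_infinity. u x / ereal (norm x) = \<infinity>"
    unfolding eventually_at_infinity
  proof (intro exI[of _ "max R 0 + 1"] allI impI)
    fix x :: 'a assume x: "max R 0 + 1 \<le> norm x"
    then have "x \<notin> edom u" using R[of x] by auto
    then have "u x = \<infinity>" by (simp add: edom_def)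
    moreover have "0 < norm x" using x by linarith
    ultimately show "u x / ereal (norm x) = \<infinity>" by (simp add: divide_ereal_def)
  qed
  then have "((\<lambda>x. u x / ereal (norm x)) \<longlongrightarrow> \<infinity>) at_infinity"
    by (rule tendsto_eventually)
  then show ?thesis using assms by (auto simp: Conv_cd_def Conv_sc_def Conv_def edom_def)
qed

lemma Conv_cdD:
  assumes "u \<in> Conv_cd"
  shows "u x \<noteq> -\<infinity>" "edom u \<noteq> {}" "ereal_convex u" "lower_semicont u" "compact (edom u)"
  using assms by (auto simp: Conv_cd_def Conv_sc_def Conv_def edom_def)

abbreviation fin :: "('a \<Rightarrow> ereal) \<Rightarrow> 'a \<Rightarrow> real" where
  "fin u x \<equiv> real_of_ereal (u x)"

lemma fin_eq: "u \<in> Conv_cd \<Longrightarrow> x \<in> edom u \<Longrightarrow> u x = ereal (fin u x)"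
  using Conv_cdD(1)[of u x] by (cases "u x") (auto simp: edom_def)

lemma ereal_convex_edom:
  assumes "ereal_convex u" "\<And>x. u x \<noteq> -\<infinity>"
  shows "convex (edom u)" "convex_on (edom u) (fin u)"
proof -
  have *: "(1 - t) *\<^sub>R x + t *\<^sub>R y \<in> edom u \<and> fin u ((1 - t) *\<^sub>R x + t *\<^sub>R y) \<le> (1 - t) * fin u x + t * fin u y"
    if h: "x \<in> edom u" "y \<in> edom u" "0 \<le> t" "t \<le> 1" for x y t
  proof -
    obtain a b where ab: "u x = ereal a" "u y = ereal b"
      using h(1,2) assms(2)[of x] assms(2)[of y] by (cases "u x"; cases "u y") (auto simp: edom_def)
    have "u ((1 - t) *\<^sub>R x + t *\<^sub>R y) \<le> ereal (1 - t) * u x + ereal t * u y"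
      using assms(1) h by (auto simp: ereal_convex_def)
    also have "\<dots> = ereal ((1 - t) * a + t * b)" by (simp add: ab)
    finally show ?thesis
      using assms(2)[of "(1 - t) *\<^sub>R x + t *\<^sub>R y"] ab
      by (cases "u ((1 - t) *\<^sub>R x + t *\<^sub>R y)") (auto simp: edom_def)
  qed
  show c: "convex (edom u)" unfolding convex_alt using * by auto
  show "convex_on (edom u) (fin u)"
    by (rule convex_onI) (use * c in auto)
qed

lemma convex_edom: "u \<in> Conv_cd \<Longrightarrow> convex (edom u)"
  and convex_on_fin: "u \<in> Conv_cd \<Longrightarrow> convex_on (edom u) (fin u)"
  using ereal_convex_edom[of u] Conv_cdD(1,3)[of u] by auto

lemma ereal_convexI:
  assumes "convex D" "convex_on D f" "\<And>x. x \<in> D \<Longrightarrow> u x = ereal (f x)" "\<And>x. x \<notin> D \<Longrightarrow> u x = \<infinity>"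
  shows "ereal_convex u"
  unfolding ereal_convex_def
proof (intro allI ballI)
  fix x y and t :: real assume t: "t \<in> {0..1}"
  have nn: "u z \<noteq> -\<infinity>" for z using assms(3,4)[of z] by (cases "z \<in> D") auto
  \<comment> \<open>For \<open>0 < t < 1\<close> an infinite value makes the right side infinite. At
    the end points \<open>0 * \<infinity> = 0\<close> would break this argument, but there the
    inequality is trivial.\<close>
  consider "t = 0" | "t = 1" | "0 < t" "t < 1" using t by fastforce
  then show "u ((1 - t) *\<^sub>R x + t *\<^sub>R y) \<le> ereal (1 - t) * u x + ereal t * u y"
  proof cases
    case 3
    show ?thesis
    proof (cases "x \<in> D \<and> y \<in> D")
      case True
      then have "(1 - t) *\<^sub>R x + t *\<^sub>R y \<in> D" using assms(1) 3 by (simp add: convex_alt)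
      moreover have "f ((1 - t) *\<^sub>R x + t *\<^sub>R y) \<le> (1 - t) * f x + t * f y"
        using convex_onD[OF assms(2)] True 3 by auto
      ultimately show ?thesis using True by (simp add: assms(3))
    next
      case False
      then have "u x = \<infinity> \<or> u y = \<infinity>" using assms(4) by auto
      then have inf: "ereal (1 - t) * u x + ereal t * u y = \<infinity>" using 3 nn[of x] nn[of y] by auto
      show ?thesis unfolding inf by simp
    qed
  qed (auto simp: zero_ereal_def[symmetric] one_ereal_def[symmetric])
qed

lemma restr_Conv_cd:
  fixes u :: "'a::euclidean_space \<Rightarrow> ereal"
  assumes u: "u \<in> Conv_cd" and A: "closed A" "convex A" "edom u \<inter> A \<noteq> {}"
  shows "restr u A \<in> Conv_cd"
proof (rule Conv_cdI)
  show "restr u A x \<noteq> -\<infinity>" for x using Conv_cdD(1)[OF u] by (simp add: restr_def)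
  show "edom (restr u A) \<noteq> {}" using A by (simp add: edom_restr)
  show "ereal_convex (restr u A)"
  proof (rule ereal_convexI)
    show "convex (edom u \<inter> A)" using convex_edom[OF u] A by (intro convex_Int)
    then show "convex_on (edom u \<inter> A) (fin u)"
      using convex_on_subset[OF convex_on_fin[OF u]] by auto
  qed (use fin_eq[OF u] in \<open>auto simp: restr_def edom_def\<close>)
  show "lower_semicont (restr u A)" unfolding lower_semicont_iff
  proof (intro allI impI)
    fix x c assume c: "c < restr u A x"
    show "\<forall>\<^sub>F y in nhds x. c < restr u A y"
    proof (cases "x \<in> A")
      case True
      then have "c < u x" using c by (simp add: restr_def)
      then have "\<forall>\<^sub>F y in nhds x. c < u y" using Conv_cdD(4)[OF u] by (simp add: lower_semicont_iff)
      moreover have "c < \<infinity>" using c by auto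
      ultimately show ?thesis by (auto elim!: eventually_mono simp: restr_def)
    next
      case False
      then have "\<forall>\<^sub>F y in nhds x. y \<in> - A" using A(1) by (intro eventually_nhds_in_open) auto
      moreover have "c < \<infinity>" using c by auto
      ultimately show ?thesis by (auto elim!: eventually_mono simp: restr_def)
    qed
  qed
  show "compact (edom (restr u A))"
    using Conv_cdD(5)[OF u] A by (simp add: edom_restr compact_Int_closed)
qed

lemma restr_real_Conv_cd:
  fixes f :: "'a::euclidean_space \<Rightarrow> real"
  assumes D: "compact D" "convex D" "D \<noteq> {}" and f: "convex_on D f" "continuous_on D f"
  shows "restr (\<lambda>x. ereal (f x)) D \<in> Conv_cd"
proof (rule Conv_cdI)
  have e: "edom (restr (\<lambda>x. ereal (f x)) D) = D" by (auto simp: edom_def restr_def)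
  show "edom (restr (\<lambda>x. ereal (f x)) D) \<noteq> {}" "compact (edom (restr (\<lambda>x. ereal (f x)) D))"
    using D e by auto
  show "ereal_convex (restr (\<lambda>x. ereal (f x)) D)"
    by (rule ereal_convexI[OF D(2) f(1)]) (auto simp: restr_def)
  show "restr (\<lambda>x. ereal (f x)) D x \<noteq> -\<infinity>" for x by (simp add: restr_def)
  show "lower_semicont (restr (\<lambda>x. ereal (f x)) D)" unfolding lower_semicont_def
  proof
    fix x
    show "restr (\<lambda>x. ereal (f x)) D x \<le> Liminf (at x) (restr (\<lambda>x. ereal (f x)) D)"
      unfolding le_Liminf_iff
    proof (intro allI impI)
      fix c assume c: "c < restr (\<lambda>x. ereal (f x)) D x"
      show "\<forall>\<^sub>F y in at x. c < restr (\<lambda>x. ereal (f x)) D y"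
      proof (cases "x \<in> D")
        case True
        then have "((\<lambda>y. ereal (f y)) \<longlongrightarrow> ereal (f x)) (at x within D)"
          using f(2) by (auto simp: continuous_on_def)
        then have "\<forall>\<^sub>F y in at x within D. c < ereal (f y)"
          using c True by (intro order_tendstoD(1)) (auto simp: restr_def)
        then show ?thesis using c True
          by (auto simp: eventually_at_filter restr_def elim!: eventually_mono)
      next
        case False
        then have "\<forall>\<^sub>F y in nhds x. y \<in> - D" using compact_imp_closed[OF D(1)]
          by (intro eventually_nhds_in_open) auto
        moreover have "c < \<infinity>" using c by auto
        ultimately show ?thesis unfolding eventually_at_filter by (auto elim!: eventually_mono simp: restr_def)
      qed
    qed
  qed
qed

lemma translate_Conv_cd:
  fixes u :: "'a::euclidean_space \<Rightarrow> ereal"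
  assumes u: "u \<in> Conv_cd"
  shows "(\<lambda>y. u (y - a) + ereal b) \<in> Conv_cd"
proof (rule Conv_cdI)
  let ?v = "\<lambda>y. u (y - a) + ereal b"
  have "u (y - a) + ereal b < \<infinity> \<longleftrightarrow> u (y - a) < \<infinity>" for y by (cases "u (y - a)") auto
  then have e: "edom ?v = (+) a ` edom u" 
    by (force simp: edom_def image_iff intro: exI[of _ "_ - a"])
  show "edom ?v \<noteq> {}" using Conv_cdD(2)[OF u] e by simp
  show "compact (edom ?v)" using Conv_cdD(5)[OF u] e compact_translation by metis
  show "?v x \<noteq> -\<infinity>" for x using Conv_cdD(1)[OF u, of "x - a"] by (cases "u (x - a)") auto
  show "lower_semicont ?v" unfolding lower_semicont_iff
  proof (intro allI impI)
    fix x c assume c: "c < u (x - a) + ereal b"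
    have *: "c < r + ereal b \<longleftrightarrow> c - ereal b < r" for r by (simp add: ereal_minus_less)
    have "\<forall>\<^sub>F z in nhds (x - a). c - ereal b < u z"
      using c Conv_cdD(4)[OF u] unfolding * lower_semicont_iff by blast
    then show "\<forall>\<^sub>F y in nhds x. c < u (y - a) + ereal b" unfolding *
      by (rule eventually_compose_filterlim) (auto intro!: tendsto_intros filterlim_ident)
  qed
  show "ereal_convex ?v"
  proof (rule ereal_convexI[where D = "(+) a ` edom u" and f = "\<lambda>y. fin u (y - a) + b"])
    show cv: "convex ((+) a ` edom u)" using convex_edom[OF u] by (rule convex_translation)
    show "convex_on ((+) a ` edom u) (\<lambda>y. fin u (y - a) + b)"
    proof (rule convex_onI[OF _ cv])
      fix t x y assume t: "0 < t" "t < (1::real)" and xy: "x \<in> (+) a ` edom u" "y \<in> (+) a ` edom u"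
      have "fin u ((1 - t) *\<^sub>R (x - a) + t *\<^sub>R (y - a)) \<le> (1 - t) * fin u (x - a) + t * fin u (y - a)"
        using t xy by (intro convex_onD[OF convex_on_fin[OF u]]) auto
      moreover have "(1 - t) *\<^sub>R (x - a) + t *\<^sub>R (y - a) = (1 - t) *\<^sub>R x + t *\<^sub>R y - a"
        by (simp add: algebra_simps)
      ultimately show "fin u ((1 - t) *\<^sub>R x + t *\<^sub>R y - a) + b \<le> (1 - t) * (fin u (x - a) + b) + t * (fin u (y - a) + b)"
        by (simp add: algebra_simps)
    qed
    show "?v x = ereal (fin u (x - a) + b)" if "x \<in> (+) a ` edom u" for x
    proof -
      have "x - a \<in> edom u" using that by auto
      then show ?thesis using fin_eq[OF u, of "x - a"] by (metis plus_ereal.simps(1))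
    qed
    show "?v x = \<infinity>" if "x \<notin> (+) a ` edom u" for x
    proof -
      have "x - a \<notin> edom u" using that by (metis add.commute diff_add_cancel image_eqI)
      then show ?thesis by (simp add: not_edom)
    qed
  qed
qed

lemma dilate_Conv_cd:
  fixes u :: "'a::euclidean_space \<Rightarrow> ereal"
  assumes u: "u \<in> Conv_cd" and t: "0 < t"
  shows "(\<lambda>x. ereal t * u (x /\<^sub>R t)) \<in> Conv_cd"
proof (rule Conv_cdI)
  let ?v = "\<lambda>x. ereal t * u (x /\<^sub>R t)"
  have "ereal t * r < \<infinity> \<longleftrightarrow> r < \<infinity>" for r using t by (cases r) auto
  then have e: "edom ?v = (\<lambda>x. t *\<^sub>R x) ` edom u"
    using t by (force simp: edom_def image_iff intro: exI[of _ "_ /\<^sub>R t"])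
  show "edom ?v \<noteq> {}" using Conv_cdD(2)[OF u] e by simp
  show "compact (edom ?v)" unfolding e using Conv_cdD(5)[OF u] by (rule compact_scaling)
  show "?v x \<noteq> -\<infinity>" for x using Conv_cdD(1)[OF u, of "x /\<^sub>R t"] t by (cases "u (x /\<^sub>R t)") auto
  show "lower_semicont ?v" unfolding lower_semicont_iff
  proof (intro allI impI)
    fix x c assume c: "c < ereal t * u (x /\<^sub>R t)"
    have *: "c < ereal t * r \<longleftrightarrow> c / ereal t < r" for r
      using t by (simp add: ereal_divide_less_iff mult.commute)
    have "\<forall>\<^sub>F z in nhds (x /\<^sub>R t). c / ereal t < u z"
      using c Conv_cdD(4)[OF u] unfolding * lower_semicont_iff by blast
    then show "\<forall>\<^sub>F y in nhds x. c < ereal t * u (y /\<^sub>R t)" unfolding *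
      by (rule eventually_compose_filterlim) (auto intro!: tendsto_intros filterlim_ident)
  qed
  show "ereal_convex ?v"
  proof (rule ereal_convexI[where D = "(\<lambda>x. t *\<^sub>R x) ` edom u" and f = "\<lambda>y. t * fin u (y /\<^sub>R t)"])
    show cv: "convex ((\<lambda>x. t *\<^sub>R x) ` edom u)" using convex_edom[OF u] by (rule convex_scaling)
    show "convex_on ((\<lambda>x. t *\<^sub>R x) ` edom u) (\<lambda>y. t * fin u (y /\<^sub>R t))"
    proof (rule convex_onI[OF _ cv])
      fix s x y assume s: "0 < s" "s < (1::real)" and xy: "x \<in> (\<lambda>x. t *\<^sub>R x) ` edom u" "y \<in> (\<lambda>x. t *\<^sub>R x) ` edom u"
      have "t * fin u ((1 - s) *\<^sub>R (x /\<^sub>R t) + s *\<^sub>R (y /\<^sub>R t)) \<le> t * ((1 - s) * fin u (x /\<^sub>R t) + s * fin u (y /\<^sub>R t))"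
        using t s xy by (intro mult_left_mono convex_onD[OF convex_on_fin[OF u]]) auto
      moreover have "(1 - s) *\<^sub>R (x /\<^sub>R t) + s *\<^sub>R (y /\<^sub>R t) = ((1 - s) *\<^sub>R x + s *\<^sub>R y) /\<^sub>R t"
        by (simp add: algebra_simps)
      ultimately show "t * fin u (((1 - s) *\<^sub>R x + s *\<^sub>R y) /\<^sub>R t) \<le> (1 - s) * (t * fin u (x /\<^sub>R t)) + s * (t * fin u (y /\<^sub>R t))"
        by (simp add: algebra_simps)
    qed
    show "?v x = ereal (t * fin u (x /\<^sub>R t))" if "x \<in> (\<lambda>x. t *\<^sub>R x) ` edom u" for x
    proof -
      have "x /\<^sub>R t \<in> edom u" using that t by auto
      then show ?thesis using fin_eq[OF u, of "x /\<^sub>R t"] by (metis times_ereal.simps(1))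
    qed
    show "?v x = \<infinity>" if "x \<notin> (\<lambda>x. t *\<^sub>R x) ` edom u" for x
    proof -
      have "x = t *\<^sub>R (x /\<^sub>R t)" using t by simp
      then have "x /\<^sub>R t \<notin> edom u" using that by (metis image_eqI)
      then show ?thesis using t by (simp add: not_edom)
    qed
  qed
qed

text \<open>Lower semicontinuity makes the sets where \<open>u\<close> exceeds \<open>- n\<close>
  open; finitely many of them cover the compact domain.\<close>

lemma Conv_cd_bdd_below:
  fixes u :: "'a::euclidean_space \<Rightarrow> ereal"
  assumes u: "u \<in> Conv_cd"
  obtains m :: real where "\<And>x. ereal m \<le> u x"
proof -
  have "\<exists>n::nat. u x > ereal (- real n)" for x
  proof (cases "u x")
    case (real r)
    obtain n :: nat where "- r < real n" using reals_Archimedean2 by blast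
    then show ?thesis using real by (intro exI[of _ n]) auto
  qed (use Conv_cdD(1)[OF u, of x] in auto)
  then have "edom u \<subseteq> (\<Union>n::nat\<in>UNIV. {x. ereal (- real n) < u x})" by blast
  then obtain F where F: "finite F" "edom u \<subseteq> (\<Union>n\<in>F. {x. ereal (- real n) < u x})"
    by (rule compactE_image[OF Conv_cdD(5)[OF u] lower_semicont_open[OF Conv_cdD(4)[OF u]]])
  have "ereal (- real (Max F)) \<le> u x" for x
  proof (cases "x \<in> edom u")
    case True
    then obtain n where n: "n \<in> F" "ereal (- real n) < u x" using F(2) by blast
    then have "- real (Max F) \<le> - real n" using F(1) by simp
    then have "ereal (- real (Max F)) \<le> ereal (- real n)" by simp
    with n(2) show ?thesis by order
  qed (simp add: not_edom)
  then show ?thesis by (rule that)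
qed

section \<open>Lower boundaries of convex bodies and truncated epigraphs\<close>

lemma convex_body_fiber:
  fixes K :: "('a::euclidean_space \<times> real) set"
  assumes "K \<in> convex_bodies"
  shows lower_boundary_le: "(x, t) \<in> K \<Longrightarrow> \<lfloor>K\<rfloor>\<^sub>b x \<le> ereal t"
    and lower_boundary_attained: "\<lfloor>K\<rfloor>\<^sub>b x \<noteq> \<infinity> \<Longrightarrow> \<exists>s. \<lfloor>K\<rfloor>\<^sub>b x = ereal s \<and> (x, s) \<in> K"
proof -
  show "(x, t) \<in> K \<Longrightarrow> \<lfloor>K\<rfloor>\<^sub>b x \<le> ereal t"
    unfolding lower_boundary_fun_def by (rule INF_lower) simp
  assume ne: "\<lfloor>K\<rfloor>\<^sub>b x \<noteq> \<infinity>"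
  let ?T = "{t. (x, t) \<in> K}"
  have "?T \<noteq> {}"
  proof
    assume "?T = {}"
    then have "\<lfloor>K\<rfloor>\<^sub>b x = \<infinity>" unfolding lower_boundary_fun_def by (simp only: image_empty Inf_empty top_ereal_def)
    with ne show False by simp
  qed
  moreover have "compact ?T"
  proof -
    have cK: "compact K" using assms by (simp add: convex_bodies_def)
    have "?T = snd ` (K \<inter> ({x} \<times> UNIV))" by force
    moreover have "compact (K \<inter> ({x} \<times> UNIV))" by (intro compact_Int_closed cK closed_Times) auto
    ultimately show ?thesis by (auto intro!: compact_continuous_image continuous_intros)
  qed
  ultimately have "\<exists>s\<in>?T. \<forall>t\<in>?T. s \<le> t" by (intro compact_attains_inf)
  then obtain s where "s \<in> ?T" "\<forall>t\<in>?T. s \<le> t" by (elim bexE)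
  then have s: "s \<in> ?T" "\<And>t. t \<in> ?T \<Longrightarrow> s \<le> t" by simp_all
  have "\<lfloor>K\<rfloor>\<^sub>b x = ereal s" unfolding lower_boundary_fun_def
    by (rule antisym) (use s in \<open>auto intro: INF_lower INF_greatest\<close>)
  then show "\<exists>s. \<lfloor>K\<rfloor>\<^sub>b x = ereal s \<and> (x, s) \<in> K" using s by auto
qed

lemma edom_lower_boundary:
  assumes "K \<in> convex_bodies"
  shows "edom \<lfloor>K\<rfloor>\<^sub>b = fst ` K"
proof
  show "edom \<lfloor>K\<rfloor>\<^sub>b \<subseteq> fst ` K"
    using lower_boundary_attained[OF assms] by (force simp: edom_def)
  show "fst ` K \<subseteq> edom \<lfloor>K\<rfloor>\<^sub>b"
    using lower_boundary_le[OF assms] by (force simp: edom_def intro: le_less_trans)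
qed

lemma lower_boundary_Conv_cd:
  fixes K :: "('a::euclidean_space \<times> real) set"
  assumes K: "K \<in> convex_bodies"
  shows "\<lfloor>K\<rfloor>\<^sub>b \<in> Conv_cd"
proof (rule Conv_cdI)
  have K': "K \<noteq> {}" "compact K" "convex K" using K by (auto simp: convex_bodies_def)
  note e = edom_lower_boundary[OF K]
  note at = lower_boundary_attained[OF K] and le = lower_boundary_le[OF K]
  show "\<lfloor>K\<rfloor>\<^sub>b x \<noteq> -\<infinity>" for x using at[of x] by (cases "\<lfloor>K\<rfloor>\<^sub>b x") auto
  have in_K: "(x, fin \<lfloor>K\<rfloor>\<^sub>b x) \<in> K" "\<lfloor>K\<rfloor>\<^sub>b x = ereal (fin \<lfloor>K\<rfloor>\<^sub>b x)" if "x \<in> fst ` K" for x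
    using at[of x] that[folded e] by (auto simp: edom_def)
  show "edom \<lfloor>K\<rfloor>\<^sub>b \<noteq> {}" using e K' by simp
  show "compact (edom \<lfloor>K\<rfloor>\<^sub>b)" unfolding e using K' by (intro compact_continuous_image continuous_intros)
  have cv: "convex (fst ` K)" using K' by (intro convex_linear_image) (auto intro: linear_fst)
  show "ereal_convex \<lfloor>K\<rfloor>\<^sub>b"
  proof (rule ereal_convexI[OF cv, where f = "fin \<lfloor>K\<rfloor>\<^sub>b"])
    show "convex_on (fst ` K) (fin \<lfloor>K\<rfloor>\<^sub>b)"
    proof (rule convex_onI[OF _ cv])
      fix t x y assume t: "0 < t" "t < (1::real)" and xy: "x \<in> fst ` K" "y \<in> fst ` K"
      have "(1 - t) *\<^sub>R (x, fin \<lfloor>K\<rfloor>\<^sub>b x) + t *\<^sub>R (y, fin \<lfloor>K\<rfloor>\<^sub>b y) \<in> K"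
        using convexD_alt[OF K'(3) in_K(1)[OF xy(1)] in_K(1)[OF xy(2)], of t] t by auto
      then have "((1 - t) *\<^sub>R x + t *\<^sub>R y, (1 - t) * fin \<lfloor>K\<rfloor>\<^sub>b x + t * fin \<lfloor>K\<rfloor>\<^sub>b y) \<in> K" by simp
      from le[OF this] in_K(2)[of "(1 - t) *\<^sub>R x + t *\<^sub>R y"] this
      show "fin \<lfloor>K\<rfloor>\<^sub>b ((1 - t) *\<^sub>R x + t *\<^sub>R y) \<le> (1 - t) * fin \<lfloor>K\<rfloor>\<^sub>b x + t * fin \<lfloor>K\<rfloor>\<^sub>b y"
        by (metis ereal_less_eq(3) fst_conv image_eqI)
    qed
  qed (use in_K e in \<open>auto simp: edom_def\<close>)
  \<comment> \<open>If the values stay at most \<open>c\<close> along points tending to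
    \<open>x\<close>, the graph points over them subconverge in the compact set \<open>K\<close> to
    a point over \<open>x\<close> of height at most \<open>c\<close>.\<close>
  show "lower_semicont \<lfloor>K\<rfloor>\<^sub>b" unfolding lower_semicont_iff
  proof (intro allI impI, rule ccontr)
    fix x c assume c: "c < \<lfloor>K\<rfloor>\<^sub>b x" and n: "\<not> (\<forall>\<^sub>F y in nhds x. c < \<lfloor>K\<rfloor>\<^sub>b y)"
    have "\<exists>y. dist y x < 1 / Suc n \<and> \<lfloor>K\<rfloor>\<^sub>b y \<le> c" for n
      using n unfolding eventually_nhds_metric by (meson divide_pos_pos not_le of_nat_0_less_iff zero_less_Suc zero_less_one)
    then obtain Y where Y: "\<And>n. dist (Y n) x < 1 / Suc n" "\<And>n. \<lfloor>K\<rfloor>\<^sub>b (Y n) \<le> c" by metis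
    have cinf: "c < \<infinity>" using c by auto
    have YK: "(Y n, fin \<lfloor>K\<rfloor>\<^sub>b (Y n)) \<in> K" "\<lfloor>K\<rfloor>\<^sub>b (Y n) = ereal (fin \<lfloor>K\<rfloor>\<^sub>b (Y n))" for n
    proof -
      have "\<lfloor>K\<rfloor>\<^sub>b (Y n) < \<infinity>" using Y(2) cinf by (rule le_less_trans)
      then obtain s where "\<lfloor>K\<rfloor>\<^sub>b (Y n) = ereal s" "(Y n, s) \<in> K" using at[of "Y n"] by auto
      then show "(Y n, fin \<lfloor>K\<rfloor>\<^sub>b (Y n)) \<in> K" "\<lfloor>K\<rfloor>\<^sub>b (Y n) = ereal (fin \<lfloor>K\<rfloor>\<^sub>b (Y n))" by simp_all
    qed
    obtain l r where l: "l \<in> K" "strict_mono r" "((\<lambda>n. (Y n, fin \<lfloor>K\<rfloor>\<^sub>b (Y n))) \<circ> r) \<longlonglongrightarrow> l"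
      by (rule seq_compactE[OF compact_imp_seq_compact[OF K'(2)], of "\<lambda>n. (Y n, fin \<lfloor>K\<rfloor>\<^sub>b (Y n))"])
        (use YK(1) in auto)
    have "dist (Y n) x \<le> inverse (real (Suc n))" for n
      using Y(1)[of n] by (simp add: inverse_eq_divide)
    then have "(\<lambda>n. dist (Y n) x) \<longlonglongrightarrow> 0"
      by (intro tendsto_sandwich[OF _ _ tendsto_const LIMSEQ_inverse_real_of_nat] always_eventually allI zero_le_dist)
    then have Yx: "Y \<longlonglongrightarrow> x" using tendsto_dist_iff by blast
    have 1: "(\<lambda>n. Y (r n)) \<longlonglongrightarrow> fst l" using tendsto_fst[OF l(3)] by (simp add: o_def)
    have 2: "(\<lambda>n. fin \<lfloor>K\<rfloor>\<^sub>b (Y (r n))) \<longlonglongrightarrow> snd l" using tendsto_snd[OF l(3)] by (simp add: o_def)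
    have "fst l = x" using 1 LIMSEQ_subseq_LIMSEQ[OF Yx l(2)] LIMSEQ_unique by (fastforce simp: o_def)
    then have "\<lfloor>K\<rfloor>\<^sub>b x \<le> ereal (snd l)" using l(1) le by (metis prod.collapse)
    moreover have "ereal (snd l) \<le> c"
    proof (rule LIMSEQ_le_const2)
      show "(\<lambda>n. ereal (fin \<lfloor>K\<rfloor>\<^sub>b (Y (r n)))) \<longlonglongrightarrow> ereal (snd l)" using 2 by simp
      show "\<exists>N. \<forall>n\<ge>N. ereal (fin \<lfloor>K\<rfloor>\<^sub>b (Y (r n))) \<le> c" using Y(2) YK(2) by metis
    qed
    ultimately show False using c by simp
  qed
qed

text \<open>The epigraph cut off at height \<open>R\<close>. It makes compactness of families of
  bodies available for functions and realises a function that is bounded above on its domain as a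
  lower boundary.\<close>

lemma epi_body:
  fixes u :: "'a::euclidean_space \<Rightarrow> ereal"
  assumes u: "u \<in> Conv_cd" and R: "\<And>x. x \<in> edom u \<Longrightarrow> u x \<le> ereal R"
  defines "K \<equiv> {(x, t). u x \<le> ereal t \<and> t \<le> R}"
  shows "K \<in> convex_bodies" "\<lfloor>K\<rfloor>\<^sub>b = u"
proof -
  have in_K: "(x, fin u x) \<in> K" if "x \<in> edom u" for x
    using fin_eq[OF u that] R[OF that] by (simp add: K_def) (metis ereal_less_eq(3))
  obtain m where m: "\<And>x. ereal m \<le> u x" using Conv_cd_bdd_below[OF u] by blast
  have sub: "K \<subseteq> edom u \<times> {m..R}"
  proof clarify
    fix x t assume "(x, t) \<in> K"
    then have "u x \<le> ereal t" "t \<le> R" by (auto simp: K_def)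
    moreover have "ereal m \<le> ereal t" using m[of x] \<open>u x \<le> ereal t\<close> by order
    ultimately show "x \<in> edom u \<and> t \<in> {m..R}" by (auto simp: edom_def intro: le_less_trans)
  qed
  have bK: "bounded K"
    using sub Conv_cdD(5)[OF u] by (intro bounded_subset[OF bounded_Times]) (auto intro: compact_imp_bounded)
  have "closed K" unfolding closed_sequential_limits
  proof (intro allI impI, elim conjE)
    fix X l assume X: "\<forall>n. X n \<in> K" "X \<longlonglongrightarrow> l"
    have 1: "(\<lambda>n. fst (X n)) \<longlonglongrightarrow> fst l" "(\<lambda>n. snd (X n)) \<longlonglongrightarrow> snd l" using X by (auto intro: tendsto_intros)
    have XK: "u (fst (X n)) \<le> ereal (snd (X n))" "snd (X n) \<le> R" for n using X(1) by (auto simp: K_def split_beta)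
    have "u (fst l) \<le> liminf (\<lambda>n. u (fst (X n)))" by (rule lower_semicont_LIMSEQ[OF Conv_cdD(4)[OF u] 1(1)])
    also have "\<dots> \<le> liminf (\<lambda>n. ereal (snd (X n)))" by (rule Liminf_mono) (use XK in simp)
    also have "\<dots> = ereal (snd l)" using 1(2) by (intro lim_imp_Liminf) auto
    finally have "u (fst l) \<le> ereal (snd l)" .
    moreover have "snd l \<le> R" using 1(2) XK(2) by (intro LIMSEQ_le_const2) auto
    ultimately show "l \<in> K" by (simp add: K_def split_beta)
  qed
  moreover have "K \<noteq> {}" using in_K Conv_cdD(2)[OF u] by blast
  moreover have "convex K" unfolding convex_alt
  proof (intro ballI allI impI, elim conjE)
    fix p q s assume pq: "p \<in> K" "q \<in> K" and s: "0 \<le> s" "s \<le> (1::real)"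
    obtain x a y b where [simp]: "p = (x, a)" "q = (y, b)" by (cases p, cases q)
    have xy: "x \<in> edom u" "y \<in> edom u" using pq sub by auto
    have le: "fin u x \<le> a" "fin u y \<le> b" "a \<le> R" "b \<le> R"
      using pq fin_eq[OF u xy(1)] fin_eq[OF u xy(2)] by (auto simp: K_def) (metis ereal_less_eq(3))+
    have z: "(1 - s) *\<^sub>R x + s *\<^sub>R y \<in> edom u" using convex_edom[OF u] xy s by (simp add: convex_alt)
    have "fin u ((1 - s) *\<^sub>R x + s *\<^sub>R y) \<le> (1 - s) * fin u x + s * fin u y"
      using convex_onD[OF convex_on_fin[OF u]] xy s by auto
    also have "\<dots> \<le> (1 - s) * a + s * b" using le s by (intro add_mono mult_left_mono) auto
    finally have "u ((1 - s) *\<^sub>R x + s *\<^sub>R y) \<le> ereal ((1 - s) * a + s * b)"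
      by (subst fin_eq[OF u z]) simp
    moreover have "(1 - s) * a + s * b \<le> R" using convex_bound_le[of a R b "1 - s" s] le s by simp
    ultimately show "(1 - s) *\<^sub>R p + s *\<^sub>R q \<in> K" by (simp add: K_def)
  qed
  ultimately show Kc: "K \<in> convex_bodies" using bK by (simp add: convex_bodies_def compact_eq_bounded_closed)
  show "\<lfloor>K\<rfloor>\<^sub>b = u"
  proof
    fix x
    show "\<lfloor>K\<rfloor>\<^sub>b x = u x"
    proof (cases "x \<in> edom u")
      case True
      show ?thesis
      proof (rule antisym)
        show "\<lfloor>K\<rfloor>\<^sub>b x \<le> u x" using lower_boundary_le[OF Kc in_K[OF True]] fin_eq[OF u True] by simp
        show "u x \<le> \<lfloor>K\<rfloor>\<^sub>b x" unfolding lower_boundary_fun_def by (rule INF_greatest) (simp add: K_def)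
      qed
    next
      case False
      then have "{t. (x, t) \<in> K} = {}" using sub by auto
      then show ?thesis using False by (simp add: lower_boundary_fun_def not_edom top_ereal_def)
    qed
  qed
qed

text \<open>With the value 0 outside of \<open>Conv_cd\<close>, in particular for an empty domain,
  cutting identities hold also when one of the pieces is empty.\<close>

definition zext :: "(('a::euclidean_space \<Rightarrow> ereal) \<Rightarrow> real) \<Rightarrow> ('a \<Rightarrow> ereal) \<Rightarrow> real" where
  "zext Z u = (if u \<in> Conv_cd then Z u else 0)"

section \<open>Criteria for epi-convergence, and compactness\<close>

lemma epi_continuous_eventually:
  fixes Z :: "('a::euclidean_space \<Rightarrow> ereal) \<Rightarrow> real"
  assumes Z: "epi_continuous Z" and U: "\<forall>\<^sub>F j in sequentially. U j \<in> Conv_cd" and u: "u \<in> Conv_cd"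
    and epi: "epi_converges U u"
  shows "(\<lambda>j. Z (U j)) \<longlonglongrightarrow> Z u"
proof -
  define V where "V j = (if U j \<in> Conv_cd then U j else u)" for j
  have eq: "\<forall>\<^sub>F j in sequentially. V j = U j" using U by eventually_elim (simp add: V_def)
  have "epi_converges V u" unfolding epi_converges_def
  proof (intro allI conjI impI)
    fix x :: 'a and X :: "nat \<Rightarrow> 'a" assume X: "X \<longlonglongrightarrow> x"
    have "liminf (\<lambda>j. V j (X j)) = liminf (\<lambda>j. U j (X j))"
      by (rule Liminf_eq) (use eq in \<open>eventually_elim, simp\<close>)
    then show "u x \<le> liminf (\<lambda>j. V j (X j))" using epi X by (simp add: epi_converges_def)
  next
    fix x :: 'a
    obtain X where X: "X \<longlonglongrightarrow> x" "(\<lambda>j. U j (X j)) \<longlonglongrightarrow> u x" using epi by (auto simp: epi_converges_def)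
    have "(\<lambda>j. V j (X j)) \<longlonglongrightarrow> u x"
      by (rule Lim_transform_eventually[OF X(2)]) (use eq in \<open>eventually_elim, simp\<close>)
    then show "\<exists>X. X \<longlonglongrightarrow> x \<and> (\<lambda>j. V j (X j)) \<longlonglongrightarrow> u x" using X(1) by blast
  qed
  moreover have "\<forall>j. V j \<in> Conv_cd" using u by (simp add: V_def)
  ultimately have "(\<lambda>j. Z (V j)) \<longlonglongrightarrow> Z u" using Z u unfolding epi_continuous_def by blast
  then show ?thesis by (rule Lim_transform_eventually) (use eq in \<open>eventually_elim, simp\<close>)
qed

text \<open>Continuity of \<open>f\<close> and uniform closeness carry a lower bound at
  \<open>x\<close> over to \<open>g j\<close> at the points \<open>X j\<close>; outside of the
  closed set \<open>A\<close> all values are infinite, and constant sequences attain the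
  limit.\<close>

lemma epi_converges_uniform:
  fixes f :: "'a::euclidean_space \<Rightarrow> real"
  assumes A: "closed A" and f: "continuous_on A f"
    and unif: "\<And>e. 0 < e \<Longrightarrow> \<forall>\<^sub>F j in sequentially. \<forall>x\<in>A. \<bar>g j x - f x\<bar> < e"
  shows "epi_converges (\<lambda>j. restr (\<lambda>x. ereal (g j x)) A) (restr (\<lambda>x. ereal (f x)) A)"
  unfolding epi_converges_def
proof (intro allI conjI impI)
  fix x :: 'a and X :: "nat \<Rightarrow> 'a" assume X: "X \<longlonglongrightarrow> x"
  show "restr (\<lambda>x. ereal (f x)) A x \<le> liminf (\<lambda>j. restr (\<lambda>x. ereal (g j x)) A (X j))"
    unfolding le_Liminf_iff
  proof (intro allI impI)
    fix c assume c: "c < restr (\<lambda>x. ereal (f x)) A x"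
    show "\<forall>\<^sub>F j in sequentially. c < restr (\<lambda>x. ereal (g j x)) A (X j)"
    proof (cases "x \<in> A")
      case True
      then have cf: "c < ereal (f x)" using c by (simp add: restr_def)
      then obtain b where b: "c < ereal b" "b < f x" using ereal_dense2[of c "ereal (f x)"] by auto
      define e where "e = (f x - b) / 2"
      have e: "0 < e" using b by (simp add: e_def)
      obtain \<delta> where \<delta>: "0 < \<delta>" "\<And>y. y \<in> A \<Longrightarrow> dist y x < \<delta> \<Longrightarrow> dist (f y) (f x) < e"
        using f True e unfolding continuous_on_iff by blast
      have "\<forall>\<^sub>F j in sequentially. dist (X j) x < \<delta>" using X \<delta>(1) by (rule tendstoD)
      with unif[OF e] show ?thesis
      proof eventually_elim
        case (elim j)
        show ?case
        proof (cases "X j \<in> A")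
          case True
          then have "\<bar>g j (X j) - f (X j)\<bar> < e" "\<bar>f (X j) - f x\<bar> < e"
            using elim \<delta>(2) by (auto simp: dist_real_def)
          moreover have "f x - b = 2 * e" by (simp add: e_def)
          ultimately have "b < g j (X j)" by linarith
          then have "ereal b < ereal (g j (X j))" by simp
          with b(1) have "c < ereal (g j (X j))" by (rule less_trans)
          then show ?thesis using True by (simp add: restr_def)
        next
          case False
          then show ?thesis using b(1) by (auto simp: restr_def)
        qed
      qed
    next
      case False
      then have "\<forall>\<^sub>F j in sequentially. X j \<in> - A"
        using A X by (intro topological_tendstoD[OF X]) auto
      moreover have "c < \<infinity>" using c by auto
      ultimately show ?thesis by (auto elim!: eventually_mono simp: restr_def)
    qed
  qed
next
  fix x :: 'a
  have "(\<lambda>j. restr (\<lambda>x. ereal (g j x)) A x) \<longlonglongrightarrow> restr (\<lambda>x. ereal (f x)) A x"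
  proof (cases "x \<in> A")
    case True
    have "(\<lambda>j. g j x) \<longlonglongrightarrow> f x"
    proof (rule tendstoI)
      fix e :: real assume "0 < e"
      then show "\<forall>\<^sub>F j in sequentially. dist (g j x) (f x) < e"
        using unif[of e] True by (auto simp: dist_real_def elim!: eventually_mono)
    qed
    then show ?thesis using True by (simp add: restr_def)
  qed (simp add: restr_def)
  then show "\<exists>X. X \<longlonglongrightarrow> x \<and> (\<lambda>j. restr (\<lambda>x. ereal (g j x)) A (X j)) \<longlonglongrightarrow> restr (\<lambda>x. ereal (f x)) A x"
    by (intro exI[of _ "\<lambda>_. x"]) simp
qed

text \<open>The Blaschke selection theorem: the distance functions of the bodies are equicontinuous, so
  Arzela--Ascoli applies to them.\<close>

lemma convex_bodies_selection:
  fixes K :: "nat \<Rightarrow> 'b::euclidean_space set"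
  assumes K: "\<And>j. K j \<in> convex_bodies" "\<And>j. K j \<subseteq> cball 0 \<rho>"
  obtains r L where "strict_mono r" "L \<in> convex_bodies"
    "\<And>q. q \<in> L \<Longrightarrow> \<exists>Q. (\<forall>j. Q j \<in> K (r j)) \<and> Q \<longlonglongrightarrow> q"
    "\<And>Q q m. strict_mono m \<Longrightarrow> (\<And>j. Q j \<in> K (r (m j))) \<Longrightarrow> Q \<longlonglongrightarrow> q \<Longrightarrow> q \<in> L"
proof -
  have K': "K j \<noteq> {}" "compact (K j)" "closed (K j)" "convex (K j)" for j
    using K(1)[of j] by (auto simp: convex_bodies_def compact_imp_closed)
  obtain g and r :: "nat \<Rightarrow> nat" where g: "continuous_on (cball 0 \<rho>) g" and r: "strict_mono r"
    and unif: "\<And>e. 0 < e \<Longrightarrow> \<exists>N. \<forall>n x. n \<ge> N \<and> x \<in> cball 0 \<rho> \<longrightarrow> norm (infdist x (K (r n)) - g x) < e"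
  proof -
    note obt = that
    show ?thesis
    proof (rule Arzela_Ascoli[of "cball 0 \<rho>" "\<lambda>n x. infdist x (K n)" "2 * \<rho>"])
      show "norm (infdist x (K n)) \<le> 2 * \<rho>" if "x \<in> cball 0 \<rho>" for n x
      proof -
        obtain a where a: "a \<in> K n" using K'(1) by blast
        have "infdist x (K n) \<le> dist x a" using a by (rule infdist_le)
        also have "\<dots> \<le> norm x + norm a" by (simp add: dist_norm norm_triangle_ineq4)
        also have "\<dots> \<le> 2 * \<rho>" using that a K(2)[of n] by auto
        finally show ?thesis by (simp add: infdist_nonneg)
      qed
      show "\<exists>d>0. \<forall>n y. y \<in> cball 0 \<rho> \<and> norm (x - y) < d \<longrightarrow> norm (infdist x (K n) - infdist y (K n)) < e"
        if "0 < e" for x e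
      proof (intro exI[of _ e] conjI allI impI)
        fix n y assume "y \<in> cball 0 \<rho> \<and> norm (x - y) < e"
        then show "norm (infdist x (K n) - infdist y (K n)) < e"
          using infdist_triangle_abs[of x "K n" y] by (simp add: dist_norm)
      qed (rule that)
      fix g' r' assume a: "continuous_on (cball 0 \<rho>) g'" "strict_mono (r' :: nat \<Rightarrow> nat)"
        "\<And>e. 0 < e \<Longrightarrow> \<exists>N. \<forall>n x. n \<ge> N \<and> x \<in> cball 0 \<rho> \<longrightarrow> norm (infdist x (K (r' n)) - g' x) < e"
      show ?thesis by (rule obt[OF a(1,2)]) (erule a(3))
    qed simp
  qed
  have lim: "(\<lambda>n. infdist x (K (r n))) \<longlonglongrightarrow> g x" if "x \<in> cball 0 \<rho>" for x
    using unif that by (intro LIMSEQ_I) blast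
  have g0: "0 \<le> g x" if "x \<in> cball 0 \<rho>" for x
    using lim[OF that] by (rule LIMSEQ_le_const) (auto simp: infdist_nonneg)
  \<comment> \<open>The limit body is the zero set of the limit \<open>g\<close> of the distance
    functions.\<close>
  define L where "L = {x \<in> cball 0 \<rho>. g x = 0}"
  have b: "q \<in> L" if m: "strict_mono m" and Q: "\<And>j. Q j \<in> K (r (m j))" "Q \<longlonglongrightarrow> q" for Q q m
  proof -
    have "Q j \<in> cball 0 \<rho>" for j using Q(1) K(2) by blast
    then have q: "q \<in> cball 0 \<rho>" using Q(2) by (metis closed_cball closed_sequentially)
    have "(\<lambda>j. infdist q (K (r (m j)))) \<longlonglongrightarrow> g q"
      using LIMSEQ_subseq_LIMSEQ[OF lim[OF q] m] by (simp add: o_def)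
    moreover have "(\<lambda>j. infdist q (K (r (m j)))) \<longlonglongrightarrow> 0"
    proof (rule tendsto_sandwich[OF _ _ tendsto_const])
      show "(\<lambda>j. dist q (Q j)) \<longlonglongrightarrow> 0" using tendsto_dist[OF tendsto_const Q(2), of q] by simp
    qed (use infdist_le[OF Q(1)] in \<open>auto simp: infdist_nonneg\<close>)
    ultimately have "g q = 0" by (rule LIMSEQ_unique)
    then show ?thesis using q by (simp add: L_def)
  qed
  show ?thesis
  proof (rule that[OF r _ _ b])
    show "L \<in> convex_bodies" unfolding convex_bodies_def
    proof (intro CollectI conjI)
      have "\<forall>n. \<exists>a. a \<in> K (r n)" using K'(1) by blast
      then obtain Q where Q: "\<And>n. Q n \<in> K (r n)" by metis
      then have "\<forall>n. Q n \<in> cball 0 \<rho>" using K(2) by blast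
      then obtain l m where l: "strict_mono m" "(Q \<circ> m) \<longlonglongrightarrow> l"
        by (rule seq_compactE[OF compact_imp_seq_compact[OF compact_cball]]) auto
      then have "l \<in> L" using Q by (intro b[of m "Q \<circ> m"]) auto
      then show "L \<noteq> {}" by blast
      have "closed L" unfolding L_def
        using continuous_closed_preimage_constant[OF g, of 0] by simp
      moreover have "L \<subseteq> cball 0 \<rho>" by (auto simp: L_def)
      then have "bounded L" by (rule bounded_subset[OF bounded_cball])
      ultimately show "compact L" by (simp add: compact_eq_bounded_closed)
      show "convex L" unfolding convex_alt
      proof (intro ballI allI impI, elim conjE)
        fix x y and t :: real assume xy: "x \<in> L" "y \<in> L" and t: "0 \<le> t" "t \<le> 1"
        let ?z = "(1 - t) *\<^sub>R x + t *\<^sub>R y"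
        have c: "x \<in> cball 0 \<rho>" "y \<in> cball 0 \<rho>" "g x = 0" "g y = 0" using xy by (auto simp: L_def)
        then have z: "?z \<in> cball 0 \<rho>" using t by (intro convexD_alt[OF convex_cball])
        \<comment> \<open>The distance to a convex set is a convex function, and the inequality
          survives in the limit.\<close>
        have "infdist ?z (K n) \<le> (1 - t) * infdist x (K n) + t * infdist y (K n)" for n
        proof -
          obtain a where a: "a \<in> K n" "infdist x (K n) = dist x a" by (rule infdist_attains_inf[OF K'(3,1)])
          obtain b where b: "b \<in> K n" "infdist y (K n) = dist y b" by (rule infdist_attains_inf[OF K'(3,1)])
          note ab = a b
          have "(1 - t) *\<^sub>R a + t *\<^sub>R b \<in> K n" using ab t K'(4) by (intro convexD_alt)
          then have "infdist ?z (K n) \<le> dist ?z ((1 - t) *\<^sub>R a + t *\<^sub>R b)" by (rule infdist_le)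
          also have "\<dots> = norm ((1 - t) *\<^sub>R (x - a) + t *\<^sub>R (y - b))"
            by (simp add: dist_norm algebra_simps)
          also have "\<dots> \<le> (1 - t) * dist x a + t * dist y b"
            using t norm_triangle_ineq[of "(1 - t) *\<^sub>R (x - a)" "t *\<^sub>R (y - b)"] by (simp add: dist_norm)
          finally show ?thesis by (simp add: ab)
        qed
        then have "g ?z \<le> (1 - t) * g x + t * g y"
          by (intro LIMSEQ_le[OF lim[OF z] tendsto_add[OF tendsto_mult[OF tendsto_const lim[OF c(1)]] tendsto_mult[OF tendsto_const lim[OF c(2)]]]]) auto
        then show "?z \<in> L" using c z g0[OF z] by (simp add: L_def)
      qed
    qed
    fix q assume q: "q \<in> L"
    have "\<forall>j. \<exists>a. a \<in> K (r j) \<and> infdist q (K (r j)) = dist q a"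
    proof
      fix j
      obtain a where "a \<in> K (r j)" "infdist q (K (r j)) = dist q a" by (rule infdist_attains_inf[OF K'(3,1)])
      then show "\<exists>a. a \<in> K (r j) \<and> infdist q (K (r j)) = dist q a" by blast
    qed
    then obtain Q where Q: "\<And>j. Q j \<in> K (r j)" "\<And>j. infdist q (K (r j)) = dist q (Q j)" by metis
    have "(\<lambda>j. dist q (Q j)) \<longlonglongrightarrow> 0" using lim[of q] q by (simp add: Q(2) L_def)
    then have "Q \<longlonglongrightarrow> q" by (subst tendsto_dist_iff) (simp add: dist_commute)
    then show "\<exists>Q. (\<forall>j. Q j \<in> K (r j)) \<and> Q \<longlonglongrightarrow> q" using Q(1) by blast
  qed
qed

text \<open>Hypotheses \<open>a\<close> and \<open>b\<close> express convergence of the bodies in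
  the sense of Kuratowski. By \<open>b\<close>, lowest points over points tending to
  \<open>x\<close> subconverge into \<open>L\<close>, which gives the lower bound; by
  \<open>a\<close>, a lowest point of \<open>L\<close> is a limit of points of the bodies, whose
  horizontal components form a recovery sequence.\<close>

lemma epi_converges_lower_boundary:
  fixes K :: "nat \<Rightarrow> ('a::euclidean_space \<times> real) set"
  assumes K: "\<And>j. K j \<in> convex_bodies" "\<And>j. K j \<subseteq> cball 0 \<rho>" and L: "L \<in> convex_bodies"
    and a: "\<And>q. q \<in> L \<Longrightarrow> \<exists>Q. (\<forall>j. Q j \<in> K j) \<and> Q \<longlonglongrightarrow> q"
    and b: "\<And>Q q m. strict_mono m \<Longrightarrow> (\<And>j. Q j \<in> K (m j)) \<Longrightarrow> Q \<longlonglongrightarrow> q \<Longrightarrow> q \<in> L"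
  shows "epi_converges (\<lambda>j. \<lfloor>K j\<rfloor>\<^sub>b) \<lfloor>L\<rfloor>\<^sub>b"
proof -
  have ev: "\<forall>\<^sub>F j in sequentially. c < \<lfloor>K j\<rfloor>\<^sub>b (X j)" if X: "X \<longlonglongrightarrow> x" and c: "c < \<lfloor>L\<rfloor>\<^sub>b x" for x X c
  proof (rule ccontr)
    assume "\<not> ?thesis"
    then obtain m :: "nat \<Rightarrow> nat" where m': "strict_mono m" "\<forall>n. \<not> c < \<lfloor>K (m n)\<rfloor>\<^sub>b (X (m n))"
      by (auto dest: not_eventually_sequentiallyD)
    have m: "strict_mono m" "\<And>n. \<lfloor>K (m n)\<rfloor>\<^sub>b (X (m n)) \<le> c"
      using m' by (auto simp: not_less)
    have cinf: "c < \<infinity>" using c by auto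
    have "\<exists>s. \<lfloor>K (m n)\<rfloor>\<^sub>b (X (m n)) = ereal s \<and> (X (m n), s) \<in> K (m n)" for n
    proof (rule lower_boundary_attained[OF K(1)])
      show "\<lfloor>K (m n)\<rfloor>\<^sub>b (X (m n)) \<noteq> \<infinity>" using le_less_trans[OF m(2)[of n] cinf] by simp
    qed
    then obtain s where s: "\<And>n. \<lfloor>K (m n)\<rfloor>\<^sub>b (X (m n)) = ereal (s n)" "\<And>n. (X (m n), s n) \<in> K (m n)" by metis
    have "\<forall>n. (X (m n), s n) \<in> cball 0 \<rho>" using s(2) K(2) by blast
    then obtain l r where l: "strict_mono r" "((\<lambda>n. (X (m n), s n)) \<circ> r) \<longlonglongrightarrow> l"
      by (rule seq_compactE[OF compact_imp_seq_compact[OF compact_cball]]) auto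
    have l': "(\<lambda>n. (X (m (r n)), s (r n))) \<longlonglongrightarrow> l" using l(2) by (simp add: o_def)
    have "l \<in> L"
      by (rule b[OF _ _ l', of "m \<circ> r"]) (use m l s in \<open>auto intro: strict_mono_o\<close>)
    have 1: "(\<lambda>n. X (m (r n))) \<longlonglongrightarrow> fst l" using tendsto_fst[OF l'] by simp
    have 2: "(\<lambda>n. s (r n)) \<longlonglongrightarrow> snd l" using tendsto_snd[OF l'] by simp
    have "(\<lambda>n. X (m (r n))) \<longlonglongrightarrow> x"
      using LIMSEQ_subseq_LIMSEQ[OF X strict_mono_o[OF m(1) l(1)]] by (simp add: o_def)
    then have "fst l = x" using 1 LIMSEQ_unique by blast
    then have "(x, snd l) \<in> L" using \<open>l \<in> L\<close> by auto
    then have "\<lfloor>L\<rfloor>\<^sub>b x \<le> ereal (snd l)" by (rule lower_boundary_le[OF L])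
    also have "\<dots> \<le> c"
    proof (rule LIMSEQ_le_const2)
      show "(\<lambda>n. ereal (s (r n))) \<longlonglongrightarrow> ereal (snd l)" using 2 by simp
      show "\<exists>N. \<forall>n\<ge>N. ereal (s (r n)) \<le> c" using m(2) s(1) by metis
    qed
    finally show False using c by simp
  qed
  show ?thesis unfolding epi_converges_def
  proof (intro allI conjI impI)
    fix x :: 'a and X :: "nat \<Rightarrow> 'a" assume X: "X \<longlonglongrightarrow> x"
    show "\<lfloor>L\<rfloor>\<^sub>b x \<le> liminf (\<lambda>j. \<lfloor>K j\<rfloor>\<^sub>b (X j))" unfolding le_Liminf_iff using ev[OF X] by blast
  next
    fix x :: 'a
    show "\<exists>X. X \<longlonglongrightarrow> x \<and> (\<lambda>j. \<lfloor>K j\<rfloor>\<^sub>b (X j)) \<longlonglongrightarrow> \<lfloor>L\<rfloor>\<^sub>b x"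
    proof (cases "\<lfloor>L\<rfloor>\<^sub>b x = \<infinity>")
      case True
      have "(\<lambda>j. \<lfloor>K j\<rfloor>\<^sub>b x) \<longlonglongrightarrow> \<lfloor>L\<rfloor>\<^sub>b x"
        by (rule order_tendstoI) (use ev[OF tendsto_const] True in auto)
      then show ?thesis by (intro exI[of _ "\<lambda>_. x"]) simp
    next
      case False
      then obtain s where s: "\<lfloor>L\<rfloor>\<^sub>b x = ereal s" "(x, s) \<in> L" using lower_boundary_attained[OF L] by blast
      obtain Q where Q: "\<And>j. Q j \<in> K j" "Q \<longlonglongrightarrow> (x, s)" using a[OF s(2)] by blast
      have X: "(\<lambda>j. fst (Q j)) \<longlonglongrightarrow> x" using tendsto_fst[OF Q(2)] by simp
      have "(\<lambda>j. snd (Q j)) \<longlonglongrightarrow> s" using tendsto_snd[OF Q(2)] by simp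
      then have S: "(\<lambda>j. ereal (snd (Q j))) \<longlonglongrightarrow> ereal s" by simp
      have le: "\<lfloor>K j\<rfloor>\<^sub>b (fst (Q j)) \<le> ereal (snd (Q j))" for j
        using lower_boundary_le[OF K(1), of "fst (Q j)" "snd (Q j)" j] Q(1)[of j] by simp
      have "(\<lambda>j. \<lfloor>K j\<rfloor>\<^sub>b (fst (Q j))) \<longlonglongrightarrow> \<lfloor>L\<rfloor>\<^sub>b x"
      proof (rule order_tendstoI)
        fix c assume "\<lfloor>L\<rfloor>\<^sub>b x < c"
        then have "\<forall>\<^sub>F j in sequentially. ereal (snd (Q j)) < c" using S s(1) by (intro order_tendstoD(2)) auto
        then show "\<forall>\<^sub>F j in sequentially. \<lfloor>K j\<rfloor>\<^sub>b (fst (Q j)) < c"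
          by eventually_elim (use le in \<open>auto intro: le_less_trans\<close>)
      qed (rule ev[OF X])
      then show ?thesis using X by blast
    qed
  qed
qed

text \<open>A sequence of functions with unbounded values of \<open>Z\<close> can be translated
  vertically so as to vanish at a point of the domain. The epigraphs cut off at \<open>R\<close>
  then lie in a fixed ball, and along a convergent subsequence of these bodies \<open>Z\<close>
  converges, hence is bounded.\<close>

lemma bounded_on_functions_of_bounded_oscillation:
  fixes Z :: "('a::euclidean_space \<Rightarrow> ereal) \<Rightarrow> real"
  assumes Z: "epi_continuous Z" "epi_translation_invariant Z"
  obtains M where "\<And>v. v \<in> Conv_cd \<Longrightarrow> edom v \<subseteq> cball 0 \<rho> \<Longrightarrow>
    (\<And>x y. x \<in> edom v \<Longrightarrow> y \<in> edom v \<Longrightarrow> fin v x \<le> fin v y + R) \<Longrightarrow> \<bar>Z v\<bar> \<le> M"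
proof (rule ccontr)
  assume "\<not> thesis"
  then have "\<exists>v. v \<in> Conv_cd \<and> edom v \<subseteq> cball 0 \<rho> \<and> (\<forall>x\<in>edom v. \<forall>y\<in>edom v. fin v x \<le> fin v y + R) \<and> real k < \<bar>Z v\<bar>" for k :: nat
    using that[of "real k"] by (meson not_le)
  then obtain v where v: "\<And>k. v k \<in> Conv_cd" "\<And>k. edom (v k) \<subseteq> cball 0 \<rho>"
    "\<And>k x y. x \<in> edom (v k) \<Longrightarrow> y \<in> edom (v k) \<Longrightarrow> fin (v k) x \<le> fin (v k) y + R"
    and big: "\<And>k. real k < \<bar>Z (v k)\<bar>" by metis
  have "\<forall>k. \<exists>x. x \<in> edom (v k)" using Conv_cdD(2)[OF v(1)] by blast
  then obtain p where p: "\<And>k. p k \<in> edom (v k)" by metis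
  define w where "w k = (\<lambda>y. v k (y - 0) + ereal (- fin (v k) (p k)))" for k
  have w: "w k \<in> Conv_cd" for k unfolding w_def by (rule translate_Conv_cd[OF v(1)])
  have Zw: "Z (w k) = Z (v k)" for k
    using Z(2) v(1)[of k] unfolding w_def epi_translation_invariant_def by blast
  have wv: "w k x = ereal (fin (v k) x - fin (v k) (p k))" if "x \<in> edom (v k)" for k x
    using fin_eq[OF v(1) that] unfolding w_def by (metis diff_0_right diff_conv_add_uminus plus_ereal.simps(1))
  have ew: "edom (w k) = edom (v k)" for k
  proof -
    have "v k x + ereal b < \<infinity> \<longleftrightarrow> v k x < \<infinity>" for x b by (cases "v k x") auto
    then show ?thesis by (simp add: edom_def w_def)
  qed
  have R0: "0 \<le> R" using v(3)[OF p p, of 0] by simp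
  have wR: "w k x \<le> ereal R" "ereal (- R) \<le> w k x" if "x \<in> edom (w k)" for k x
    using v(3)[OF that[unfolded ew] p] v(3)[OF p that[unfolded ew]] wv[OF that[unfolded ew]] by auto
  define K where "K k = {(x, t). w k x \<le> ereal t \<and> t \<le> R}" for k
  have K: "K k \<in> convex_bodies" "\<lfloor>K k\<rfloor>\<^sub>b = w k" for k
    unfolding K_def by (rule epi_body[OF w wR(1)], assumption)+
  have Kb: "K k \<subseteq> cball 0 (\<rho> + R)" for k
  proof
    fix q assume q: "q \<in> K k"
    obtain x t where xt: "q = (x, t)" by (cases q)
    have t: "w k x \<le> ereal t" "t \<le> R" using q by (auto simp: K_def xt)
    then have x: "x \<in> edom (w k)" by (auto simp: edom_def intro: le_less_trans)
    have "ereal (- R) \<le> ereal t" using wR(2)[OF x] t(1) by (rule order_trans)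
    then have "\<bar>t\<bar> \<le> R" using t(2) by simp
    moreover have "norm x \<le> \<rho>" using x v(2)[of k] ew by auto
    moreover have "norm q \<le> norm x + \<bar>t\<bar>" unfolding xt norm_Pair using sqrt_sum_squares_le_sum_abs[of "norm x" t] by simp
    ultimately show "q \<in> cball 0 (\<rho> + R)" by simp
  qed
  obtain r L where r: "strict_mono r" and L: "L \<in> convex_bodies"
    "\<And>q. q \<in> L \<Longrightarrow> \<exists>Q. (\<forall>j. Q j \<in> K (r j)) \<and> Q \<longlonglongrightarrow> q"
    "\<And>Q q m. strict_mono m \<Longrightarrow> (\<And>j. Q j \<in> K (r (m j))) \<Longrightarrow> Q \<longlonglongrightarrow> q \<Longrightarrow> q \<in> L"
  proof (rule convex_bodies_selection[of K "\<rho> + R", OF K(1) Kb], goal_cases)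
    case (1 r L)
    show ?case
    proof (rule that[OF 1(2,3)])
      show "\<exists>Q. (\<forall>j. Q j \<in> K (r j)) \<and> Q \<longlonglongrightarrow> q" if "q \<in> L" for q using that by (rule 1(4))
      show "q \<in> L" if "strict_mono m" "\<And>j. Q j \<in> K (r (m j))" "Q \<longlonglongrightarrow> q" for Q q m
        using that by (rule 1(5))
    qed
  qed
  have "epi_converges (\<lambda>j. \<lfloor>K (r j)\<rfloor>\<^sub>b) \<lfloor>L\<rfloor>\<^sub>b"
  proof (rule epi_converges_lower_boundary[of "\<lambda>j. K (r j)", OF K(1) Kb L(1,2)])
    fix Q :: "nat \<Rightarrow> 'a \<times> real" and q and m :: "nat \<Rightarrow> nat"
    assume "strict_mono m" "\<And>j. Q j \<in> K (r (m j))" "Q \<longlonglongrightarrow> q"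
    then show "q \<in> L" by (rule L(3))
  qed
  then have "epi_converges (\<lambda>j. w (r j)) \<lfloor>L\<rfloor>\<^sub>b" by (simp add: K(2))
  then have "(\<lambda>j. Z (w (r j))) \<longlonglongrightarrow> Z \<lfloor>L\<rfloor>\<^sub>b"
    by (intro epi_continuous_eventually[OF Z(1)] always_eventually allI w lower_boundary_Conv_cd[OF L(1)])
  then have "Bseq (\<lambda>j. Z (w (r j)))" by (intro convergent_imp_Bseq convergentI)
  then obtain B where B: "\<And>j. \<bar>Z (w (r j))\<bar> \<le> B" unfolding Bseq_def by auto
  obtain n :: nat where n: "B < real n" using reals_Archimedean2 by blast
  have "real n \<le> real (r n)" using r by (simp add: seq_suble)
  then show False using big[of "r n"] B[of n] n by (simp add: Zw)
qed

section \<open>Half-open cells and the representation on Lipschitz functions\<close>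

text \<open>Measurability of the limit is part of the conclusion, by completeness of the Lebesgue
  measure; this is how functions of the gradient become measurable.\<close>

lemma lebesgue_dominated_convergence:
  fixes s :: "nat \<Rightarrow> 'a::euclidean_space \<Rightarrow> real"
  assumes s: "\<And>i. s i \<in> borel_measurable lebesgue" and w: "integrable lebesgue w"
    and lim: "AE x in lebesgue. (\<lambda>i. s i x) \<longlonglongrightarrow> f x"
    and bound: "\<And>i. AE x in lebesgue. norm (s i x) \<le> w x"
  shows "integrable lebesgue f" "(\<lambda>i. LINT x|lebesgue. s i x) \<longlonglongrightarrow> (LINT x|lebesgue. f x)"
proof -
  define h where "h x = lim (\<lambda>i. s i x)" for x
  have "h \<in> borel_measurable lebesgue" unfolding h_def using s by (rule borel_measurable_lim_metric)
  moreover have "AE x in lebesgue. h x = f x" using lim by eventually_elim (simp add: h_def limI)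
  ultimately have f: "f \<in> borel_measurable lebesgue" by (rule borel_measurable_AE)
  show "integrable lebesgue f" "(\<lambda>i. LINT x|lebesgue. s i x) \<longlonglongrightarrow> (LINT x|lebesgue. f x)"
    using integrable_dominated_convergence[OF f s w lim bound] integral_dominated_convergence[OF f s w lim bound]
    by auto
qed

lemma sum_telescope_int:
  fixes F :: "int \<Rightarrow> real"
  shows "(\<Sum>m\<in>{a..<a + int n}. F m - F (m + 1)) = F a - F (a + int n)"
proof (induction n)
  case (Suc n)
  have "{a..<a + int (Suc n)} = insert (a + int n) {a..<a + int n}" by auto
  then show ?case using Suc by (simp add: algebra_simps)
qed simp

text \<open>\<open>slab i a a\<close> serves as the hyperplane at height \<open>a\<close>.\<close>

definition slab :: "'a::euclidean_space \<Rightarrow> real \<Rightarrow> real \<Rightarrow> 'a set" where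
  "slab i a b = {x. a \<le> x \<bullet> i \<and> x \<bullet> i \<le> b}"

lemma closed_convex_halfspaces:
  fixes i :: "'a::euclidean_space"
  shows "closed {x. x \<bullet> i \<le> a}" "convex {x. x \<bullet> i \<le> a}" "closed {x. a \<le> x \<bullet> i}" "convex {x. a \<le> x \<bullet> i}"
    "closed {x. x \<bullet> i = a}" "convex {x. x \<bullet> i = a}"
  using convex_halfspace_le[of i a] convex_halfspace_ge[of a i] convex_hyperplane[of i a]
  by (auto simp: inner_commute intro!: closed_Collect_le closed_Collect_eq continuous_intros)

lemma closed_convex_slab: "closed (slab i a b)" "convex (slab i a b)"
proof -
  have "slab i a b = {x. a \<le> x \<bullet> i} \<inter> {x. x \<bullet> i \<le> b}" by (auto simp: slab_def)
  then show "closed (slab i a b)" "convex (slab i a b)"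
    by (simp_all add: closed_Int convex_Int closed_convex_halfspaces)
qed

text \<open>The alternating sum that extends a functional additively to half-open boxes
  \<open>lo i \<le> x \<bullet> i < hi i\<close>, built up one coordinate direction at a time.\<close>

primrec half_open :: "(('a::euclidean_space \<Rightarrow> ereal) \<Rightarrow> real) \<Rightarrow> ('a \<Rightarrow> real) \<Rightarrow> ('a \<Rightarrow> real) \<Rightarrow> 'a list
    \<Rightarrow> ('a \<Rightarrow> ereal) \<Rightarrow> real" where
  "half_open W lo hi [] u = W u"
| "half_open W lo hi (i # is) u =
     half_open W lo hi is (restr u (slab i (lo i) (hi i))) - half_open W lo hi is (restr u (slab i (hi i) (hi i)))"

lemma half_open_cong:
  "(\<And>i. i \<in> set is \<Longrightarrow> lo i = lo' i \<and> hi i = hi' i) \<Longrightarrow> half_open W lo hi is u = half_open W lo' hi' is u"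
  by (induction "is" arbitrary: u) simp_all

text \<open>Each direction doubles the number of terms, and every term is a restriction to a closed
  convex subset of \<open>C\<close>.\<close>

lemma half_open_bound:
  assumes W: "\<And>A. closed A \<Longrightarrow> convex A \<Longrightarrow> A \<subseteq> C \<Longrightarrow> \<bar>W (restr v A)\<bar> \<le> M"
    and "closed A" "convex A" "{x \<in> A. \<forall>i\<in>set is. lo i \<le> x \<bullet> i \<and> x \<bullet> i \<le> hi i} \<subseteq> C" "\<forall>i\<in>set is. lo i \<le> hi i"
  shows "\<bar>half_open W lo hi is (restr v A)\<bar> \<le> 2 ^ length is * M"
  using assms(2-)
proof (induction "is" arbitrary: A)
  case Nil
  then show ?case using W by simp
next
  case (Cons i "is")
  have "\<bar>half_open W lo hi is (restr v (A \<inter> slab i a (hi i)))\<bar> \<le> 2 ^ length is * M" if "lo i \<le> a" for a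
    using Cons.prems that by (intro Cons.IH closed_Int convex_Int closed_convex_slab) (auto simp: slab_def)
  from this[of "lo i"] this[of "hi i"] show ?case using Cons.prems(4) by (simp add: restr_restr)
qed

lemma half_open_tendsto:
  assumes W: "\<And>A. closed A \<Longrightarrow> convex A \<Longrightarrow> A \<subseteq> C \<Longrightarrow> (\<lambda>j. W (restr (v j) A)) \<longlonglongrightarrow> W (restr w A)"
    and "closed A" "convex A" "{x \<in> A. \<forall>i\<in>set is. lo i \<le> x \<bullet> i \<and> x \<bullet> i \<le> hi i} \<subseteq> C" "\<forall>i\<in>set is. lo i \<le> hi i"
  shows "(\<lambda>j::nat. half_open W lo hi is (restr (v j) A)) \<longlonglongrightarrow> half_open W lo hi is (restr w A)"
  using assms(2-)
proof (induction "is" arbitrary: A)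
  case Nil
  then show ?case using W by simp
next
  case (Cons i "is")
  have "(\<lambda>j. half_open W lo hi is (restr (v j) (A \<inter> slab i a (hi i)))) \<longlonglongrightarrow> half_open W lo hi is (restr w (A \<inter> slab i a (hi i)))"
    if "lo i \<le> a" for a
    using Cons.prems that by (intro Cons.IH closed_Int convex_Int closed_convex_slab) (auto simp: slab_def)
  from tendsto_diff[OF this[of "lo i"] this[of "hi i"]] show ?case using Cons.prems(4) by (simp add: restr_restr)
qed

text \<open>The recursion of \<open>half_open\<close> runs over a list, hence a fixed enumeration of
  the basis.\<close>

definition basis_list :: "'a::euclidean_space list" where
  "basis_list = (SOME l. set l = Basis \<and> distinct l)"

lemma basis_list: "set (basis_list :: 'a::euclidean_space list) = Basis" "distinct (basis_list :: 'a list)"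
proof -
  have "\<exists>l::'a list. set l = Basis \<and> distinct l" using finite_distinct_list[OF finite_Basis] by blast
  from someI_ex[OF this] show "set (basis_list :: 'a list) = Basis" "distinct (basis_list :: 'a list)"
    by (auto simp: basis_list_def)
qed

section \<open>The unit cube and blow-ups\<close>

definition unit_cube :: "'a::euclidean_space set" where
  "unit_cube = {x. \<forall>i\<in>Basis. 0 \<le> x \<bullet> i \<and> x \<bullet> i \<le> 1}"

lemma unit_cube_eq: "unit_cube = cbox 0 (One :: 'a::euclidean_space)"
  by (auto simp: unit_cube_def cbox_def)

lemma unit_cube: "compact (unit_cube :: 'a::euclidean_space set)" "convex (unit_cube :: 'a set)"
    "(unit_cube :: 'a set) \<noteq> {}" "(unit_cube :: 'a set) \<subseteq> cball 0 DIM('a)"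
proof -
  show "compact (unit_cube :: 'a set)" "convex (unit_cube :: 'a set)" by (simp_all add: unit_cube_eq)
  have "0 \<in> (unit_cube :: 'a set)" by (simp add: unit_cube_def)
  then show "(unit_cube :: 'a set) \<noteq> {}" by blast
  have "norm x \<le> DIM('a)" if "x \<in> unit_cube" for x :: 'a
  proof -
    have "norm x \<le> (\<Sum>i\<in>Basis. \<bar>x \<bullet> i\<bar>)" by (rule norm_le_l1)
    also have "\<dots> \<le> (\<Sum>i\<in>(Basis::'a set). 1)" using that by (intro sum_mono) (auto simp: unit_cube_def)
    finally show ?thesis by simp
  qed
  then show "(unit_cube :: 'a set) \<subseteq> cball 0 DIM('a)" by auto
qed

text \<open>Takes the cube with corner \<open>c\<close> and side \<open>\<epsilon>\<close> to the
  unit cube and scales the values by the same factor, so that slopes are preserved: a translation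
  followed by the operation of epi-homogeneity with factor \<open>1 / \<epsilon>\<close>.\<close>

definition blow_up :: "real \<Rightarrow> 'a::euclidean_space \<Rightarrow> real \<Rightarrow> ('a \<Rightarrow> ereal) \<Rightarrow> 'a \<Rightarrow> ereal" where
  "blow_up \<epsilon> c b u = (\<lambda>z. ereal (1 / \<epsilon>) * (u (c + \<epsilon> *\<^sub>R z) + ereal (- b)))"

lemma restr_blow_up: "0 < \<epsilon> \<Longrightarrow> blow_up \<epsilon> c b (restr u A) = restr (blow_up \<epsilon> c b u) {z. c + \<epsilon> *\<^sub>R z \<in> A}"
  by (auto simp: blow_up_def restr_def fun_eq_iff)

lemma edom_blow_up: "0 < \<epsilon> \<Longrightarrow> edom (blow_up \<epsilon> c b u) = {z. c + \<epsilon> *\<^sub>R z \<in> edom u}"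
proof -
  assume "0 < \<epsilon>"
  then have "ereal (1 / \<epsilon>) * (r + ereal (- b)) < \<infinity> \<longleftrightarrow> r < \<infinity>" for r by (cases r) auto
  then show ?thesis by (simp add: edom_def blow_up_def)
qed

lemma fin_blow_up:
  assumes "u \<in> Conv_cd" "0 < \<epsilon>" "c + \<epsilon> *\<^sub>R z \<in> edom u"
  shows "fin (blow_up \<epsilon> c b u) z = (fin u (c + \<epsilon> *\<^sub>R z) - b) / \<epsilon>"
proof -
  obtain r where r: "u (c + \<epsilon> *\<^sub>R z) = ereal r" using fin_eq[OF assms(1,3)] by blast
  show ?thesis by (simp add: blow_up_def r)
qed

lemma blow_up_Conv_cd:
  assumes "u \<in> Conv_cd" "0 < \<epsilon>"
  shows "blow_up \<epsilon> c b u \<in> Conv_cd"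
  using dilate_Conv_cd[OF translate_Conv_cd[OF assms(1), of "- c" "- b"], of "1 / \<epsilon>"] assms(2)
  by (simp add: blow_up_def add.commute)

lemma convex_on_inner: "convex A \<Longrightarrow> convex_on A (\<lambda>x. y \<bullet> x)"
  by (rule convex_onI) (auto simp: inner_add_right)

lemma linear_Conv_cd:
  fixes A :: "'a::euclidean_space set"
  assumes "compact A" "convex A" "A \<noteq> {}"
  shows "restr (\<lambda>x. ereal (y \<bullet> x)) A \<in> Conv_cd"
  by (rule restr_real_Conv_cd[OF assms convex_on_inner[OF assms(2)]]) (intro continuous_intros)

section \<open>Additivity of the valuation on half-open cells\<close>

locale epi_valuation =
  fixes Z :: "('a::euclidean_space \<Rightarrow> ereal) \<Rightarrow> real"
  assumes continuous: "epi_continuous Z"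
    and translation: "epi_translation_invariant Z"
    and valuation: "valuation Z"
    and homogeneous: "epi_homogeneous DIM('a) Z"
begin

abbreviation "W \<equiv> zext Z"

lemma W_empty: "edom u = {} \<Longrightarrow> W u = 0"
  using Conv_cdD(2)[of u] by (auto simp: zext_def)

text \<open>Restriction to closed convex sets does not leave this class, which lets the cutting
  identities be iterated.\<close>

definition Conv_cd_or_empty :: "('a \<Rightarrow> ereal) \<Rightarrow> bool" where
  "Conv_cd_or_empty u \<longleftrightarrow> u \<in> Conv_cd \<or> edom u = {}"

lemma Conv_cd_or_empty_restr: "Conv_cd_or_empty u \<Longrightarrow> closed A \<Longrightarrow> convex A \<Longrightarrow> Conv_cd_or_empty (restr u A)"
  using restr_Conv_cd[of u A] by (auto simp: Conv_cd_or_empty_def edom_restr)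

text \<open>If both closed half-spaces meet the convex domain, so does the hyperplane, by
  connectedness. Minimum and maximum of the two restrictions are then \<open>u\<close> and its
  restriction to the hyperplane, and the valuation property applies. Otherwise one piece and the
  hyperplane section are empty and contribute 0.\<close>

lemma W_cut:
  assumes "Conv_cd_or_empty u"
  shows "W (restr u {x. x \<bullet> i \<le> a}) + W (restr u {x. a \<le> x \<bullet> i}) = W u + W (restr u (slab i a a))"
proof (cases "edom u = {}")
  case True
  then show ?thesis by (simp add: W_empty edom_restr)
next
  case False
  then have u: "u \<in> Conv_cd" using assms by (simp add: Conv_cd_or_empty_def)
  let ?A = "{x. x \<bullet> i \<le> a}" and ?B = "{x. a \<le> x \<bullet> i}" and ?C = "slab i a a"
  consider "edom u \<inter> ?A = {}" | "edom u \<inter> ?B = {}" | "edom u \<inter> ?A \<noteq> {}" "edom u \<inter> ?B \<noteq> {}" by blast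
  then show ?thesis
  proof cases
    case 1
    then have "edom u \<subseteq> ?B" "edom u \<inter> ?C = {}" by (auto simp: slab_def)
    then show ?thesis using 1 by (simp add: restr_edom W_empty edom_restr)
  next
    case 2
    then have "edom u \<subseteq> ?A" "edom u \<inter> ?C = {}" by (auto simp: slab_def)
    then show ?thesis using 2 by (simp add: restr_edom W_empty edom_restr)
  next
    case 3
    then obtain x y where "x \<in> edom u" "x \<bullet> i \<le> a" "y \<in> edom u" "a \<le> y \<bullet> i" by blast
    then have "\<exists>z\<in>edom u. i \<bullet> z = a"
      by (intro connected_ivt_hyperplane[of "edom u" x y] convex_connected convex_edom u) (auto simp: inner_commute)
    then have C: "edom u \<inter> ?C \<noteq> {}" by (auto simp: inner_commute slab_def)
    have r: "restr u ?A \<in> Conv_cd" "restr u ?B \<in> Conv_cd" "restr u ?C \<in> Conv_cd"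
      using 3 C by (auto intro!: restr_Conv_cd u closed_convex_halfspaces closed_convex_slab)
    have m: "(\<lambda>x. min (restr u ?A x) (restr u ?B x)) = u" "(\<lambda>x. max (restr u ?A x) (restr u ?B x)) = restr u ?C"
      by (auto simp: restr_def fun_eq_iff min_def max_def slab_def)
    then have "Z u + Z (restr u ?C) = Z (restr u ?A) + Z (restr u ?B)"
      using valuation[unfolded valuation_def, rule_format, OF r(1,2)] r(3) u by (simp only: m)
    then show ?thesis using r u by (simp add: zext_def)
  qed
qed

text \<open>With \<open>F m\<close> the value on the closed half-space above height
  \<open>\<epsilon> * m\<close>, the half-open slab has the value \<open>F m - F (m + 1)\<close>,
  and the sum telescopes.\<close>

lemma W_slabs:
  assumes u: "Conv_cd_or_empty u" and \<epsilon>: "0 < \<epsilon>" and dom: "\<And>x. x \<in> edom u \<Longrightarrow> - (real N * \<epsilon>) \<le> x \<bullet> i \<and> x \<bullet> i < real N * \<epsilon>"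
  shows "(\<Sum>m\<in>{- int N..<int N}. W (restr u (slab i (\<epsilon> * of_int m) (\<epsilon> * (of_int m + 1))))
      - W (restr u (slab i (\<epsilon> * (of_int m + 1)) (\<epsilon> * (of_int m + 1))))) = W u"
proof -
  define F where "F m = W (restr u {x. \<epsilon> * real_of_int m \<le> x \<bullet> i})" for m
  have "W (restr u (slab i (\<epsilon> * of_int m) (\<epsilon> * (of_int m + 1))))
      - W (restr u (slab i (\<epsilon> * (of_int m + 1)) (\<epsilon> * (of_int m + 1)))) = F m - F (m + 1)" for m
  proof -
    let ?a = "\<epsilon> * real_of_int m" and ?b = "\<epsilon> * (real_of_int m + 1)"
    have ab: "?a \<le> ?b" using \<epsilon> by (simp add: algebra_simps)
    have "Conv_cd_or_empty (restr u {x. ?a \<le> x \<bullet> i})" using u closed_convex_halfspaces by (intro Conv_cd_or_empty_restr)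
    from W_cut[OF this, of i ?b]
    have "W (restr u ({x. ?a \<le> x \<bullet> i} \<inter> {x. x \<bullet> i \<le> ?b})) + W (restr u ({x. ?a \<le> x \<bullet> i} \<inter> {x. ?b \<le> x \<bullet> i})) =
      F m + W (restr u ({x. ?a \<le> x \<bullet> i} \<inter> slab i ?b ?b))" by (simp add: restr_restr F_def)
    moreover have "{x. ?a \<le> x \<bullet> i} \<inter> {x. x \<bullet> i \<le> ?b} = slab i ?a ?b" "{x. ?a \<le> x \<bullet> i} \<inter> {x. ?b \<le> x \<bullet> i} = {x. ?b \<le> x \<bullet> i}"
      "{x. ?a \<le> x \<bullet> i} \<inter> slab i ?b ?b = slab i ?b ?b" using ab by (auto simp: slab_def)
    ultimately show ?thesis by (simp add: F_def)
  qed
  then have "(\<Sum>m\<in>{- int N..<int N}. W (restr u (slab i (\<epsilon> * of_int m) (\<epsilon> * (of_int m + 1))))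
      - W (restr u (slab i (\<epsilon> * (of_int m + 1)) (\<epsilon> * (of_int m + 1))))) = (\<Sum>m\<in>{- int N..<- int N + int (2 * N)}. F m - F (m + 1))"
    by (intro sum.cong) auto
  also have "\<dots> = F (- int N) - F (int N)" unfolding sum_telescope_int by simp
  also have "F (- int N) = W u" unfolding F_def
    using dom by (subst restr_edom) (auto simp: mult.commute)
  \<comment> \<open>The strict upper bound on the domain empties the last closed half-space.\<close>
  also have "F (int N) = 0" unfolding F_def
    using dom by (intro W_empty) (force simp: edom_restr mult.commute)
  finally show ?thesis by simp
qed

lemma W_cells:
  assumes "Conv_cd_or_empty u" "0 < \<epsilon>" "distinct is" "\<And>i x. i \<in> set is \<Longrightarrow> x \<in> edom u \<Longrightarrow> - (real N * \<epsilon>) \<le> x \<bullet> i \<and> x \<bullet> i < real N * \<epsilon>"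
  shows "(\<Sum>k\<in>PiE (set is) (\<lambda>_. {- int N..<int N}).
    half_open W (\<lambda>i. \<epsilon> * of_int (k i)) (\<lambda>i. \<epsilon> * (of_int (k i) + 1)) is u) = W u"
  using assms
proof (induction "is" arbitrary: u)
  case Nil
  then show ?case by simp
next
  case (Cons i "is")
  let ?R = "{- int N..<int N}"
  let ?P = "PiE (set is) (\<lambda>_. ?R)"
  let ?H = "\<lambda>k is u. half_open W (\<lambda>i. \<epsilon> * of_int (k i)) (\<lambda>i. \<epsilon> * (of_int (k i) + 1)) is u"
  have IH: "(\<Sum>k\<in>?P. ?H k is (restr u (slab i a b))) = W (restr u (slab i a b))" for a b
    using Cons.prems by (intro Cons.IH Conv_cd_or_empty_restr closed_convex_slab) (auto simp: edom_restr)
  have i: "i \<notin> set is" using Cons.prems by simp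
  have "(\<Sum>k\<in>PiE (set (i # is)) (\<lambda>_. ?R). ?H k (i # is) u) =
    (\<Sum>(m, k)\<in>?R \<times> ?P. ?H (k(i := m)) (i # is) u)"
    unfolding list.set PiE_insert_eq
    by (subst sum.reindex[OF inj_combinator[OF i]]) (auto intro!: sum.cong)
  also have "\<dots> = (\<Sum>m\<in>?R. \<Sum>k\<in>?P. ?H (k(i := m)) (i # is) u)"
    by (rule sum.cartesian_product[symmetric])
  also have "\<dots> = (\<Sum>m\<in>?R. \<Sum>k\<in>?P. ?H k is (restr u (slab i (\<epsilon> * of_int m) (\<epsilon> * (of_int m + 1))))
      - ?H k is (restr u (slab i (\<epsilon> * (of_int m + 1)) (\<epsilon> * (of_int m + 1)))))"
  proof (intro sum.cong refl)
    fix m k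
    have c: "?H (k(i := m)) is v = ?H k is v" for v
      by (rule half_open_cong) (use i in auto)
    show "?H (k(i := m)) (i # is) u = ?H k is (restr u (slab i (\<epsilon> * of_int m) (\<epsilon> * (of_int m + 1))))
      - ?H k is (restr u (slab i (\<epsilon> * (of_int m + 1)) (\<epsilon> * (of_int m + 1))))"
      by (simp only: half_open.simps c) simp
  qed
  also have "\<dots> = (\<Sum>m\<in>?R. W (restr u (slab i (\<epsilon> * of_int m) (\<epsilon> * (of_int m + 1))))
      - W (restr u (slab i (\<epsilon> * (of_int m + 1)) (\<epsilon> * (of_int m + 1)))))"
    by (simp only: sum_subtractf IH)
  also have "\<dots> = W u" using Cons.prems by (intro W_slabs) auto
  finally show ?case .
qed

text \<open>As the degree of homogeneity is the dimension, the factor is the volume of the rescaled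
  cube; it cancels against the volume of a cell once \<open>Z u\<close> is written as an
  integral.\<close>

lemma W_blow_up:
  assumes u: "Conv_cd_or_empty u" and \<epsilon>: "0 < \<epsilon>"
  shows "W u = \<epsilon> ^ DIM('a) * W (blow_up \<epsilon> c b u)"
proof (cases "edom u = {}")
  case True
  then have "edom (blow_up \<epsilon> c b u) = {}" using \<epsilon> by (simp add: edom_blow_up)
  then show ?thesis using True by (simp add: W_empty)
next
  case False
  then have u: "u \<in> Conv_cd" using u by (simp add: Conv_cd_or_empty_def)
  let ?w = "\<lambda>y. u (y - (- c)) + ereal (- b)"
  have w: "?w \<in> Conv_cd" by (rule translate_Conv_cd[OF u])
  have "Z ?w = Z u" by (rule translation[unfolded epi_translation_invariant_def, rule_format, OF u])
  moreover have "Z (\<lambda>x. ereal (1 / \<epsilon>) * ?w (x /\<^sub>R (1 / \<epsilon>))) = (1 / \<epsilon>) ^ DIM('a) * Z ?w"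
    using \<epsilon> by (intro homogeneous[unfolded epi_homogeneous_def, rule_format, OF w]) simp
  moreover have "(\<lambda>x. ereal (1 / \<epsilon>) * ?w (x /\<^sub>R (1 / \<epsilon>))) = blow_up \<epsilon> c b u"
    using \<epsilon> by (simp add: blow_up_def add.commute)
  ultimately have "Z (blow_up \<epsilon> c b u) = (1 / \<epsilon>) ^ DIM('a) * Z u" by simp
  then show ?thesis using u blow_up_Conv_cd[OF u \<epsilon>] \<epsilon> by (simp add: zext_def power_divide)
qed

lemma half_open_blow_up:
  assumes "Conv_cd_or_empty u" "0 < \<epsilon>" "\<And>i. i \<in> set is \<Longrightarrow> i \<in> Basis" "\<And>i. i \<in> set is \<Longrightarrow> c \<bullet> i = lo i \<and> hi i = lo i + \<epsilon>"
  shows "half_open W lo hi is u = \<epsilon> ^ DIM('a) * half_open W (\<lambda>_. 0) (\<lambda>_. 1) is (blow_up \<epsilon> c b u)"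
  using assms
proof (induction "is" arbitrary: u)
  case Nil
  then show ?case using W_blow_up[of u \<epsilon> c b] by simp
next
  case (Cons i "is")
  have "{z. c + \<epsilon> *\<^sub>R z \<in> slab i (lo i + \<epsilon> * a) (hi i)} = slab i a 1" for a
  proof -
    have "c \<bullet> i = lo i" "hi i = lo i + \<epsilon>" using Cons.prems(4)[of i] by auto
    then show ?thesis using \<open>0 < \<epsilon>\<close> by (auto simp: slab_def inner_add_left)
  qed
  from this[of 0] this[of 1] have s: "{z. c + \<epsilon> *\<^sub>R z \<in> slab i (lo i) (hi i)} = slab i 0 1"
    "{z. c + \<epsilon> *\<^sub>R z \<in> slab i (hi i) (hi i)} = slab i 1 1" using Cons.prems(4)[of i] by auto
  have IH: "half_open W lo hi is (restr u (slab i a b')) = \<epsilon> ^ DIM('a) * half_open W (\<lambda>_. 0) (\<lambda>_. 1) is (blow_up \<epsilon> c b (restr u (slab i a b')))" for a b'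
    using Cons.prems by (intro Cons.IH Conv_cd_or_empty_restr closed_convex_slab) auto
  show ?case using Cons.prems(2) by (simp add: IH restr_blow_up s right_diff_distrib)
qed

definition unit_cell :: "('a \<Rightarrow> ereal) \<Rightarrow> real" where
  "unit_cell v = half_open W (\<lambda>_. 0) (\<lambda>_. 1) basis_list v"

text \<open>Every term of the alternating sum belongs to a closed convex part of the unit cube,
  where uniform convergence yields epi-convergence. The condition on the \<open>v j\<close> is asked
  eventually, since a cell fits into the domain only for a small mesh.\<close>

lemma unit_cell_tendsto:
  assumes v: "\<forall>\<^sub>F j in sequentially. restr (v j) unit_cube \<in> Conv_cd \<and> unit_cube \<subseteq> edom (v j)"
    and f: "convex_on unit_cube f" "continuous_on unit_cube f"
    and unif: "\<And>e. 0 < e \<Longrightarrow> \<forall>\<^sub>F j in sequentially. \<forall>x\<in>unit_cube. \<bar>fin (v j) x - f x\<bar> < e"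
  shows "(\<lambda>j. unit_cell (v j)) \<longlonglongrightarrow> unit_cell (\<lambda>x. ereal (f x))"
proof -
  have W: "(\<lambda>j. W (restr (v j) A)) \<longlonglongrightarrow> W (restr (\<lambda>x. ereal (f x)) A)"
    if A: "closed A" "convex A" "A \<subseteq> unit_cube" for A
  proof (cases "A = {}")
    case True
    then show ?thesis by (simp add: W_empty edom_restr)
  next
    case False
    have fA: "restr (\<lambda>x. ereal (f x)) A \<in> Conv_cd"
    proof (rule restr_real_Conv_cd)
      show "compact A" using compact_Int_closed[OF unit_cube(1) A(1)] A(3) by (simp add: Int_absorb1)
    qed (use A False f in \<open>auto intro: convex_on_subset continuous_on_subset\<close>)
    have ev: "\<forall>\<^sub>F j in sequentially. restr (v j) A \<in> Conv_cd \<and> restr (v j) A = restr (\<lambda>x. ereal (fin (v j) x)) A"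
      using v
    proof eventually_elim
      case (elim j)
      have eq: "restr (v j) A = restr (restr (v j) unit_cube) A" using A(3) by (simp add: restr_restr Int_absorb1)
      have c: "restr (v j) A \<in> Conv_cd" unfolding eq
        by (rule restr_Conv_cd) (use elim A False in \<open>auto simp: edom_restr\<close>)
      have "restr (v j) A = restr (\<lambda>x. ereal (fin (v j) x)) A"
      proof
        fix x
        show "restr (v j) A x = restr (\<lambda>x. ereal (fin (v j) x)) A x"
        proof (cases "x \<in> A")
          case True
          then have "x \<in> edom (restr (v j) A)" using elim A(3) by (auto simp: edom_restr)
          from fin_eq[OF c this] show ?thesis using True by (simp add: restr_def)
        qed (simp add: restr_def)
      qed
      with c show ?case by simp
    qed
    have epi: "epi_converges (\<lambda>j. restr (\<lambda>x. ereal (fin (v j) x)) A) (restr (\<lambda>x. ereal (f x)) A)"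
    proof (rule epi_converges_uniform[OF A(1)])
      show "continuous_on A f" using f(2) A(3) by (rule continuous_on_subset)
      show "\<forall>\<^sub>F j in sequentially. \<forall>x\<in>A. \<bar>fin (v j) x - f x\<bar> < e" if "0 < e" for e
        using unif[OF that] by eventually_elim (use A(3) in auto)
    qed
    have "(\<lambda>j. Z (restr (\<lambda>x. ereal (fin (v j) x)) A)) \<longlonglongrightarrow> Z (restr (\<lambda>x. ereal (f x)) A)"
    proof (rule epi_continuous_eventually[OF continuous _ fA epi])
      show "\<forall>\<^sub>F j in sequentially. restr (\<lambda>x. ereal (fin (v j) x)) A \<in> Conv_cd"
        using ev by (rule eventually_mono) (elim conjE, erule subst)
    qed
    then have "(\<lambda>j. Z (restr (\<lambda>x. ereal (fin (v j) x)) A)) \<longlonglongrightarrow> W (restr (\<lambda>x. ereal (f x)) A)"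
      using fA by (simp add: zext_def)
    then show ?thesis
    proof (rule Lim_transform_eventually)
      show "\<forall>\<^sub>F j in sequentially. Z (restr (\<lambda>x. ereal (fin (v j) x)) A) = W (restr (v j) A)"
        using ev by (rule eventually_mono) (metis zext_def)
    qed
  qed
  have "(\<lambda>j. half_open W (\<lambda>_. 0) (\<lambda>_. 1) basis_list (restr (v j) UNIV))
      \<longlonglongrightarrow> half_open W (\<lambda>_. 0) (\<lambda>_. 1) basis_list (restr (\<lambda>x. ereal (f x)) UNIV)"
    by (rule half_open_tendsto[where C = unit_cube, OF W]) (auto simp: basis_list unit_cube_def)
  then show ?thesis by (simp add: unit_cell_def restr_def)
qed

definition \<zeta> :: "'a \<Rightarrow> real" where "\<zeta> y = unit_cell (\<lambda>x. ereal (y \<bullet> x))"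

lemma continuous_on_zeta: "continuous_on UNIV \<zeta>"
  unfolding continuous_on_sequentially
proof (intro allI ballI impI, elim conjE)
  fix Y :: "nat \<Rightarrow> 'a" and y assume Y: "Y \<longlonglongrightarrow> y"
  show "(\<zeta> \<circ> Y) \<longlonglongrightarrow> \<zeta> y" unfolding o_def \<zeta>_def
  proof (rule unit_cell_tendsto)
    show "\<forall>\<^sub>F j in sequentially. restr (\<lambda>x. ereal (Y j \<bullet> x)) unit_cube \<in> Conv_cd \<and> unit_cube \<subseteq> edom (\<lambda>x. ereal (Y j \<bullet> x))"
      by (intro always_eventually allI conjI linear_Conv_cd[OF unit_cube(1,2,3)]) (simp add: edom_def)
    show "convex_on unit_cube ((\<bullet>) y)" using unit_cube(2) by (rule convex_on_inner)
    show "continuous_on unit_cube ((\<bullet>) y)" by (intro continuous_intros)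
    fix e :: real assume e: "0 < e"
    define n where "n = real DIM('a)"
    have n: "0 < n" by (simp add: n_def)
    have "\<forall>\<^sub>F j in sequentially. dist (Y j) y < e / n" using Y e n by (intro tendstoD) auto
    then show "\<forall>\<^sub>F j in sequentially. \<forall>x\<in>unit_cube. \<bar>fin (\<lambda>x. ereal (Y j \<bullet> x)) x - y \<bullet> x\<bar> < e"
    proof eventually_elim
      case (elim j)
      show ?case
      proof
        fix x :: 'a assume "x \<in> unit_cube"
        then have x: "norm x \<le> n" using unit_cube(4) by (auto simp: n_def)
        have "\<bar>Y j \<bullet> x - y \<bullet> x\<bar> \<le> norm (Y j - y) * norm x"
          using Cauchy_Schwarz_ineq2[of "Y j - y" x] by (simp add: inner_diff_left)
        also have "\<dots> \<le> norm (Y j - y) * n" using x by (intro mult_left_mono) auto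
        also have "\<dots> < e" using elim n by (simp add: dist_norm field_simps)
        finally show "\<bar>fin (\<lambda>x. ereal (Y j \<bullet> x)) x - y \<bullet> x\<bar> < e" by simp
      qed
    qed
  qed
qed

end

section \<open>Gradients almost everywhere\<close>

lemma grad_eq:
  assumes "GDERIV (fin u) x :> D"
  shows "grad u x = D"
  unfolding grad_def
proof (rule the_equality)
  show "GDERIV (\<lambda>y. fin u y) x :> D" by (rule assms)
  fix D' assume "GDERIV (\<lambda>y. fin u y) x :> D'"
  then have "(\<lambda>h. h \<bullet> D') = (\<lambda>h. h \<bullet> D)"
    using assms unfolding gderiv_def by (rule has_derivative_unique)
  from fun_cong[OF this, of "D' - D"] have "(D' - D) \<bullet> (D' - D) = 0" by (simp add: inner_diff_right)
  then show "D' = D" by simp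
qed

lemma AE_differentiable:
  fixes u :: "'a::euclidean_space \<Rightarrow> ereal"
  assumes u: "u \<in> Conv_cd"
  shows "AE x in lebesgue. x \<notin> edom u \<or> (x \<in> interior (edom u) \<and> GDERIV (fin u) x :> grad u x)"
proof -
  let ?B = "{x \<in> interior (edom u). \<nexists>D. GDERIV (fin u) x :> D}"
  have "convex_on (interior (edom u)) (fin u)"
    using convex_on_fin[OF u] by (rule convex_on_subset) (auto simp: interior_subset convex_interior convex_edom u)
  then have "negligible ?B" by (rule negligible_convex_not_differentiable) simp
  moreover have "negligible (frontier (edom u))" by (intro negligible_convex_frontier convex_edom u)
  ultimately have "?B \<union> frontier (edom u) \<in> null_sets lebesgue" by (simp add: negligible_iff_null_sets[symmetric])
  from AE_not_in[OF this] show ?thesis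
  proof eventually_elim
    case (elim x)
    have "closed (edom u)" using Conv_cdD(5)[OF u] by (rule compact_imp_closed)
    then have "x \<notin> edom u \<or> x \<in> interior (edom u)" using elim by (auto simp: frontier_def)
    then show ?case using elim grad_eq by fastforce
  qed
qed

section \<open>Grid cells\<close>

definition cell :: "real \<Rightarrow> ('a::euclidean_space \<Rightarrow> int) \<Rightarrow> 'a set" where
  "cell \<epsilon> k = {x. \<forall>i\<in>Basis. \<epsilon> * of_int (k i) \<le> x \<bullet> i \<and> x \<bullet> i < \<epsilon> * (of_int (k i) + 1)}"

text \<open>\<open>restrict\<close> makes the index extensional, so that it equals a member of the
  finite product \<open>PiE\<close> as soon as the two agree on the basis.\<close>

definition cell_index :: "real \<Rightarrow> 'a::euclidean_space \<Rightarrow> 'a \<Rightarrow> int" where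
  "cell_index \<epsilon> x = restrict (\<lambda>i. \<lfloor>x \<bullet> i / \<epsilon>\<rfloor>) Basis"

lemma mem_cell:
  assumes "0 < \<epsilon>"
  shows "x \<in> cell \<epsilon> k \<longleftrightarrow> (\<forall>i\<in>Basis. k i = cell_index \<epsilon> x i)"
proof -
  have "\<epsilon> * of_int (k i) \<le> x \<bullet> i \<and> x \<bullet> i < \<epsilon> * (of_int (k i) + 1) \<longleftrightarrow> k i = \<lfloor>x \<bullet> i / \<epsilon>\<rfloor>" for i
    using floor_eq_iff[of "x \<bullet> i / \<epsilon>" "k i"] assms by (auto simp: field_simps)
  then show ?thesis by (simp add: cell_def cell_index_def)
qed

lemma measure_cell:
  fixes k :: "'a::euclidean_space \<Rightarrow> int"
  assumes "0 < \<epsilon>"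
  shows "cell \<epsilon> k \<in> sets borel" "emeasure lborel (cell \<epsilon> k) < \<infinity>" "measure lborel (cell \<epsilon> k) = \<epsilon> ^ DIM('a)"
proof -
  define a b where "a = (\<Sum>i\<in>Basis. (\<epsilon> * of_int (k i)) *\<^sub>R (i::'a))"
    and "b = (\<Sum>i\<in>Basis. (\<epsilon> * (of_int (k i) + 1)) *\<^sub>R (i::'a))"
  have ab: "a \<bullet> i = \<epsilon> * of_int (k i)" "b \<bullet> i = \<epsilon> * (of_int (k i) + 1)" if "i \<in> Basis" for i
    using that by (simp_all add: a_def b_def)
  have le: "a \<bullet> i \<le> b \<bullet> i" if "i \<in> Basis" for i using ab[OF that] assms by (simp add: distrib_left)
  have sub: "box a b \<subseteq> cell \<epsilon> k" "cell \<epsilon> k \<subseteq> cbox a b"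
    by (auto simp: box_def cbox_def cell_def ab)
  show b: "cell \<epsilon> k \<in> sets borel" unfolding cell_def by measurable
  have "emeasure lborel (cell \<epsilon> k) \<le> emeasure lborel (cbox a b)" by (rule emeasure_mono[OF sub(2)]) simp
  moreover have "emeasure lborel (box a b) \<le> emeasure lborel (cell \<epsilon> k)" by (rule emeasure_mono[OF sub(1)]) (use b in simp)
  moreover have p: "(\<Prod>i\<in>Basis. (b - a) \<bullet> i) = \<epsilon> ^ DIM('a)"
    by (simp add: inner_diff_left ab distrib_left)
  ultimately have e: "emeasure lborel (cell \<epsilon> k) = ennreal (\<epsilon> ^ DIM('a))"
    using le by (simp add: emeasure_lborel_box emeasure_lborel_cbox antisym)
  then show "emeasure lborel (cell \<epsilon> k) < \<infinity>" by simp
  show "measure lborel (cell \<epsilon> k) = \<epsilon> ^ DIM('a)" using e assms by (simp add: measure_def)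
qed

definition corner :: "real \<Rightarrow> 'a::euclidean_space \<Rightarrow> 'a" where
  "corner \<epsilon> x = (\<Sum>i\<in>Basis. (\<epsilon> * of_int (cell_index \<epsilon> x i)) *\<^sub>R i)"

lemma corner_inner: "i \<in> Basis \<Longrightarrow> corner \<epsilon> x \<bullet> i = \<epsilon> * of_int (cell_index \<epsilon> x i)"
  by (simp add: corner_def)

lemma corner_near:
  fixes x :: "'a::euclidean_space"
  assumes "0 < \<epsilon>" "z \<in> unit_cube"
  shows "norm (corner \<epsilon> x + \<epsilon> *\<^sub>R z - x) \<le> \<epsilon> * DIM('a)"
proof -
  have "norm (corner \<epsilon> x + \<epsilon> *\<^sub>R z - x) \<le> (\<Sum>i\<in>Basis. \<bar>(corner \<epsilon> x + \<epsilon> *\<^sub>R z - x) \<bullet> i\<bar>)" by (rule norm_le_l1)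
  also have "\<dots> \<le> (\<Sum>i\<in>(Basis::'a set). \<epsilon>)"
  proof (rule sum_mono)
    fix i :: 'a assume i: "i \<in> Basis"
    define t where "t = x \<bullet> i / \<epsilon>"
    have "(corner \<epsilon> x + \<epsilon> *\<^sub>R z - x) \<bullet> i = \<epsilon> * (of_int \<lfloor>t\<rfloor> + z \<bullet> i - t)"
      using i assms(1) by (simp add: inner_add_left inner_diff_left corner_inner cell_index_def t_def algebra_simps)
    moreover have "\<bar>of_int \<lfloor>t\<rfloor> + z \<bullet> i - t\<bar> \<le> 1"
    proof -
      have "0 \<le> z \<bullet> i" "z \<bullet> i \<le> 1" using assms(2) i by (auto simp: unit_cube_def)
      then show ?thesis using floor_correct[of t] by linarith
    qed
    ultimately show "\<bar>(corner \<epsilon> x + \<epsilon> *\<^sub>R z - x) \<bullet> i\<bar> \<le> \<epsilon>"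
      using assms(1) by (simp add: abs_mult mult_left_le)
  qed
  finally show ?thesis by (simp add: mult.commute)
qed

context epi_valuation
begin

lemma unit_cell_bound:
  assumes "\<And>A. closed A \<Longrightarrow> convex A \<Longrightarrow> A \<subseteq> unit_cube \<Longrightarrow> \<bar>W (restr v A)\<bar> \<le> M"
  shows "\<bar>unit_cell v\<bar> \<le> 2 ^ DIM('a) * M"
proof -
  have "length (basis_list :: 'a list) = DIM('a)"
    using distinct_card[OF basis_list(2)[where 'a = 'a]] by (simp add: basis_list(1))
  moreover have "\<bar>half_open W (\<lambda>_. 0) (\<lambda>_. 1) basis_list (restr v UNIV)\<bar> \<le> 2 ^ length (basis_list :: 'a list) * M"
    by (rule half_open_bound[where C = unit_cube]) (use assms in \<open>auto simp: basis_list unit_cube_def\<close>)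
  ultimately show ?thesis by (simp add: unit_cell_def restr_def)
qed

lemma unit_cell_off_domain:
  assumes "edom v \<inter> unit_cube = {}"
  shows "unit_cell v = 0"
proof -
  have "\<bar>unit_cell v\<bar> \<le> 2 ^ DIM('a) * 0"
  proof (rule unit_cell_bound)
    fix A :: "'a set" assume "A \<subseteq> unit_cube"
    then have "edom (restr v A) = {}" using assms by (auto simp: edom_restr)
    then show "\<bar>W (restr v A)\<bar> \<le> 0" by (simp add: W_empty)
  qed
  then show ?thesis by simp
qed

text \<open>On each cell \<open>s\<close> is the value of \<open>u\<close> on this half-open cell
  divided by the volume of the cell, which is the value of the blow-up on the unit cell. The height
  \<open>b\<close> is free by translation invariance, so that it can later be chosen depending on
  \<open>x\<close>.\<close>

lemma W_eq_integral_unit_cell: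
  assumes u: "u \<in> Conv_cd" and \<epsilon>: "0 < \<epsilon>"
  obtains s where "s \<in> borel_measurable borel" "(LINT x|lborel. s x) = Z u"
    "\<And>x b. s x = unit_cell (blow_up \<epsilon> (corner \<epsilon> x) b u)"
proof -
  obtain R where R: "\<And>x. x \<in> edom u \<Longrightarrow> norm x \<le> R"
    using Conv_cdD(5)[OF u] compact_imp_bounded bounded_iff by metis
  obtain N :: nat where "R / \<epsilon> < real N" using reals_Archimedean2 by blast
  then have N: "R < real N * \<epsilon>" using \<epsilon> by (simp add: field_simps)
  \<comment> \<open>The bounds are strict on both sides: the closed cells just outside of the grid
    share faces with it and must still miss the domain.\<close>
  have dom: "- (real N * \<epsilon>) < x \<bullet> i \<and> x \<bullet> i < real N * \<epsilon>" if "i \<in> Basis" "x \<in> edom u" for i x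
    using Basis_le_norm[OF that(1), of x] R[OF that(2)] N by auto
  define P where "P = PiE (Basis :: 'a set) (\<lambda>_. {- int N..<int N})"
  define a where "a k = half_open W (\<lambda>i. \<epsilon> * of_int (k i)) (\<lambda>i. \<epsilon> * (of_int (k i) + 1)) basis_list u" for k :: "'a \<Rightarrow> int"
  define n where "n = DIM('a)"
  define s where "s x = (\<Sum>k\<in>P. a k / \<epsilon> ^ n * indicator (cell \<epsilon> k) x)" for x
  have finP: "finite P" unfolding P_def by (intro finite_PiE) auto
  show ?thesis
  proof (rule that)
    show "s \<in> borel_measurable borel" unfolding s_def
      by (intro borel_measurable_sum borel_measurable_times borel_measurable_indicator measure_cell \<epsilon>) auto
    have "(LINT x|lborel. s x) = (\<Sum>k\<in>P. LINT x|lborel. a k / \<epsilon> ^ n * indicator (cell \<epsilon> k) x)"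
      unfolding s_def
      by (intro Bochner_Integration.integral_sum integrable_mult_right integrable_real_indicator measure_cell \<epsilon>)
        (use measure_cell \<epsilon> in auto)
    also have "\<dots> = (\<Sum>k\<in>P. a k)"
      using \<epsilon> by (intro sum.cong) (auto simp: n_def measure_cell(3)[OF \<epsilon>])
    also have "\<dots> = W u" unfolding P_def a_def basis_list(1)[symmetric]
      by (rule W_cells) (use u \<epsilon> dom in \<open>auto simp: Conv_cd_or_empty_def basis_list less_imp_le\<close>)
    finally show "(LINT x|lborel. s x) = Z u" using u by (simp add: zext_def)
  next
    fix x :: 'a and b
    let ?k = "cell_index \<epsilon> x"
    have ext: "k = ?k \<longleftrightarrow> x \<in> cell \<epsilon> k" if "k \<in> P" for k
      using that unfolding mem_cell[OF \<epsilon>] P_def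
      by (auto simp: cell_index_def fun_eq_iff PiE_def extensional_def)
    have sum: "s x = (if ?k \<in> P then a ?k / \<epsilon> ^ n else 0)"
    proof -
      have "s x = (\<Sum>k\<in>P. if k = ?k then a ?k / \<epsilon> ^ n else 0)"
        unfolding s_def using ext by (intro sum.cong) (auto simp: indicator_def)
      then show ?thesis using finP by (simp add: sum.delta)
    qed
    show "s x = unit_cell (blow_up \<epsilon> (corner \<epsilon> x) b u)"
    proof (cases "?k \<in> P")
      case True
      have "a ?k = \<epsilon> ^ DIM('a) * half_open W (\<lambda>_. 0) (\<lambda>_. 1) basis_list (blow_up \<epsilon> (corner \<epsilon> x) b u)"
        unfolding a_def using u \<epsilon>
        by (intro half_open_blow_up) (auto simp: Conv_cd_or_empty_def basis_list corner_inner algebra_simps)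
      then show ?thesis using True \<epsilon> by (simp add: sum unit_cell_def n_def)
    next
      case False
      then obtain i where i: "i \<in> Basis" "?k i < - int N \<or> int N \<le> ?k i"
        by (force simp: P_def cell_index_def PiE_iff)
      have "edom (blow_up \<epsilon> (corner \<epsilon> x) b u) \<inter> unit_cube = {}"
      proof (rule ccontr)
        assume "\<not> ?thesis"
        then obtain z where z: "corner \<epsilon> x + \<epsilon> *\<^sub>R z \<in> edom u" "z \<in> unit_cube" using \<epsilon> by (auto simp: edom_blow_up)
        have zi: "0 \<le> z \<bullet> i" "z \<bullet> i \<le> 1" using z(2) i(1) by (auto simp: unit_cube_def)
        have e: "(corner \<epsilon> x + \<epsilon> *\<^sub>R z) \<bullet> i = \<epsilon> * (of_int (?k i) + z \<bullet> i)"
          using i(1) by (simp add: inner_add_left corner_inner distrib_left)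
        have "\<epsilon> * (- real N) < \<epsilon> * (of_int (?k i) + z \<bullet> i)" "\<epsilon> * (of_int (?k i) + z \<bullet> i) < \<epsilon> * real N"
          using dom[OF i(1) z(1)] unfolding e by (simp_all only: mult.commute[of "real N"] mult_minus_right)
        then have "- real N < of_int (?k i) + z \<bullet> i" "of_int (?k i) + z \<bullet> i < real N"
          using \<epsilon> by (simp_all only: mult_less_cancel_left_pos)
        then have "- real N < of_int (?k i) + 1" "of_int (?k i) < real N" using zi by linarith+
        then have "- int N < ?k i + 1" "?k i < int N" by linarith+
        then show False using i(2) by linarith
      qed
      then show ?thesis using False by (simp add: sum unit_cell_off_domain)
    qed
  qed
qed

text \<open>The integrals of the step functions equal \<open>Z u\<close> for every mesh, so it
  remains to pass to the limit under the integral. Blowing up preserves the Lipschitz constant; this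
  bounds the oscillation of all blow-ups on the unit cube and thereby the step functions.\<close>

theorem lipschitz_representation:
  assumes u: "u \<in> Conv_cd"
    and L: "\<And>x y. x \<in> edom u \<Longrightarrow> y \<in> edom u \<Longrightarrow> fin u x \<le> fin u y + L * dist x y"
  shows "integrable lebesgue (\<lambda>x. indicator (edom u) x * \<zeta> (grad u x))"
    and "Z u = (LINT x|lebesgue. indicator (edom u) x * \<zeta> (grad u x))"
proof -
  define n where "n = real DIM('a)"
  have n: "0 < n" by (simp add: n_def)
  define L' where "L' = max L 0"
  \<comment> \<open>\<open>n\<close> bounds the norm on the unit cube, hence \<open>2 * n\<close>
    the distances in it.\<close>
  obtain M where M: "\<And>v. v \<in> Conv_cd \<Longrightarrow> edom v \<subseteq> cball 0 n \<Longrightarrow>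
    (\<And>x y. x \<in> edom v \<Longrightarrow> y \<in> edom v \<Longrightarrow> fin v x \<le> fin v y + L' * (2 * n)) \<Longrightarrow> \<bar>Z v\<bar> \<le> M"
    by (rule bounded_on_functions_of_bounded_oscillation[OF continuous translation, of n "L' * (2 * n)"]) blast
  define \<epsilon> where "\<epsilon> j = 1 / real (Suc j)" for j
  have \<epsilon>: "0 < \<epsilon> j" "\<epsilon> j \<le> 1" for j by (auto simp: \<epsilon>_def)
  have \<epsilon>0: "\<epsilon> \<longlonglongrightarrow> 0" unfolding \<epsilon>_def using LIMSEQ_inverse_real_of_nat by (simp add: inverse_eq_divide)
  have "\<forall>j. \<exists>s. s \<in> borel_measurable borel \<and> (LINT x|lborel. s x) = Z u \<and> (\<forall>x b. s x = unit_cell (blow_up (\<epsilon> j) (corner (\<epsilon> j) x) b u))"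
    by (metis W_eq_integral_unit_cell[OF u \<epsilon>(1)])
  then obtain s where s: "\<And>j. s j \<in> borel_measurable borel" "\<And>j. (LINT x|lborel. s j x) = Z u"
    "\<And>j x b. s j x = unit_cell (blow_up (\<epsilon> j) (corner (\<epsilon> j) x) b u)" by metis
  obtain R where R: "\<And>x. x \<in> edom u \<Longrightarrow> norm x \<le> R"
    using Conv_cdD(5)[OF u] compact_imp_bounded bounded_iff by metis
  have Mb: "\<bar>s j x\<bar> \<le> 2 ^ DIM('a) * max M 0" for j x
    unfolding s(3)[of j x 0]
  proof (rule unit_cell_bound)
    fix A :: "'a set" assume A: "closed A" "convex A" "A \<subseteq> unit_cube"
    let ?v = "restr (blow_up (\<epsilon> j) (corner (\<epsilon> j) x) 0 u) A"
    show "\<bar>W ?v\<bar> \<le> max M 0"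
    proof (cases "edom ?v = {}")
      case True
      then show ?thesis by (simp add: W_empty)
    next
      case False
      then have v: "?v \<in> Conv_cd"
        using A by (intro restr_Conv_cd blow_up_Conv_cd u \<epsilon>) (auto simp: edom_restr)
      have "\<bar>Z ?v\<bar> \<le> M"
      proof (rule M[OF v])
        show sub: "edom ?v \<subseteq> cball 0 n" using A(3) unit_cube(4) by (auto simp: edom_restr n_def)
        fix y z assume yz: "y \<in> edom ?v" "z \<in> edom ?v"
        let ?T = "\<lambda>z. corner (\<epsilon> j) x + \<epsilon> j *\<^sub>R z"
        have d: "?T y \<in> edom u" "?T z \<in> edom u" using yz \<epsilon> by (auto simp: edom_restr edom_blow_up)
        have f: "fin ?v y = fin u (?T y) / \<epsilon> j" "fin ?v z = fin u (?T z) / \<epsilon> j"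
        proof -
          have "y \<in> A" "z \<in> A" using yz by (auto simp: edom_restr)
          then show "fin ?v y = fin u (?T y) / \<epsilon> j" "fin ?v z = fin u (?T z) / \<epsilon> j"
            using fin_blow_up[OF u \<epsilon>(1) d(1), of 0] fin_blow_up[OF u \<epsilon>(1) d(2), of 0] by (auto simp: restr_def)
        qed
        have "dist (?T y) (?T z) = \<epsilon> j * dist y z"
          using \<epsilon>(1)[of j] by (simp add: dist_norm flip: scaleR_diff_right)
        then have "fin u (?T y) \<le> fin u (?T z) + L * (\<epsilon> j * dist y z)" using L[OF d] by simp
        also have "\<dots> \<le> fin u (?T z) + L' * (\<epsilon> j * dist y z)"
          using \<epsilon>(1)[of j] by (intro add_left_mono mult_right_mono) (auto simp: L'_def)
        finally have "fin ?v y \<le> fin ?v z + L' * dist y z" unfolding f using \<epsilon>(1)[of j] by (simp add: field_simps)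
        also have "\<dots> \<le> fin ?v z + L' * (2 * n)"
        proof (intro add_left_mono mult_left_mono)
          have "norm y \<le> n" "norm z \<le> n" using sub yz by auto
          then show "dist y z \<le> 2 * n" unfolding dist_norm using norm_triangle_ineq4[of y z] by linarith
        qed (simp add: L'_def)
        finally show "fin ?v y \<le> fin ?v z + L' * (2 * n)" .
      qed
      then show ?thesis using v by (simp add: zext_def)
    qed
  qed
  have off: "s j x = 0" if "\<And>y. y \<in> edom u \<Longrightarrow> \<epsilon> j * n < dist x y" for j x
    unfolding s(3)[of j x 0]
  proof (rule unit_cell_off_domain, rule ccontr)
    assume "edom (blow_up (\<epsilon> j) (corner (\<epsilon> j) x) 0 u) \<inter> unit_cube \<noteq> {}"
    then obtain z where z: "corner (\<epsilon> j) x + \<epsilon> j *\<^sub>R z \<in> edom u" "z \<in> unit_cube" using \<epsilon> by (auto simp: edom_blow_up)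
    from corner_near[OF \<epsilon>(1) z(2), of j x] that[OF z(1)] show False
      by (simp add: dist_norm norm_minus_commute n_def)
  qed
  \<comment> \<open>The step functions vanish beyond distance \<open>n\<close> from the domain
    because the mesh is at most 1.\<close>
  define w where "w x = 2 ^ DIM('a) * max M 0 * indicator (cball 0 (R + n)) x" for x :: 'a
  have w: "integrable lebesgue w" unfolding w_def
    using lmeasurable_cball by (intro integrable_mult_right) (auto simp: integrable_indicator_iff fmeasurable_def)
  have bound: "norm (s j x) \<le> w x" for j x
  proof (cases "norm x \<le> R + n")
    case True
    then show ?thesis using Mb[of j x] by (simp add: w_def)
  next
    case False
    have "s j x = 0"
    proof (rule off)
      fix y assume "y \<in> edom u"
      then have "norm y \<le> R" by (rule R)
      moreover have "\<epsilon> j * n \<le> n" using \<epsilon>[of j] n by (simp add: mult_le_cancel_right1)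
      ultimately show "\<epsilon> j * n < dist x y" unfolding dist_norm using False norm_triangle_ineq2[of x y] by linarith
    qed
    then show ?thesis by (simp add: w_def)
  qed
  have lim: "AE x in lebesgue. (\<lambda>j. s j x) \<longlonglongrightarrow> indicator (edom u) x * \<zeta> (grad u x)"
    using AE_differentiable[OF u]
  proof eventually_elim
    case (elim x)
    show ?case
    proof (cases "x \<in> edom u")
      case False
      have "closed (edom u)" using Conv_cdD(5)[OF u] by (rule compact_imp_closed)
      then obtain \<delta> where \<delta>: "0 < \<delta>" "\<And>y. y \<in> edom u \<Longrightarrow> \<delta> \<le> dist x y"
        using separate_point_closed[OF _ False] by blast
      have "\<forall>\<^sub>F j in sequentially. \<epsilon> j * n < \<delta>"
        using order_tendstoD(2)[OF tendsto_mult[OF \<epsilon>0 tendsto_const[of n]], of \<delta>] \<delta> by simp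
      then have "\<forall>\<^sub>F j in sequentially. s j x = 0"
        by eventually_elim (rule off, use \<delta>(2) in \<open>auto intro: less_le_trans\<close>)
      then show ?thesis using False by (simp add: tendsto_eventually)
    next
      case True
      then have x: "x \<in> interior (edom u)" and "GDERIV (fin u) x :> grad u x" using elim by auto
      define D where "D = grad u x"
      have der: "(fin u has_derivative (\<lambda>h. h \<bullet> D)) (at x)"
        using \<open>GDERIV (fin u) x :> grad u x\<close> by (simp add: gderiv_def D_def)
      obtain r where r: "0 < r" "cball x r \<subseteq> edom u" using x mem_interior_cball by blast
      define c where "c j = corner (\<epsilon> j) x" for j
      \<comment> \<open>The height of the tangent plane over the corner; with it the blow-ups tend
        to the linear function of slope \<open>D\<close> without a constant term.\<close>
      define b where "b j = fin u x + D \<bullet> (c j - x)" for j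
      have near: "norm (c j + \<epsilon> j *\<^sub>R z - x) \<le> \<epsilon> j * n" if "z \<in> unit_cube" for j z
        using corner_near[OF \<epsilon>(1) that, of j x] by (simp add: c_def n_def)
      have small: "\<forall>\<^sub>F j in sequentially. \<epsilon> j * n < d" if "0 < d" for d
        using order_tendstoD(2)[OF tendsto_mult[OF \<epsilon>0 tendsto_const[of n]], of d] that by simp
      have inr: "\<forall>\<^sub>F j in sequentially. \<forall>z\<in>unit_cube. c j + \<epsilon> j *\<^sub>R z \<in> edom u"
        using small[OF r(1)]
      proof eventually_elim
        case (elim j)
        show ?case
        proof
          fix z :: 'a assume "z \<in> unit_cube"
          from near[OF this, of j] elim have "c j + \<epsilon> j *\<^sub>R z \<in> cball x r" by (simp add: dist_norm norm_minus_commute)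
          then show "c j + \<epsilon> j *\<^sub>R z \<in> edom u" using r(2) by blast
        qed
      qed
      have "(\<lambda>j. unit_cell (blow_up (\<epsilon> j) (c j) (b j) u)) \<longlonglongrightarrow> unit_cell (\<lambda>z. ereal (D \<bullet> z))"
      proof (rule unit_cell_tendsto)
        show "\<forall>\<^sub>F j in sequentially. restr (blow_up (\<epsilon> j) (c j) (b j) u) unit_cube \<in> Conv_cd \<and>
            unit_cube \<subseteq> edom (blow_up (\<epsilon> j) (c j) (b j) u)"
          using inr
        proof eventually_elim
          case (elim j)
          then have "unit_cube \<subseteq> edom (blow_up (\<epsilon> j) (c j) (b j) u)" by (auto simp: edom_blow_up \<epsilon>)
          moreover have "restr (blow_up (\<epsilon> j) (c j) (b j) u) unit_cube \<in> Conv_cd"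
            using unit_cube compact_imp_closed calculation
            by (intro restr_Conv_cd blow_up_Conv_cd u \<epsilon>) auto
          ultimately show ?case by simp
        qed
        show "convex_on unit_cube ((\<bullet>) D)" using unit_cube(2) by (rule convex_on_inner)
        show "continuous_on unit_cube ((\<bullet>) D)" by (intro continuous_intros)
        fix e :: real assume e: "0 < e"
        \<comment> \<open>Points of the cell lie within \<open>\<epsilon> j * n\<close> of
          \<open>x\<close>, so after division by \<open>\<epsilon> j\<close> the error is at most
          \<open>e' * n = e / 2\<close>.\<close>
        define e' where "e' = e / (2 * n)"
        have e': "0 < e'" using e n by (simp add: e'_def)
        obtain d where d: "0 < d" "\<And>y. norm (y - x) < d \<Longrightarrow> norm (fin u y - fin u x - (y - x) \<bullet> D) \<le> e' * norm (y - x)"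
          using der e' unfolding has_derivative_at_alt by blast
        show "\<forall>\<^sub>F j in sequentially. \<forall>z\<in>unit_cube. \<bar>fin (blow_up (\<epsilon> j) (c j) (b j) u) z - D \<bullet> z\<bar> < e"
          using inr small[OF d(1)]
        proof eventually_elim
          case (elim j)
          show ?case
          proof
            fix z :: 'a assume z: "z \<in> unit_cube"
            let ?y = "c j + \<epsilon> j *\<^sub>R z"
            have "fin (blow_up (\<epsilon> j) (c j) (b j) u) z - D \<bullet> z = (fin u ?y - b j) / \<epsilon> j - D \<bullet> z"
              using elim(1) z by (subst fin_blow_up[OF u \<epsilon>(1)]) auto
            also have "\<dots> = (fin u ?y - fin u x - (?y - x) \<bullet> D) / \<epsilon> j"
              using \<epsilon>(1)[of j] by (simp add: b_def field_simps inner_add_right inner_diff_right inner_commute[of _ D])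
            finally have eq: "\<bar>fin (blow_up (\<epsilon> j) (c j) (b j) u) z - D \<bullet> z\<bar> = \<bar>fin u ?y - fin u x - (?y - x) \<bullet> D\<bar> / \<epsilon> j"
              using \<epsilon>(1)[of j] by (simp only: abs_divide abs_of_pos)
            have "\<bar>fin u ?y - fin u x - (?y - x) \<bullet> D\<bar> \<le> e' * norm (?y - x)"
              using d(2)[of ?y] near[OF z, of j] elim(2) by simp
            also have "\<dots> \<le> e' * (\<epsilon> j * n)" using near[OF z, of j] e' by (intro mult_left_mono) auto
            also have "\<dots> = e / 2 * \<epsilon> j" using n by (simp add: e'_def)
            also have "\<dots> < e * \<epsilon> j" using e \<epsilon>(1)[of j] by simp
            finally show "\<bar>fin (blow_up (\<epsilon> j) (c j) (b j) u) z - D \<bullet> z\<bar> < e"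
              unfolding eq using \<epsilon>(1)[of j] by (simp add: divide_less_eq)
          qed
        qed
      qed
      moreover have "s j x = unit_cell (blow_up (\<epsilon> j) (c j) (b j) u)" for j unfolding c_def by (rule s(3))
      ultimately show ?thesis using True by (simp add: \<zeta>_def D_def)
    qed
  qed
  have sm: "s j \<in> borel_measurable lebesgue" for j using s(1)[of j] by (simp add: measurable_completion)
  have si: "(LINT x|lebesgue. s j x) = Z u" for j
    using s(2)[of j] s(1)[of j] by (subst integral_completion) auto
  note dct = lebesgue_dominated_convergence[OF sm w lim AE_I2[OF bound]]
  show "integrable lebesgue (\<lambda>x. indicator (edom u) x * \<zeta> (grad u x))" by (rule dct(1))
  from dct(2) show "Z u = (LINT x|lebesgue. indicator (edom u) x * \<zeta> (grad u x))"
    unfolding si by (intro LIMSEQ_unique[OF tendsto_const])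
qed

end

section \<open>The density and the representation of general functions\<close>

lemma convex_on_above_tangent_plane:
  fixes f :: "'a::euclidean_space \<Rightarrow> real"
  assumes f: "convex_on S f" and x: "x \<in> S" and y: "y \<in> S" and D: "GDERIV f x :> D"
  shows "f x + D \<bullet> (y - x) \<le> f y"
proof (rule field_le_epsilon)
  fix \<epsilon> :: real assume \<epsilon>: "0 < \<epsilon>"
  define v where "v = y - x"
  define e where "e = \<epsilon> / (norm v + 1)"
  have nv: "0 < norm v + 1" by (simp add: add_nonneg_pos)
  have e: "0 < e" "e * norm v \<le> \<epsilon>" using \<epsilon> nv by (auto simp: e_def field_simps)
  obtain d where d: "0 < d" "\<And>y. norm (y - x) < d \<Longrightarrow> norm (f y - f x - (y - x) \<bullet> D) \<le> e * norm (y - x)"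
    using D e(1) unfolding gderiv_def has_derivative_at_alt by blast
  \<comment> \<open>Small enough for \<open>x + t *\<^sub>R v\<close> to lie where the derivative
    controls \<open>f\<close>.\<close>
  define t where "t = min 1 (d / (2 * (norm v + 1)))"
  have t: "0 < t" "t \<le> 1" using d(1) nv by (auto simp: t_def)
  have "t * norm v \<le> d / (2 * (norm v + 1)) * (norm v + 1)"
    using t d(1) nv by (intro mult_mono) (auto simp: t_def)
  also have "\<dots> = d / 2"
  proof -
    have "d / (2 * q) * q = d / 2" if "0 < q" for q :: real using that by simp
    from this[OF nv] show ?thesis .
  qed
  also have "\<dots> < d" using d(1) by simp
  finally have "norm ((x + t *\<^sub>R v) - x) < d" using t by simp
  from d(2)[OF this] have "f x + t * (v \<bullet> D) - e * (t * norm v) \<le> f (x + t *\<^sub>R v)" using t by simp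
  moreover have "f ((1 - t) *\<^sub>R x + t *\<^sub>R y) \<le> (1 - t) * f x + t * f y"
    using t x y by (intro convex_onD[OF f]) auto
  moreover have "(1 - t) *\<^sub>R x + t *\<^sub>R y = x + t *\<^sub>R v" by (simp add: v_def algebra_simps)
  ultimately have "t * (v \<bullet> D - e * norm v) \<le> t * (f y - f x)" by (simp add: algebra_simps)
  then have "v \<bullet> D - e * norm v \<le> f y - f x" using t by simp
  then show "f x + D \<bullet> (y - x) \<le> f y + \<epsilon>" using e(2) by (simp add: v_def inner_commute)
qed

section \<open>Linear functions of large slope on cylinders\<close>

lemma norm_orthogonal_part:
  assumes "norm e = 1"
  shows "norm (w - (w \<bullet> e) *\<^sub>R e) \<le> norm w"
proof -
  have "e \<bullet> e = 1" using assms by (simp add: dot_square_norm)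
  then have "(norm (w - (w \<bullet> e) *\<^sub>R e))\<^sup>2 = (norm w)\<^sup>2 - (w \<bullet> e)\<^sup>2"
    unfolding power2_norm_eq_inner by (simp add: algebra_simps inner_commute power2_eq_square)
  then have "(norm (w - (w \<bullet> e) *\<^sub>R e))\<^sup>2 \<le> (norm w)\<^sup>2" by simp
  then show ?thesis by (rule power2_le_imp_le) simp
qed

text \<open>For a unit vector \<open>e\<close>, \<open>cylinder e 0\<close> is the unit disc
  orthogonal to \<open>e\<close>, the domain of the limit in the support argument.\<close>

definition cylinder :: "'a::euclidean_space \<Rightarrow> real \<Rightarrow> 'a set" where
  "cylinder e L = {x. 0 \<le> x \<bullet> e \<and> x \<bullet> e \<le> L \<and> norm (x - (x \<bullet> e) *\<^sub>R e) \<le> 1}"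

lemma cylinder:
  assumes e: "norm e = 1" and L: "0 \<le> L"
  shows "compact (cylinder e L)" "convex (cylinder e L)" "cylinder e L \<noteq> {}"
proof -
  have "norm x \<le> L + 1" if "x \<in> cylinder e L" for x
  proof -
    have "norm x \<le> norm (x - (x \<bullet> e) *\<^sub>R e) + norm ((x \<bullet> e) *\<^sub>R e)"
      using norm_triangle_ineq[of "x - (x \<bullet> e) *\<^sub>R e" "(x \<bullet> e) *\<^sub>R e"] by simp
    then show ?thesis using that e by (auto simp: cylinder_def)
  qed
  then have "bounded (cylinder e L)" unfolding bounded_iff by blast
  moreover have "closed (cylinder e L)" unfolding cylinder_def
    by (intro closed_Collect_conj closed_Collect_le continuous_intros)
  ultimately show "compact (cylinder e L)" by (simp add: compact_eq_bounded_closed)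
  have "cylinder e L = slab e 0 L \<inter> (\<lambda>x. x - (x \<bullet> e) *\<^sub>R e) -` cball 0 1"
    by (auto simp: cylinder_def slab_def)
  moreover have "linear (\<lambda>x. x - (x \<bullet> e) *\<^sub>R e)"
    by (rule linearI) (auto simp: algebra_simps)
  ultimately show "convex (cylinder e L)"
    using closed_convex_slab by (auto intro!: convex_Int convex_linear_vimage)
  have "0 \<in> cylinder e L" using L by (simp add: cylinder_def)
  then show "cylinder e L \<noteq> {}" by blast
qed

text \<open>Disjoint balls of radius \<open>1 / 2\<close>, lined up along the axis, fit into the
  cylinder. Growth at least linear in the length is what the support argument uses.\<close>

lemma measure_cylinder_ge:
  fixes e :: "'a::euclidean_space"
  assumes e: "norm e = 1"
  shows "real n * measure lebesgue (ball (0::'a) (1/2)) \<le> measure lebesgue (cylinder e (real n))"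
proof -
  define B where "B j = ball ((real j + 1/2) *\<^sub>R e) (1/2)" for j
  have ee: "e \<bullet> e = 1" using e by (simp add: dot_square_norm)
  have inB: "real j < x \<bullet> e \<and> x \<bullet> e < real j + 1 \<and> norm (x - (x \<bullet> e) *\<^sub>R e) \<le> 1" if "x \<in> B j" for x j
  proof -
    define w where "w = x - (real j + 1/2) *\<^sub>R e"
    have w: "norm w < 1/2" using that by (simp add: B_def w_def dist_norm norm_minus_commute)
    have x: "x = (real j + 1/2) *\<^sub>R e + w" by (simp add: w_def)
    have we: "\<bar>w \<bullet> e\<bar> < 1/2" using Cauchy_Schwarz_ineq2[of w e] e w by simp
    have xe: "x \<bullet> e = real j + 1/2 + w \<bullet> e" by (simp add: x inner_add_left ee)
    have "x - (x \<bullet> e) *\<^sub>R e = w - (w \<bullet> e) *\<^sub>R e" unfolding xe by (simp add: x algebra_simps)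
    then show ?thesis using we norm_orthogonal_part[OF e, of w] w unfolding xe by auto
  qed
  have dis: "disjoint_family_on B {..<n}" unfolding disjoint_family_on_def
  proof (intro ballI impI, rule ccontr)
    fix i j :: nat assume "i \<noteq> j" "B i \<inter> B j \<noteq> {}"
    then obtain x where "x \<in> B i" "x \<in> B j" by blast
    from inB[OF this(1)] inB[OF this(2)] have "real i < real j + 1" "real j < real i + 1" by linarith+
    then show False using \<open>i \<noteq> j\<close> by linarith
  qed
  have "real n * measure lebesgue (ball (0::'a) (1/2)) = (\<Sum>j<n. measure lebesgue (B j))"
    by (simp add: B_def content_ball)
  also have "\<dots> = measure lebesgue (\<Union>j\<in>{..<n}. B j)"
  proof (intro measure_finite_Union[symmetric] dis)
    show "B ` {..<n} \<subseteq> sets lebesgue" by (auto simp: B_def)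
    show "emeasure lebesgue (B j) \<noteq> \<infinity>" for j by (simp add: B_def emeasure_ball)
  qed simp
  also have "\<dots> \<le> measure lebesgue (cylinder e (real n))"
  proof (rule measure_mono_fmeasurable)
    show "(\<Union>j\<in>{..<n}. B j) \<subseteq> cylinder e (real n)"
    proof
      fix x assume "x \<in> (\<Union>j\<in>{..<n}. B j)"
      then obtain j where j: "j < n" "x \<in> B j" by auto
      moreover have "real j + 1 \<le> real n" using j(1) by linarith
      ultimately show "x \<in> cylinder e (real n)" using inB[OF j(2)] by (auto simp: cylinder_def)
    qed
    show "cylinder e (real n) \<in> lmeasurable" using cylinder(1)[OF e] by (intro lmeasurable_compact) simp
  qed (auto simp: B_def)
  finally show ?thesis .
qed

text \<open>Off the domain of the limit the lower bound alone forces the values to infinity, so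
  recovery sequences are asked for on the domain only.\<close>

lemma epi_converges_const:
  assumes ev: "\<And>x X c. X \<longlonglongrightarrow> x \<Longrightarrow> c < u x \<Longrightarrow> \<forall>\<^sub>F j in sequentially. c < U j (X j)"
    and up: "\<And>x. u x < \<infinity> \<Longrightarrow> \<exists>X. X \<longlonglongrightarrow> x \<and> (\<forall>c>u x. \<forall>\<^sub>F j in sequentially. U j (X j) < c)"
  shows "epi_converges U u"
  unfolding epi_converges_def
proof (intro allI conjI impI)
  show "u x \<le> liminf (\<lambda>j. U j (X j))" if "X \<longlonglongrightarrow> x" for x X
    unfolding le_Liminf_iff using ev[OF that] by blast
  show "\<exists>X. X \<longlonglongrightarrow> x \<and> (\<lambda>j. U j (X j)) \<longlonglongrightarrow> u x" for x
  proof (cases "u x < \<infinity>")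
    case True
    then obtain X where X: "X \<longlonglongrightarrow> x" "\<forall>c>u x. \<forall>\<^sub>F j in sequentially. U j (X j) < c" using up by blast
    have "(\<lambda>j. U j (X j)) \<longlonglongrightarrow> u x" by (rule order_tendstoI) (use ev[OF X(1)] X(2) in auto)
    with X(1) show ?thesis by blast
  next
    case False
    have "(\<lambda>j. U j x) \<longlonglongrightarrow> u x" by (rule order_tendstoI) (use ev[OF tendsto_const] False in auto)
    then show ?thesis by (intro exI[of _ "\<lambda>_. x"]) simp
  qed
qed

text \<open>The lengths \<open>L j\<close> may grow without bound: ahead of the disc the values are
  the norm of the slope times a height bounded away from 0, hence tend to infinity, and the other
  points off the disc eventually fall outside of the cylinders. At points of the disc the values
  along any sequence are nonnegative, and projecting orthogonally to \<open>E j\<close> gives points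
  of the cylinders with value 0. The limit is written with slope 0 to match the formula for linear
  functions.\<close>

lemma epi_converges_cylinder:
  fixes Y :: "nat \<Rightarrow> 'a::euclidean_space"
  assumes Y: "filterlim (\<lambda>j. norm (Y j)) at_top sequentially"
    and e: "(\<lambda>j. Y j /\<^sub>R norm (Y j)) \<longlonglongrightarrow> e" and Y0: "\<And>j. Y j \<noteq> 0" and L: "\<And>j. 0 \<le> L j"
  shows "epi_converges (\<lambda>j. restr (\<lambda>x. ereal (Y j \<bullet> x)) (cylinder (Y j /\<^sub>R norm (Y j)) (L j)))
    (restr (\<lambda>x. ereal (0 \<bullet> x)) (cylinder e 0))"
proof -
  define E where "E j = Y j /\<^sub>R norm (Y j)" for j
  have E: "norm (E j) = 1" for j using Y0 by (simp add: E_def)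
  have YE: "Y j = norm (Y j) *\<^sub>R E j" for j using Y0 by (simp add: E_def)
  have Elim: "E \<longlonglongrightarrow> e" using e by (simp add: E_def[abs_def])
  have Yx: "Y j \<bullet> x = norm (Y j) * (x \<bullet> E j)" for j x using YE[of j] by (metis inner_commute inner_scaleR_right)
  have "epi_converges (\<lambda>j. restr (\<lambda>x. ereal (Y j \<bullet> x)) (cylinder (E j) (L j))) (restr (\<lambda>x. ereal (0 \<bullet> x)) (cylinder e 0))"
  proof (rule epi_converges_const)
    fix x :: 'a and X c assume X: "X \<longlonglongrightarrow> x" and c: "c < restr (\<lambda>x. ereal (0 \<bullet> x)) (cylinder e 0) x"
    have XE: "(\<lambda>j. X j \<bullet> E j) \<longlonglongrightarrow> x \<bullet> e" by (intro tendsto_intros X Elim)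
    have cinf: "c < \<infinity>" using c by auto
    show "\<forall>\<^sub>F j in sequentially. c < restr (\<lambda>x. ereal (Y j \<bullet> x)) (cylinder (E j) (L j)) (X j)"
    proof (cases "x \<in> cylinder e 0")
      case True
      then have "c < 0" using c by (simp add: restr_def zero_ereal_def)
      moreover have "0 \<le> restr (\<lambda>x. ereal (Y j \<bullet> x)) (cylinder (E j) (L j)) (X j)" for j
        by (auto simp: restr_def Yx cylinder_def)
      ultimately show ?thesis by (auto intro: always_eventually less_le_trans)
    next
      case False
      consider "x \<bullet> e < 0" | "0 < x \<bullet> e" | "1 < norm (x - (x \<bullet> e) *\<^sub>R e)"
        using False by (force simp: cylinder_def)
      then show ?thesis
      proof cases
        case 1
        from order_tendstoD(2)[OF XE this] show ?thesis
          by eventually_elim (use cinf in \<open>auto simp: restr_def cylinder_def\<close>)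
      next
        case 2
        obtain b where b: "c < ereal b" using cinf ereal_dense2 by blast
        define \<delta> where "\<delta> = x \<bullet> e / 2"
        have \<delta>: "0 < \<delta>" "\<delta> < x \<bullet> e" using 2 by (auto simp: \<delta>_def)
        have "\<forall>\<^sub>F j in sequentially. \<bar>b\<bar> / \<delta> < norm (Y j)" using Y by (simp add: filterlim_at_top_dense)
        then show ?thesis using order_tendstoD(1)[OF XE \<delta>(2)]
        proof eventually_elim
          case (elim j)
          have "b \<le> \<bar>b\<bar> / \<delta> * \<delta>" using \<delta> by simp
          also have "\<dots> \<le> norm (Y j) * (X j \<bullet> E j)" using elim \<delta> by (intro mult_mono) auto
          finally have "ereal b \<le> ereal (Y j \<bullet> X j)" by (simp add: Yx)
          with b have "c < ereal (Y j \<bullet> X j)" by (rule less_le_trans)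
          then show ?case using cinf by (auto simp: restr_def)
        qed
      next
        case 3
        have "(\<lambda>j. norm (X j - (X j \<bullet> E j) *\<^sub>R E j)) \<longlonglongrightarrow> norm (x - (x \<bullet> e) *\<^sub>R e)"
          by (intro tendsto_intros X Elim)
        from order_tendstoD(1)[OF this 3] show ?thesis
          by eventually_elim (use cinf in \<open>auto simp: restr_def cylinder_def\<close>)
      qed
    qed
  next
    fix x :: 'a assume "restr (\<lambda>x. ereal (0 \<bullet> x)) (cylinder e 0) x < \<infinity>"
    then have x: "x \<in> cylinder e 0" by (auto simp: restr_def split: if_splits)
    then have xe: "x \<bullet> e = 0" "norm x \<le> 1" by (auto simp: cylinder_def)
    define X where "X j = x - (x \<bullet> E j) *\<^sub>R E j" for j
    have EE: "E j \<bullet> E j = 1" for j using E[of j] by (simp add: dot_square_norm)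
    have XE: "X j \<bullet> E j = 0" for j by (simp add: X_def inner_diff_left EE)
    have XD: "X j \<in> cylinder (E j) (L j)" for j
      using norm_orthogonal_part[OF E, of x j] xe(2) L[of j] unfolding cylinder_def XE by (simp add: XE) (simp add: X_def)
    have "X \<longlonglongrightarrow> x - (x \<bullet> e) *\<^sub>R e" unfolding X_def by (intro tendsto_intros Elim)
    then have "X \<longlonglongrightarrow> x" by (simp add: xe)
    moreover have "restr (\<lambda>x. ereal (Y j \<bullet> x)) (cylinder (E j) (L j)) (X j) = restr (\<lambda>x. ereal (0 \<bullet> x)) (cylinder e 0) x" for j
      using XD x by (simp add: restr_def Yx XE)
    ultimately show "\<exists>X. X \<longlonglongrightarrow> x \<and> (\<forall>c>restr (\<lambda>x. ereal (0 \<bullet> x)) (cylinder e 0) x.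
        \<forall>\<^sub>F j in sequentially. restr (\<lambda>x. ereal (Y j \<bullet> x)) (cylinder (E j) (L j)) (X j) < c)"
      by (intro exI[of _ X]) simp
  qed
  then show ?thesis by (simp add: E_def)
qed

text \<open>Stated for any \<open>\<phi>\<close> so as to serve both for \<open>\<zeta>\<close> and
  for a density on the sphere composed with \<open>lower_normal\<close>.\<close>

lemma integral_grad_linear:
  fixes A :: "'a::euclidean_space set" and \<phi> :: "'a \<Rightarrow> real" and y :: 'a
  assumes A: "compact A" "convex A" "A \<noteq> {}"
  defines "v \<equiv> restr (\<lambda>x. ereal (y \<bullet> x)) A"
  shows "(LINT x|lebesgue. indicator (edom v) x * \<phi> (grad v x)) = \<phi> y * measure lebesgue A"
proof -
  have v: "v \<in> Conv_cd" unfolding v_def by (rule linear_Conv_cd[OF A])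
  have ed: "edom v = A" by (auto simp: edom_def restr_def v_def)
  have f: "fin v x = y \<bullet> x" if "x \<in> A" for x using that by (simp add: restr_def v_def)
  have AE: "AE x in lebesgue. indicator A x * \<phi> y = indicator (edom v) x * \<phi> (grad v x)"
    using AE_differentiable[OF v]
  proof eventually_elim
    case (elim x)
    show ?case
    proof (cases "x \<in> A")
      case True
      then have x: "x \<in> interior A" using elim by (auto simp: ed)
      have "((\<lambda>x. y \<bullet> x) has_derivative (\<lambda>h. h \<bullet> y)) (at x)"
        by (auto intro!: derivative_eq_intros simp: inner_commute)
      then have "(fin v has_derivative (\<lambda>h. h \<bullet> y)) (at x)"
        by (rule has_derivative_transform_within_open[OF _ open_interior x]) (use f interior_subset in force)
      then have "grad v x = y" by (intro grad_eq) (simp add: gderiv_def)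
      then show ?thesis by (simp add: ed)
    qed (simp add: ed)
  qed
  \<comment> \<open>The integrand with the gradient inherits measurability from this one, with which
    it agrees almost everywhere.\<close>
  have m: "(\<lambda>x. indicator A x * \<phi> y) \<in> borel_measurable lebesgue"
    using lmeasurable_compact[OF A(1)] by (intro borel_measurable_times borel_measurable_indicator) auto
  have "(LINT x|lebesgue. indicator A x * \<phi> y) = (LINT x|lebesgue. indicator (edom v) x * \<phi> (grad v x))"
    by (rule integral_cong_AE[OF m borel_measurable_AE[OF m AE] AE])
  then show ?thesis using lmeasurable_compact[OF A(1)] by (simp add: mult.commute)
qed

context epi_valuation
begin

lemma linear_representation:
  assumes A: "compact A" "convex A" "A \<noteq> {}"
  shows "Z (restr (\<lambda>x. ereal (y \<bullet> x)) A) = \<zeta> y * measure lebesgue A"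
proof -
  let ?v = "restr (\<lambda>x. ereal (y \<bullet> x)) A"
  have ed: "edom ?v = A" by (auto simp: edom_def restr_def)
  have "Z ?v = (LINT x|lebesgue. indicator (edom ?v) x * \<zeta> (grad ?v x))"
  proof (rule lipschitz_representation(2)[OF linear_Conv_cd[OF A]])
    fix a b assume "a \<in> edom ?v" "b \<in> edom ?v"
    then have "a \<in> A" "b \<in> A" by (simp_all add: ed)
    then have "fin ?v a - fin ?v b = y \<bullet> (a - b)" by (simp add: restr_def inner_diff_right)
    also have "\<dots> \<le> norm y * dist a b" unfolding dist_norm by (rule norm_cauchy_schwarz)
    finally show "fin ?v a \<le> fin ?v b + norm y * dist a b" by simp
  qed
  then show ?thesis by (simp only: integral_grad_linear[OF A])
qed

lemma zeta_support: "\<exists>R. \<forall>y. R < norm y \<longrightarrow> \<zeta> y = 0"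
proof (rule ccontr)
  assume "\<not> ?thesis"
  then have "\<forall>k::nat. \<exists>y. real k < norm y \<and> \<zeta> y \<noteq> 0" by blast
  then obtain Y where Y: "\<And>k. real k < norm (Y k)" "\<And>k. \<zeta> (Y k) \<noteq> 0" by metis
  have Y0: "Y k \<noteq> 0" for k using Y(1)[of k] by auto
  define E where "E k = Y k /\<^sub>R norm (Y k)" for k
  have E: "norm (E k) = 1" for k using Y0 by (simp add: E_def)
  obtain e r where e: "norm e = 1" "strict_mono r" "(E \<circ> r) \<longlonglongrightarrow> e"
    by (rule seq_compactE[OF compact_imp_seq_compact[OF compact_sphere], of E 0 1]) (use E in auto)
  \<comment> \<open>A length of at least \<open>1 / \<bar>\<zeta> (Y k)\<bar>\<close> keeps the
    values of \<open>Z\<close> above \<open>V\<close> in modulus, however small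
    \<open>\<zeta> (Y k)\<close> is.\<close>
  have "\<forall>k. \<exists>n::nat. 1 / \<bar>\<zeta> (Y k)\<bar> \<le> real n" using real_arch_simple by blast
  then obtain n where n: "\<And>k. 1 / \<bar>\<zeta> (Y k)\<bar> \<le> real (n k)" by metis
  define V where "V = measure lebesgue (ball (0::'a) (1/2))"
  have V: "0 < V" by (simp add: V_def content_ball_pos)
  let ?U = "\<lambda>k. restr (\<lambda>x. ereal (Y k \<bullet> x)) (cylinder (E k) (real (n k)))"
  have ZU: "V \<le> \<bar>Z (?U k)\<bar>" for k
  proof -
    have "V \<le> \<bar>\<zeta> (Y k)\<bar> * (real (n k) * V)"
      using n[of k] Y(2)[of k] V by (simp add: field_simps)
    also have "\<dots> \<le> \<bar>\<zeta> (Y k)\<bar> * measure lebesgue (cylinder (E k) (real (n k)))"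
      unfolding V_def by (intro mult_left_mono measure_cylinder_ge E) simp
    also have "\<dots> = \<bar>Z (?U k)\<bar>"
      by (subst linear_representation) (use E in \<open>auto simp: cylinder abs_mult\<close>)
    finally show ?thesis .
  qed
  have top: "filterlim (\<lambda>j. norm (Y (r j))) at_top sequentially"
  proof (rule filterlim_at_top_mono[OF filterlim_real_sequentially])
    show "\<forall>\<^sub>F j in sequentially. real j \<le> norm (Y (r j))"
    proof (intro always_eventually allI)
      fix j
      have "real j \<le> real (r j)" using e(2) by (simp add: seq_suble)
      then show "real j \<le> norm (Y (r j))" using Y(1)[of "r j"] by linarith
    qed
  qed
  have "epi_converges (\<lambda>j. ?U (r j)) (restr (\<lambda>x. ereal (0 \<bullet> x)) (cylinder e 0))"
    unfolding E_def by (rule epi_converges_cylinder[OF top]) (use e Y0 in \<open>auto simp: E_def[abs_def] o_def\<close>)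
  then have "(\<lambda>j. Z (?U (r j))) \<longlonglongrightarrow> Z (restr (\<lambda>x. ereal (0 \<bullet> x)) (cylinder e 0))"
    using E e(1) by (intro epi_continuous_eventually[OF continuous] always_eventually allI linear_Conv_cd cylinder) auto
  moreover have "Z (restr (\<lambda>x. ereal (0 \<bullet> x)) (cylinder e 0)) = 0"
  proof -
    have "negligible {x. e \<bullet> x = 0}" using e(1) by (intro negligible_hyperplane) auto
    then have "negligible (cylinder e 0)" by (rule negligible_subset) (auto simp: cylinder_def inner_commute)
    then show ?thesis using e(1) by (subst linear_representation) (auto simp: cylinder negligible_imp_measure0)
  qed
  ultimately have "(\<lambda>j. \<bar>Z (?U (r j))\<bar>) \<longlonglongrightarrow> 0" using tendsto_rabs_zero by metis
  then have "V \<le> 0" by (rule LIMSEQ_le_const) (use ZU in auto)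
  then show False using V by simp
qed

lemma zeta_bounded: obtains B where "\<And>y. \<bar>\<zeta> y\<bar> \<le> B"
proof -
  obtain R where R: "\<And>y. R < norm y \<Longrightarrow> \<zeta> y = 0" using zeta_support by blast
  have "bounded (\<zeta> ` cball 0 R)"
    by (intro compact_imp_bounded compact_continuous_image continuous_on_subset[OF continuous_on_zeta]) auto
  then obtain B where B: "\<forall>t\<in>\<zeta> ` cball 0 R. norm t \<le> B" unfolding bounded_iff by blast
  have "\<bar>\<zeta> y\<bar> \<le> max B 0" for y
  proof (cases "norm y \<le> R")
    case True
    then show ?thesis using B by force
  next
    case False
    then show ?thesis using R[of y] by simp
  qed
  then show ?thesis by (rule that)
qed

text \<open>\<open>w k\<close> is the infimal convolution of \<open>u\<close> with \<open>k\<close>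
  times the norm. Where \<open>u\<close> and \<open>w k\<close> are differentiable and the gradient
  of \<open>u\<close> has norm at most \<open>k\<close>, the two functions agree at the point, by
  the tangent plane inequality; as \<open>w k\<close> stays below \<open>u\<close>, their difference
  has an extremum there and the gradients agree. Hence the integrands are eventually constant at
  almost every point.\<close>

theorem representation:
  assumes u: "u \<in> Conv_cd"
  shows "Z u = (LINT x|lebesgue. indicator (edom u) x * \<zeta> (grad u x))"
proof -
  let ?D = "edom u" and ?f = "fin u"
  note D = Conv_cdD(5,2)[OF u] convex_edom[OF u]
  have Dcl: "closed ?D" using D(1) by (rule compact_imp_closed)
  note cvx = convex_on_fin[OF u]
  obtain m where m: "\<And>x. ereal m \<le> u x" using Conv_cd_bdd_below[OF u] by blast
  have fm: "m \<le> ?f x" if "x \<in> ?D" for x using m[of x] fin_eq[OF u that] by (metis ereal_less_eq(3))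
  define w where "w k x = (INF y\<in>?D. ?f y + real k * dist x y)" for k x
  have low: "m \<le> ?f y + real k * dist x y" if "y \<in> ?D" for k x y
    using fm[OF that] by (simp add: add_increasing2)
  have bdd: "bdd_below ((\<lambda>y. ?f y + real k * dist x y) ` ?D)" for k x
    by (rule bdd_belowI2[OF low])
  have w_le: "w k x \<le> ?f y + real k * dist x y" if "y \<in> ?D" for k x y
    unfolding w_def by (rule cINF_lower[OF bdd that])
  have w_ge: "c \<le> w k x" if "\<And>y. y \<in> ?D \<Longrightarrow> c \<le> ?f y + real k * dist x y" for c k x
    unfolding w_def by (rule cINF_greatest[OF D(2) that])
  have w_f: "w k x \<le> ?f x" if "x \<in> ?D" for k x using w_le[OF that, of k x] by simp
  have w_lip: "w k x \<le> w k x' + real k * dist x x'" for k x x'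
  proof -
    have "w k x - real k * dist x x' \<le> w k x'"
    proof (rule w_ge)
      fix y assume y: "y \<in> ?D"
      have "real k * dist x y \<le> real k * (dist x x' + dist x' y)" by (intro mult_left_mono dist_triangle) simp
      then show "w k x - real k * dist x x' \<le> ?f y + real k * dist x' y"
        using w_le[OF y, of k x] by (simp add: distrib_left)
    qed
    then show ?thesis by simp
  qed
  have w_convex: "convex_on ?D (w k)" for k
  proof (rule convex_onI[OF _ D(3)])
    fix t x x' assume t: "0 < t" "t < (1::real)" and "x \<in> ?D" "x' \<in> ?D"
    let ?z = "(1 - t) *\<^sub>R x + t *\<^sub>R x'"
    have w_near: "\<exists>y\<in>?D. ?f y + real k * dist x y < w k x + e" if "0 < e" for e x
    proof -
      have "(INF y\<in>?D. ?f y + real k * dist x y) < w k x + e" using that by (simp add: w_def)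
      then show ?thesis by (subst (asm) cINF_less_iff[OF D(2) bdd])
    qed
    show "w k ?z \<le> (1 - t) * w k x + t * w k x'"
    proof (rule field_le_epsilon)
      fix e :: real assume e: "0 < e"
      obtain y y' where y: "y \<in> ?D" "?f y + real k * dist x y < w k x + e" "y' \<in> ?D" "?f y' + real k * dist x' y' < w k x' + e"
        using w_near[OF e] by metis
      let ?y = "(1 - t) *\<^sub>R y + t *\<^sub>R y'"
      have "?y \<in> ?D" using y t D(3) by (simp add: convexD_alt)
      then have "w k ?z \<le> ?f ?y + real k * dist ?z ?y" by (rule w_le)
      also have "?f ?y \<le> (1 - t) * ?f y + t * ?f y'" using t y by (intro convex_onD[OF cvx]) auto
      also have "dist ?z ?y = norm ((1 - t) *\<^sub>R (x - y) + t *\<^sub>R (x' - y'))" by (simp add: dist_norm algebra_simps)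
      also have "\<dots> \<le> (1 - t) * dist x y + t * dist x' y'"
        using norm_triangle_ineq[of "(1 - t) *\<^sub>R (x - y)" "t *\<^sub>R (x' - y')"] t by (simp add: dist_norm)
      finally have "w k ?z \<le> (1 - t) * ?f y + t * ?f y' + real k * ((1 - t) * dist x y + t * dist x' y')"
        by (simp add: mult_left_mono)
      also have "\<dots> = (1 - t) * (?f y + real k * dist x y) + t * (?f y' + real k * dist x' y')"
        by (simp add: algebra_simps)
      also have "\<dots> \<le> (1 - t) * (w k x + e) + t * (w k x' + e)"
        using t y by (intro add_mono[OF mult_left_mono mult_left_mono]) auto
      finally show "w k ?z \<le> (1 - t) * w k x + t * w k x' + e" by (simp add: algebra_simps)
    qed
  qed
  have w_cont: "continuous_on ?D (w k)" for k
  proof (rule lipschitz_on_continuous_on)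
    show "(real k)-lipschitz_on ?D (w k)"
    proof (rule lipschitz_onI)
      fix x y
      show "dist (w k x) (w k y) \<le> real k * dist x y"
        using w_lip[of k x y] w_lip[of k y x] by (simp add: dist_real_def abs_le_iff dist_commute)
    qed simp
  qed
  define U where "U k = restr (\<lambda>x. ereal (w k x)) ?D" for k
  have U: "U k \<in> Conv_cd" for k unfolding U_def by (rule restr_real_Conv_cd[OF D(1,3,2) w_convex w_cont])
  have edU: "edom (U k) = ?D" for k by (auto simp: edom_def U_def restr_def)
  have fU: "fin (U k) x = w k x" if "x \<in> ?D" for k x using that by (simp add: U_def restr_def)
  have rep: "Z (U k) = (LINT x|lebesgue. indicator ?D x * \<zeta> (grad (U k) x))"
    and int: "integrable lebesgue (\<lambda>x. indicator ?D x * \<zeta> (grad (U k) x))" for k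
    using lipschitz_representation[OF U, of k "real k"] w_lip fU by (auto simp: edU)
  obtain B where B: "\<And>y. \<bar>\<zeta> y\<bar> \<le> B" using zeta_bounded by blast
  have "epi_converges U u"
  proof (rule epi_converges_const)
    fix x :: 'a and X c assume X: "X \<longlonglongrightarrow> x" and c: "c < u x"
    have cinf: "c < \<infinity>" using c by auto
    show "\<forall>\<^sub>F j in sequentially. c < U j (X j)"
    proof (cases "x \<in> ?D")
      case False
      then have "\<forall>\<^sub>F j in sequentially. X j \<in> - ?D" using Dcl by (intro topological_tendstoD[OF X]) auto
      then show ?thesis by eventually_elim (use cinf in \<open>simp add: U_def restr_def\<close>)
    next
      case True
      \<comment> \<open>Points near \<open>x\<close> have values above \<open>b\<close> by lower
        semicontinuity; points further away are penalised by at least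
        \<open>j * (\<delta> / 2)\<close>, which exceeds \<open>b - m\<close> for large
        \<open>j\<close>.\<close>
      obtain b where b: "c < ereal b" "ereal b < u x" using ereal_dense2[OF c] by blast
      have "\<forall>\<^sub>F y in nhds x. ereal b < u y" using b(2) Conv_cdD(4)[OF u] by (simp add: lower_semicont_iff)
      then obtain \<delta> where \<delta>: "0 < \<delta>" "\<And>y. dist y x < \<delta> \<Longrightarrow> ereal b < u y"
        unfolding eventually_nhds_metric by blast
      have "\<forall>\<^sub>F j in sequentially. dist (X j) x < \<delta> / 2" using X \<delta>(1) by (intro tendstoD) auto
      moreover have "\<forall>\<^sub>F j in sequentially. (b - m) / (\<delta> / 2) < real j"
        using filterlim_real_sequentially by (simp add: filterlim_at_top_dense)
      ultimately show ?thesis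
      proof eventually_elim
        case (elim j)
        have "b \<le> w j (X j)"
        proof (rule w_ge)
          fix y assume y: "y \<in> ?D"
          show "b \<le> ?f y + real j * dist (X j) y"
          proof (cases "dist y x < \<delta>")
            case True
            then have "b < ?f y" using \<delta>(2) fin_eq[OF u y] by (metis ereal_less(2) less_ereal.simps(1))
            moreover have "0 \<le> real j * dist (X j) y" by simp
            ultimately show ?thesis by linarith
          next
            case False
            have "\<delta> / 2 \<le> dist (X j) y" using False elim(1) dist_triangle[of y x "X j"] by (simp add: dist_commute)
            then have "real j * (\<delta> / 2) \<le> real j * dist (X j) y" by (rule mult_left_mono) simp
            moreover have "b - m < real j * (\<delta> / 2)" using elim(2) \<delta>(1) by (simp add: pos_divide_less_eq)
            ultimately show ?thesis using fm[OF y] by linarith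
          qed
        qed
        then have "ereal b \<le> ereal (w j (X j))" by simp
        with b(1) have "c < ereal (w j (X j))" by (rule less_le_trans)
        then show ?case using cinf by (auto simp: U_def restr_def)
      qed
    qed
  next
    fix x assume "u x < \<infinity>"
    then have x: "x \<in> ?D" by (simp add: edom_def)
    have "U j x \<le> u x" for j using w_f[OF x, of j] fin_eq[OF u x] x by (simp add: U_def restr_def) (metis ereal_less_eq(3))
    then have "U j x < c" if "u x < c" for j c using that by (rule le_less_trans)
    then show "\<exists>X. X \<longlonglongrightarrow> x \<and> (\<forall>c>u x. \<forall>\<^sub>F j in sequentially. U j (X j) < c)"
      by (intro exI[of _ "\<lambda>_. x"]) simp
  qed
  then have "(\<lambda>k. Z (U k)) \<longlonglongrightarrow> Z u"
    by (intro epi_continuous_eventually[OF continuous] always_eventually allI U u)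
  moreover have "(\<lambda>k. Z (U k)) \<longlonglongrightarrow> (LINT x|lebesgue. indicator ?D x * \<zeta> (grad u x))"
    unfolding rep
  proof (rule lebesgue_dominated_convergence(2))
    show "integrable lebesgue (\<lambda>x. indicator ?D x * B)"
      using lmeasurable_compact[OF D(1)] by (intro integrable_mult_left) (auto simp: integrable_indicator_iff fmeasurable_def)
    show "AE x in lebesgue. norm (indicator ?D x * \<zeta> (grad (U k) x)) \<le> indicator ?D x * B" for k
      using B by (intro AE_I2) (auto simp: indicator_def)
    show "(\<lambda>x. indicator ?D x * \<zeta> (grad (U k) x)) \<in> borel_measurable lebesgue" for k using int by auto
    have "AE x in lebesgue. \<forall>k. x \<notin> edom (U k) \<or> (x \<in> interior (edom (U k)) \<and> GDERIV (fin (U k)) x :> grad (U k) x)"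
      unfolding AE_all_countable using AE_differentiable[OF U] by blast
    with AE_differentiable[OF u]
    show "AE x in lebesgue. (\<lambda>k. indicator ?D x * \<zeta> (grad (U k) x)) \<longlonglongrightarrow> indicator ?D x * \<zeta> (grad u x)"
    proof eventually_elim
      case (elim x)
      show ?case
      proof (cases "x \<in> ?D")
        case True
        then have x: "x \<in> interior ?D" and du: "GDERIV ?f x :> grad u x"
          and dU: "\<And>k. GDERIV (fin (U k)) x :> grad (U k) x" using elim by (auto simp: edU)
        have "grad (U k) x = grad u x" if k: "norm (grad u x) \<le> real k" for k
        proof -
          have "?f x \<le> w k x"
          proof (rule w_ge)
            fix y assume y: "y \<in> ?D"
            have "- (grad u x \<bullet> (y - x)) \<le> norm (grad u x) * norm (y - x)"
              using norm_cauchy_schwarz[of "- grad u x" "y - x"] by simp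
            also have "\<dots> \<le> real k * dist x y" unfolding dist_norm norm_minus_commute[of x y] using k by (rule mult_right_mono) simp
            finally show "?f x \<le> ?f y + real k * dist x y"
              using convex_on_above_tangent_plane[OF cvx True y du] by linarith
          qed
          then have eq: "w k x = ?f x" using w_f[OF True, of k] by simp
          have "((\<lambda>y. ?f y - fin (U k) y) has_derivative (\<lambda>h. h \<bullet> grad u x - h \<bullet> grad (U k) x)) (at x)"
            using du dU[of k] unfolding gderiv_def by (rule has_derivative_diff)
          from differential_zero_maxmin[OF x open_interior this]
          have "(\<lambda>h. h \<bullet> grad u x - h \<bullet> grad (U k) x) = (\<lambda>v. 0)"
          proof
            show "(\<forall>y\<in>interior ?D. ?f y - fin (U k) y \<le> ?f x - fin (U k) x) \<or>
              (\<forall>y\<in>interior ?D. ?f x - fin (U k) x \<le> ?f y - fin (U k) y)"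
              using w_f eq True interior_subset[of ?D] by (auto simp: fU subset_iff)
          qed (rule refl)
          from fun_cong[OF this, of "grad u x - grad (U k) x"]
          have "(grad u x - grad (U k) x) \<bullet> (grad u x - grad (U k) x) = 0" by (simp add: inner_diff_right)
          then show ?thesis by simp
        qed
        moreover obtain k0 :: nat where "norm (grad u x) \<le> real k0" using real_arch_simple by blast
        ultimately have "\<forall>\<^sub>F k in sequentially. indicator ?D x * \<zeta> (grad (U k) x) = indicator ?D x * \<zeta> (grad u x)"
          unfolding eventually_sequentially by (intro exI[of _ k0]) (auto intro: order_trans)
        then show ?thesis by (rule tendsto_eventually)
      qed simp
    qed
  qed
  ultimately show ?thesis by (rule LIMSEQ_unique)
qed

end

section \<open>Surface area measures of lower boundaries\<close>

text \<open>The outer unit normal of the epigraph at a point where the gradient is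
  \<open>y\<close>.\<close>

definition lower_normal :: "'a::euclidean_space \<Rightarrow> 'a \<times> real" where
  "lower_normal y = (y, -1) /\<^sub>R sqrt (1 + (norm y)\<^sup>2)"

lemma norm_lower_normal: "norm (lower_normal y) = 1"
proof -
  define r where "r = sqrt (1 + (norm y)\<^sup>2)"
  have "0 < 1 + (norm y)\<^sup>2" by (simp add: add_pos_nonneg)
  then have r: "0 < r" by (simp add: r_def)
  have "norm (y, -1::real) = r" by (simp add: r_def norm_Pair add.commute)
  then have "norm (lower_normal y) = \<bar>inverse r\<bar> * r"
    unfolding lower_normal_def r_def[symmetric] norm_scaleR by simp
  then show ?thesis using r by simp
qed

lemma norm_fst_snd: "norm (fst q) \<le> norm q" "norm (snd q) \<le> norm q"
  by (metis norm_fst_le prod.collapse) (metis norm_snd_le prod.collapse)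

text \<open>Compact support in the open half-sphere enters in the quantitative form
  \<open>snd v \<le> - c\<close>. It bounds the slopes that belong to the normals seen by
  \<open>\<eta>\<close> by \<open>1 / c\<close>.\<close>

locale lower_surface = convex_body K for K :: "('a::euclidean_space \<times> real) set" +
  fixes \<eta> :: "'a \<times> real \<Rightarrow> real" and c :: real
  assumes cont: "continuous_on (sphere 0 1) \<eta>" and c: "0 < c"
    and supp: "\<And>v. v \<in> sphere 0 1 \<Longrightarrow> \<eta> v \<noteq> 0 \<Longrightarrow> snd v \<le> - c"
begin

abbreviation "u \<equiv> \<lfloor>K\<rfloor>\<^sub>b"
abbreviation "f \<equiv> fin u"

lemma K: "K \<in> convex_bodies" using K_ne K_compact K_convex by (simp add: convex_bodies_def)

lemma u: "u \<in> Conv_cd" using K by (rule lower_boundary_Conv_cd)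

lemma graph_in: "x \<in> edom u \<Longrightarrow> (x, f x) \<in> K"
  using lower_boundary_attained[OF K, of x] by (auto simp: edom_def)

lemma K_above: "(x, t) \<in> K \<Longrightarrow> x \<in> edom u \<and> f x \<le> t"
proof
  assume xt: "(x, t) \<in> K"
  then show x: "x \<in> edom u" unfolding edom_lower_boundary[OF K] by force
  show "f x \<le> t" using lower_boundary_le[OF K xt] fin_eq[OF u x] by (metis ereal_less_eq(3))
qed

text \<open>A normal with negative last component supports the body from below. Dividing the
  supporting inequality by \<open>- snd (\<nu> q)\<close> exhibits \<open>a\<close> as a subgradient
  at the contact point, which has to lie on the graph.\<close>

lemma lower_contact:
  assumes q: "0 < d q" and s: "snd (\<nu> q) < 0"
  defines "a \<equiv> fst (\<nu> q) /\<^sub>R (- snd (\<nu> q))"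
  shows "fst (p q) \<in> edom u" "snd (p q) = f (fst (p q))"
    "\<And>y. y \<in> edom u \<Longrightarrow> f (fst (p q)) + a \<bullet> (y - fst (p q)) \<le> f y"
proof -
  have pK: "(fst (p q), snd (p q)) \<in> K" using p_in by simp
  show x': "fst (p q) \<in> edom u" using K_above[OF pK] by simp
  have ineq: "fst (\<nu> q) \<bullet> (y - fst (p q)) + snd (\<nu> q) * (f y - snd (p q)) \<le> 0" if "y \<in> edom u" for y
    using nu_dot[OF q graph_in[OF that]] by (simp add: inner_prod_def)
  show e: "snd (p q) = f (fst (p q))"
    using ineq[OF x'] K_above[OF pK] s by (simp add: mult_le_0_iff)
  show "f (fst (p q)) + a \<bullet> (y - fst (p q)) \<le> f y" if "y \<in> edom u" for y
    using ineq[OF that] s unfolding e a_def by (simp add: field_simps)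
qed

section \<open>Vertical fibers of the parallel set\<close>

definition \<Psi> :: "real \<Rightarrow> 'a \<times> real \<Rightarrow> real" where
  "\<Psi> \<rho> q = indicator (shell K 0 \<rho> UNIV) q * \<eta> (\<nu> q)"

lemma Psi_nonzero:
  assumes "\<Psi> \<rho> q \<noteq> 0"
  shows "0 < d q" "d q \<le> \<rho>" "snd (\<nu> q) \<le> - c"
proof -
  show d: "0 < d q" "d q \<le> \<rho>" using assms by (auto simp: \<Psi>_def shell_def indicator_def split: if_splits)
  show "snd (\<nu> q) \<le> - c" using assms norm_nu[OF d(1)] by (intro supp) (auto simp: \<Psi>_def)
qed

lemma eta_bounded: "\<exists>B\<ge>0. \<forall>v\<in>sphere 0 1. \<bar>\<eta> v\<bar> \<le> B"
proof -
  have "bounded (\<eta> ` sphere 0 1)" using cont by (intro compact_imp_bounded compact_continuous_image) auto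
  then obtain B where "\<forall>y\<in>\<eta> ` sphere 0 1. norm y \<le> B" unfolding bounded_iff by blast
  then show ?thesis by (intro exI[of _ "max B 0"]) (auto simp: le_max_iff_disj)
qed

lemma Psi_measurable: "\<Psi> \<rho> \<in> borel_measurable borel"
proof -
  have sh: "shell K 0 \<rho> UNIV \<in> sets borel" by (rule borel_shell) auto
  have "continuous_on (shell K 0 \<rho> UNIV) (\<lambda>q. \<eta> (\<nu> q))"
  proof (rule continuous_on_compose2[OF cont])
    show "continuous_on (shell K 0 \<rho> UNIV) \<nu>"
      by (rule continuous_on_subset[OF continuous_on_nu]) (auto simp: shell_eq d_pos_iff[symmetric])
    show "\<nu> ` shell K 0 \<rho> UNIV \<subseteq> sphere 0 1" using norm_nu by (auto simp: shell_eq)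
  qed
  from borel_measurable_continuous_on_indicator[OF sh this] show ?thesis
    by (simp add: \<Psi>_def[abs_def])
qed

lemma Psi_bound:
  assumes B: "\<forall>v\<in>sphere 0 1. \<bar>\<eta> v\<bar> \<le> B" "0 \<le> B"
  shows "\<bar>\<Psi> \<rho> q\<bar> \<le> B * indicator (shell K 0 \<rho> UNIV) q"
proof (cases "q \<in> shell K 0 \<rho> UNIV")
  case True
  then have "0 < d q" by (simp add: shell_def)
  then show ?thesis using True B(1) norm_nu[of q] by (simp add: \<Psi>_def)
qed (simp add: \<Psi>_def)

lemma Psi_integrable: "integrable lborel (\<Psi> \<rho>)"
proof -
  obtain B where B: "0 \<le> B" "\<forall>v\<in>sphere 0 1. \<bar>\<eta> v\<bar> \<le> B" using eta_bounded by blast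
  have "integrable lborel (\<lambda>q. B * indicator (shell K 0 \<rho> UNIV) q)"
    using borel_shell[of UNIV 0 \<rho>] shell_finite[of 0 \<rho> UNIV]
    by (intro integrable_mult_right integrable_real_indicator) auto
  then show ?thesis
    by (rule Bochner_Integration.integrable_bound)
      (use Psi_measurable Psi_bound[OF B(2,1)] in \<open>auto intro!: AE_I2 intro: order_trans[OF _ abs_ge_self]\<close>)
qed

lemma fst_contact_near: "norm (x - fst (p (x, t))) \<le> d (x, t)"
  unfolding d_eq using norm_fst_snd(1)[of "(x, t) - p (x, t)"] by simp

lemma snd_contact_near: "\<bar>t - snd (p (x, t))\<bar> \<le> d (x, t)"
  unfolding d_eq using norm_fst_snd(2)[of "(x, t) - p (x, t)"] by simp

text \<open>Both contact points lie within \<open>\<rho>\<close> of the vertical line, and the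
  subgradient at the first has norm at most \<open>1 / c\<close>. So the first exceeds the second in
  height by at most \<open>2 * \<rho> / c\<close>, and another \<open>2 * \<rho>\<close> accounts
  for the vertical distances to the contact points.\<close>

lemma Psi_fiber_width:
  assumes "\<Psi> \<rho> (x, t) \<noteq> 0" "\<Psi> \<rho> (x, t') \<noteq> 0"
  shows "t - t' \<le> (2 + 2 / c) * \<rho>"
proof -
  note q = Psi_nonzero[OF assms(1)] and q' = Psi_nonzero[OF assms(2)]
  have s: "snd (\<nu> (x, t)) < 0" "snd (\<nu> (x, t')) < 0" using q(3) q'(3) c by auto
  let ?y = "fst (p (x, t))" and ?y' = "fst (p (x, t'))"
  define a where "a = fst (\<nu> (x, t)) /\<^sub>R (- snd (\<nu> (x, t)))"
  have "norm (fst (\<nu> (x, t))) \<le> 1" using norm_fst_snd(1)[of "\<nu> (x, t)"] norm_nu[OF q(1)] by simp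
  then have "norm (fst (\<nu> (x, t))) / (- snd (\<nu> (x, t))) \<le> 1 / c"
    using q(3) c by (intro frac_le) auto
  then have "norm a \<le> 1 / c" using s(1) by (simp add: a_def divide_inverse mult.commute)
  have "norm (?y' - ?y) \<le> 2 * \<rho>"
    using norm_triangle_ineq4[of "x - ?y" "x - ?y'"] fst_contact_near[of x t] fst_contact_near[of x t'] q(2) q'(2) by simp
  then have "norm a * norm (?y' - ?y) \<le> (1 / c) * (2 * \<rho>)"
    using \<open>norm a \<le> 1 / c\<close> c by (intro mult_mono) auto
  then have "- (a \<bullet> (?y' - ?y)) \<le> 2 * \<rho> / c"
    using norm_cauchy_schwarz[of "- a" "?y' - ?y"] by simp
  moreover have "f ?y + a \<bullet> (?y' - ?y) \<le> f ?y'"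
    unfolding a_def by (rule lower_contact(3)[OF q(1) s(1) lower_contact(1)[OF q'(1) s(2)]])
  moreover have "t - f ?y \<le> \<rho>" "f ?y' - t' \<le> \<rho>"
    using snd_contact_near[of t x] snd_contact_near[of t' x] q(2) q'(2)
      lower_contact(2)[OF q(1) s(1)] lower_contact(2)[OF q'(1) s(2)] by auto
  ultimately have "t - t' \<le> 2 * \<rho> + 2 * \<rho> / c" by linarith
  then show ?thesis by (simp add: algebra_simps)
qed

text \<open>The bound is linear in \<open>\<rho>\<close> and uniform in \<open>x\<close>, inside and
  outside of the domain, so it dominates the fiber integrals after division by
  \<open>\<rho>\<close>.\<close>

lemma fiber_integral_bound:
  assumes B: "\<forall>v\<in>sphere 0 1. \<bar>\<eta> v\<bar> \<le> B" "0 \<le> B" and \<rho>: "0 < \<rho>"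
  shows "\<bar>LINT t|lborel. \<Psi> \<rho> (x, t)\<bar> \<le> B * (2 * ((2 + 2 / c) * \<rho>))"
proof (cases "\<exists>t0. \<Psi> \<rho> (x, t0) \<noteq> 0")
  case False
  then show ?thesis using B \<rho> c by simp
next
  case True
  then obtain t0 where t0: "\<Psi> \<rho> (x, t0) \<noteq> 0" by blast
  define w where "w = (2 + 2 / c) * \<rho>"
  have w: "0 \<le> w" using \<rho> c by (simp add: w_def)
  have bd: "\<bar>\<Psi> \<rho> (x, t)\<bar> \<le> B * indicator {t0 - w..t0 + w} t" for t
  proof (cases "\<Psi> \<rho> (x, t) = 0")
    case True
    then show ?thesis using B by simp
  next
    case False
    then have "t - t0 \<le> w" "t0 - t \<le> w" using Psi_fiber_width t0 unfolding w_def by blast+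
    moreover have "\<bar>\<Psi> \<rho> (x, t)\<bar> \<le> B" using Psi_bound[OF B, of \<rho> "(x, t)"] B(2)
      by (cases "(x, t) \<in> shell K 0 \<rho> UNIV") auto
    ultimately show ?thesis by (simp add: indicator_def)
  qed
  have m: "(\<lambda>t. \<Psi> \<rho> (x, t)) \<in> borel_measurable lborel"
  proof -
    have "(\<lambda>t. (x, t)) \<in> borel_measurable borel" by (intro borel_measurable_continuous_onI continuous_intros)
    from measurable_compose[OF this Psi_measurable] show ?thesis by simp
  qed
  have iw: "integrable lborel (\<lambda>t. B * indicator {t0 - w..t0 + w} t)"
    using w by (intro integrable_mult_right integrable_real_indicator) auto
  have i: "integrable lborel (\<lambda>t. \<Psi> \<rho> (x, t))"
    by (rule Bochner_Integration.integrable_bound[OF iw m])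
      (use bd in \<open>auto intro!: AE_I2 intro: order_trans[OF _ abs_ge_self]\<close>)
  have "\<bar>LINT t|lborel. \<Psi> \<rho> (x, t)\<bar> \<le> (LINT t|lborel. \<bar>\<Psi> \<rho> (x, t)\<bar>)"
    using integral_norm_bound[of lborel "\<lambda>t. \<Psi> \<rho> (x, t)"] by simp
  also have "\<dots> \<le> (LINT t|lborel. B * indicator {t0 - w..t0 + w} t)"
    using i by (intro integral_mono iw bd) simp
  also have "\<dots> = B * (2 * w)" using w by simp
  finally show ?thesis by (simp add: w_def)
qed


text \<open>A point outside of the body with a downward normal lies strictly below the supporting
  plane through its contact point, whereas the graph lies on or above this plane.\<close>

lemma Psi_above_graph:
  assumes x: "x \<in> edom u" and t: "f x \<le> t"
  shows "\<Psi> \<rho> (x, t) = 0"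
proof (rule ccontr)
  assume n: "\<Psi> \<rho> (x, t) \<noteq> 0"
  note q = Psi_nonzero[OF n]
  have s: "snd (\<nu> (x, t)) < 0" using q(3) c by simp
  let ?q = "(x, t)"
  define a where "a = fst (\<nu> ?q) /\<^sub>R (- snd (\<nu> ?q))"
  have "\<nu> ?q \<bullet> (?q - p ?q) = d ?q"
  proof -
    have "\<nu> ?q \<bullet> (?q - p ?q) = \<nu> ?q \<bullet> (d ?q *\<^sub>R \<nu> ?q)" using eq_p_plus[OF q(1)] by (metis add_diff_cancel_left')
    then show ?thesis using norm_nu[OF q(1)] by (simp add: dot_square_norm)
  qed
  then have "0 < fst (\<nu> ?q) \<bullet> (x - fst (p ?q)) + snd (\<nu> ?q) * (t - snd (p ?q))"
    using q(1) by (simp add: inner_prod_def)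
  then have "t - snd (p ?q) < a \<bullet> (x - fst (p ?q))" using s by (simp add: a_def field_simps)
  moreover have "f (fst (p ?q)) + a \<bullet> (x - fst (p ?q)) \<le> f x"
    unfolding a_def by (rule lower_contact(3)[OF q(1) s x])
  ultimately show False using lower_contact(2)[OF q(1) s] t by linarith
qed

section \<open>Blow-up at a point of differentiability\<close>

context
  fixes x0 y assumes x0: "x0 \<in> interior (edom u)" and y: "GDERIV f x0 :> y"
begin

text \<open>The ratio of vertical distance to distance from the tangent plane, and at the same time
  the area element of the graph.\<close>

definition "sl = sqrt (1 + (norm y)\<^sup>2)"

lemma sl: "0 < sl" "sl * sl = 1 + y \<bullet> y"
proof -
  have "0 < 1 + (norm y)\<^sup>2" by (simp add: add_pos_nonneg)
  then show "0 < sl" "sl * sl = 1 + y \<bullet> y" by (simp_all add: sl_def power2_norm_eq_inner)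
qed

lemma normal_eq: "lower_normal y = (y /\<^sub>R sl, - inverse sl)"
  by (simp add: lower_normal_def sl_def)

lemma x0_in: "x0 \<in> edom u" using x0 interior_subset by blast

lemma normal_dot: "q \<in> K \<Longrightarrow> lower_normal y \<bullet> (q - (x0, f x0)) \<le> 0"
proof -
  assume "q \<in> K"
  then have q: "fst q \<in> edom u" "f (fst q) \<le> snd q" using K_above[of "fst q" "snd q"] by auto
  have "f x0 + y \<bullet> (fst q - x0) \<le> snd q"
    using convex_on_above_tangent_plane[OF convex_on_fin[OF u] x0_in q(1) y] q(2) by linarith
  then have "(y \<bullet> (fst q - x0) - (snd q - f x0)) / sl \<le> 0"
    using sl(1) by (simp add: divide_nonpos_pos)
  then show ?thesis by (simp add: normal_eq inner_prod_def diff_divide_distrib divide_inverse algebra_simps)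
qed

text \<open>The body lies on one side of the tangent plane at \<open>(x0, f x0)\<close>, and the
  distance to this plane is \<open>s / sl\<close>.\<close>

lemma dist_below_ge:
  assumes "0 \<le> s"
  shows "s / sl \<le> d (x0, f x0 - s)"
proof -
  let ?q = "(x0, f x0 - s)"
  have "lower_normal y \<bullet> (?q - p ?q) \<le> norm (?q - p ?q)"
    using norm_cauchy_schwarz[of "lower_normal y" "?q - p ?q"] by (simp add: norm_lower_normal)
  moreover have "lower_normal y \<bullet> (?q - p ?q) = s / sl - lower_normal y \<bullet> (p ?q - (x0, f x0))"
    by (simp add: normal_eq inner_prod_def divide_inverse algebra_simps)
  ultimately show ?thesis using normal_dot[OF p_in, of ?q] unfolding d_eq by linarith
qed

text \<open>Seen from \<open>p0\<close> at scale \<open>\<rho> k\<close>, the point below the graph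
  is \<open>Q\<close>, and \<open>h\<close> is its foot on the tangent plane. The rescaled contact
  points \<open>w k\<close> lie on or beyond that plane, and they are no farther from
  \<open>Q\<close> than the rescaled graph points \<open>a k\<close>, which tend to \<open>h\<close>
  by differentiability. Pythagoras then forces \<open>w k\<close> towards \<open>h\<close>.\<close>

lemma blow_up_contact:
  assumes \<rho>: "\<rho> \<longlonglongrightarrow> 0" "\<And>k. 0 < \<rho> k" and \<tau>: "0 < \<tau>"
  shows "(\<lambda>k::nat. d (x0, f x0 - \<rho> k * \<tau>) / \<rho> k) \<longlonglongrightarrow> \<tau> / sl"
    "(\<lambda>k. \<nu> (x0, f x0 - \<rho> k * \<tau>)) \<longlonglongrightarrow> lower_normal y"
proof -
  let ?n = "lower_normal y"
  define p0 where "p0 = (x0, f x0)"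
  define q where "q k = (x0, f x0 - \<rho> k * \<tau>)" for k
  define Q where "Q = (0::'a, - \<tau>)"
  define h where "h = Q - (\<tau> / sl) *\<^sub>R ?n"
  define w where "w k = (p (q k) - p0) /\<^sub>R \<rho> k" for k
  define z where "z = fst h"
  define a where "a k = (z, (f (x0 + \<rho> k *\<^sub>R z) - f x0) / \<rho> k)" for k
  have qp: "q k = p0 + \<rho> k *\<^sub>R Q" for k by (simp add: q_def p0_def Q_def)
  have pw: "p (q k) = p0 + \<rho> k *\<^sub>R w k" for k using \<rho>(2)[of k] by (simp add: w_def)
  have qpd: "q k - p (q k) = \<rho> k *\<^sub>R (Q - w k)" for k unfolding pw by (simp add: qp scaleR_diff_right)
  have nQ: "?n \<bullet> Q = \<tau> / sl" by (simp add: normal_eq Q_def inner_prod_def divide_inverse)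
  have nn: "?n \<bullet> ?n = 1" using norm_lower_normal[of y] by (simp add: dot_square_norm)
  have nh: "?n \<bullet> h = 0" by (simp add: h_def inner_diff_right nQ nn)
  have nw: "?n \<bullet> w k \<le> 0" for k
    using normal_dot[OF p_in, of "q k"] \<rho>(2)[of k] by (simp add: w_def p0_def mult_nonneg_nonpos)
  have z: "z = - (\<tau> / (sl * sl)) *\<^sub>R y" by (simp add: z_def h_def Q_def normal_eq divide_inverse)
  have hz: "h = (z, y \<bullet> z)"
  proof -
    have "snd h = - \<tau> + \<tau> / (sl * sl)" by (simp add: h_def Q_def normal_eq divide_inverse)
    moreover have "y \<bullet> z = - (\<tau> / (sl * sl)) * (sl * sl - 1)" by (simp add: z sl(2))
    moreover have "- (\<tau> / (sl * sl)) * (sl * sl - 1) = - \<tau> + \<tau> / (sl * sl)"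
      using sl(1) by (simp add: field_simps)
    ultimately show ?thesis by (simp add: z_def prod_eq_iff)
  qed
  have rz: "(\<lambda>k. x0 + \<rho> k *\<^sub>R z) \<longlonglongrightarrow> x0"
    using tendsto_add[OF tendsto_const tendsto_scaleR[OF \<rho>(1) tendsto_const], of x0 z] by simp
  have ahlim: "a \<longlonglongrightarrow> h"
  proof -
    have "(\<lambda>k. (f (x0 + \<rho> k *\<^sub>R z) - f x0) / \<rho> k) \<longlonglongrightarrow> y \<bullet> z"
    proof (rule LIMSEQ_I)
      fix e :: real assume e: "0 < e"
      define e' where "e' = e / (norm z + 1)"
      have nz: "0 < norm z + 1" by (simp add: add_nonneg_pos)
      have e': "0 < e'" "e' * norm z < e" using e nz by (auto simp: e'_def field_simps)
      obtain \<delta> where \<delta>: "0 < \<delta>" "\<And>x. norm (x - x0) < \<delta> \<Longrightarrow> norm (f x - f x0 - (x - x0) \<bullet> y) \<le> e' * norm (x - x0)"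
        using y e'(1) unfolding gderiv_def has_derivative_at_alt by blast
      obtain N where N: "\<And>k. k \<ge> N \<Longrightarrow> norm (x0 + \<rho> k *\<^sub>R z - x0) < \<delta>"
        using LIMSEQ_D[OF rz \<delta>(1)] by blast
      show "\<exists>N. \<forall>k\<ge>N. norm ((f (x0 + \<rho> k *\<^sub>R z) - f x0) / \<rho> k - y \<bullet> z) < e"
      proof (intro exI[of _ N] allI impI)
        fix k assume "k \<ge> N"
        from \<delta>(2)[OF N[OF this]] have "\<bar>f (x0 + \<rho> k *\<^sub>R z) - f x0 - \<rho> k * (y \<bullet> z)\<bar> \<le> e' * (\<rho> k * norm z)"
          using \<rho>(2)[of k] by (simp add: inner_commute)
        moreover have "(f (x0 + \<rho> k *\<^sub>R z) - f x0) / \<rho> k - y \<bullet> z = (f (x0 + \<rho> k *\<^sub>R z) - f x0 - \<rho> k * (y \<bullet> z)) / \<rho> k"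
          using \<rho>(2)[of k] by (simp add: diff_divide_distrib)
        ultimately have "norm ((f (x0 + \<rho> k *\<^sub>R z) - f x0) / \<rho> k - y \<bullet> z) \<le> e' * norm z"
          using \<rho>(2)[of k] by (simp add: divide_le_eq mult_ac)
        then show "norm ((f (x0 + \<rho> k *\<^sub>R z) - f x0) / \<rho> k - y \<bullet> z) < e" using e'(2) by linarith
      qed
    qed
    then show ?thesis unfolding hz a_def by (intro tendsto_intros)
  qed
  have close: "\<forall>\<^sub>F k in sequentially. norm (w k - Q) \<le> norm (a k - Q)"
  proof -
    have "\<forall>\<^sub>F k in sequentially. x0 + \<rho> k *\<^sub>R z \<in> interior (edom u)"
      by (rule topological_tendstoD[OF rz open_interior x0])
    then show ?thesis
    proof eventually_elim
      case (elim k)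
      then have "x0 + \<rho> k *\<^sub>R z \<in> edom u" using interior_subset by blast
      from closest_point_le[OF K_closed graph_in[OF this], of "q k"]
      have "norm (q k - p (q k)) \<le> norm (q k - (x0 + \<rho> k *\<^sub>R z, f (x0 + \<rho> k *\<^sub>R z)))"
        by (simp add: dist_norm)
      moreover have "(x0 + \<rho> k *\<^sub>R z, f (x0 + \<rho> k *\<^sub>R z)) = p0 + \<rho> k *\<^sub>R a k"
        using \<rho>(2)[of k] by (simp add: p0_def a_def)
      then have "q k - (x0 + \<rho> k *\<^sub>R z, f (x0 + \<rho> k *\<^sub>R z)) = \<rho> k *\<^sub>R (Q - a k)"
        by (simp add: qp scaleR_diff_right)
      ultimately have "\<rho> k * norm (Q - w k) \<le> \<rho> k * norm (Q - a k)"
        using \<rho>(2)[of k] by (simp add: qpd)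
      then show ?case using \<rho>(2)[of k] by (simp add: norm_minus_commute)
    qed
  qed
  have near: "\<forall>\<^sub>F k in sequentially. (norm (w k - h))\<^sup>2 \<le> (norm (a k - Q))\<^sup>2 - (norm (h - Q))\<^sup>2"
    using close
  proof eventually_elim
    case (elim k)
    have "(w k - h) \<bullet> (h - Q) = - (\<tau> / sl) * (?n \<bullet> w k)"
    proof -
      have hQ: "h - Q = (- (\<tau> / sl)) *\<^sub>R ?n" by (simp add: h_def)
      have "(w k - h) \<bullet> (h - Q) = - (\<tau> / sl) * (?n \<bullet> (w k - h))"
        unfolding hQ inner_scaleR_right by (simp only: inner_commute)
      then show ?thesis by (simp only: inner_diff_right nh diff_zero)
    qed
    moreover have "0 \<le> - (\<tau> / sl) * (?n \<bullet> w k)" 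
    proof -
      have "\<tau> * (?n \<bullet> w k) / sl \<le> 0" using \<tau> sl(1) nw[of k] by (intro divide_nonpos_pos mult_nonneg_nonpos) auto
      then show ?thesis by simp
    qed
    moreover have "(norm (w k - Q))\<^sup>2 = (norm (w k - h))\<^sup>2 + 2 * ((w k - h) \<bullet> (h - Q)) + (norm (h - Q))\<^sup>2"
      unfolding power2_norm_eq_inner by (simp add: inner_diff_left inner_diff_right inner_commute)
    moreover have "(norm (w k - Q))\<^sup>2 \<le> (norm (a k - Q))\<^sup>2" using elim by (intro power_mono) auto
    ultimately show ?case by linarith
  qed
  have "(\<lambda>k. (norm (a k - Q))\<^sup>2 - (norm (h - Q))\<^sup>2) \<longlonglongrightarrow> (norm (h - Q))\<^sup>2 - (norm (h - Q))\<^sup>2"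
    by (intro tendsto_intros ahlim)
  then have "(\<lambda>k. (norm (w k - h))\<^sup>2) \<longlonglongrightarrow> 0"
    by (intro tendsto_sandwich[OF _ near tendsto_const]) auto
  then have "(\<lambda>k. sqrt ((norm (w k - h))\<^sup>2)) \<longlonglongrightarrow> sqrt 0" by (rule tendsto_real_sqrt)
  then have "(\<lambda>k. norm (w k - h)) \<longlonglongrightarrow> 0" by simp
  then have wh: "w \<longlonglongrightarrow> h" using LIM_zero_cancel tendsto_norm_zero_iff by blast
  have Qh: "Q - h = (\<tau> / sl) *\<^sub>R ?n" by (simp add: h_def)
  have nQh: "norm (Q - h) = \<tau> / sl" unfolding Qh using \<tau> sl(1) by (simp add: norm_lower_normal)
  have lim1: "(\<lambda>k. norm (Q - w k)) \<longlonglongrightarrow> \<tau> / sl"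
    unfolding nQh[symmetric] by (intro tendsto_intros wh)
  have dk: "d (q k) = \<rho> k * norm (Q - w k)" for k unfolding d_eq qpd using \<rho>(2)[of k] by simp
  show "(\<lambda>k. d (x0, f x0 - \<rho> k * \<tau>) / \<rho> k) \<longlonglongrightarrow> \<tau> / sl"
    unfolding q_def[symmetric] dk using lim1 \<rho>(2) by (simp add: less_imp_neq[symmetric])
  have nuk: "\<nu> (q k) = (Q - w k) /\<^sub>R norm (Q - w k)" for k
    unfolding \<nu>_def dk qpd using \<rho>(2)[of k] by simp
  have "(\<lambda>k. (Q - w k) /\<^sub>R norm (Q - w k)) \<longlonglongrightarrow> (Q - h) /\<^sub>R (\<tau> / sl)"
    using \<tau> sl(1) by (intro tendsto_intros wh lim1) auto
  moreover have "(Q - h) /\<^sub>R (\<tau> / sl) = ?n" unfolding Qh using \<tau> sl(1) by simp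
  ultimately show "(\<lambda>k. \<nu> (x0, f x0 - \<rho> k * \<tau>)) \<longlonglongrightarrow> ?n"
    unfolding q_def[symmetric] nuk by simp
qed

text \<open>With \<open>t = f x0 - \<rho> k * \<tau>\<close> the integrand tends to
  \<open>\<eta> (lower_normal y)\<close> for \<open>0 < \<tau> < sl\<close> and to 0 outside of this
  interval, as the distance to the body is asymptotically \<open>\<rho> k * \<tau> / sl\<close>. The
  factor \<open>sl\<close> is the length of the interval.\<close>

lemma fiber_integral_tendsto:
  "(\<lambda>k. (LINT t|lborel. \<Psi> (1 / Suc k) (x0, t)) * Suc k) \<longlonglongrightarrow> \<eta> (lower_normal y) * sl"
proof -
  define \<rho> where "\<rho> k = 1 / real (Suc k)" for k
  have \<rho>: "\<rho> \<longlonglongrightarrow> 0" "0 < \<rho> k" for k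
    unfolding \<rho>_def using LIMSEQ_inverse_real_of_nat by (simp_all add: inverse_eq_divide)
  obtain B where B: "0 \<le> B" "\<forall>v\<in>sphere 0 1. \<bar>\<eta> v\<bar> \<le> B" using eta_bounded by blast
  define g where "g k \<tau> = \<Psi> (\<rho> k) (x0, f x0 - \<rho> k * \<tau>)" for k \<tau>
  have subst: "(LINT t|lborel. \<Psi> (\<rho> k) (x0, t)) * Suc k = (LINT \<tau>|lborel. g k \<tau>)" for k
  proof -
    have "(LINT t|lborel. \<Psi> (\<rho> k) (x0, t)) = \<rho> k * (LINT \<tau>|lborel. g k \<tau>)"
      using lborel_integral_real_affine[of "- \<rho> k" "\<lambda>t. \<Psi> (\<rho> k) (x0, t)" "f x0"] \<rho>(2)[of k]
      by (simp add: g_def)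
    then show ?thesis by (simp add: \<rho>_def)
  qed
  have "(\<lambda>k. LINT \<tau>|lborel. g k \<tau>) \<longlonglongrightarrow> (LINT \<tau>|lborel. \<eta> (lower_normal y) * indicator {0..sl} \<tau>)"
  proof (rule integral_dominated_convergence)
    show "integrable lborel (\<lambda>\<tau>. B * indicator {0..sl} \<tau>)"
      using sl(1) by (intro integrable_mult_right integrable_real_indicator) auto
    show "(\<lambda>\<tau>. \<eta> (lower_normal y) * indicator {0..sl} \<tau>) \<in> borel_measurable lborel" by simp
    show "g k \<in> borel_measurable lborel" for k
    proof -
      have "(\<lambda>\<tau>. (x0, f x0 - \<rho> k * \<tau>)) \<in> borel_measurable borel"
        by (intro borel_measurable_continuous_onI continuous_intros)
      from measurable_compose[OF this Psi_measurable] show ?thesis by (simp add: g_def[abs_def])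
    qed
    show "AE \<tau> in lborel. norm (g k \<tau>) \<le> B * indicator {0..sl} \<tau>" for k
    proof (intro AE_I2)
      fix \<tau>
      show "norm (g k \<tau>) \<le> B * indicator {0..sl} \<tau>"
      proof (cases "g k \<tau> = 0")
        case True
        then show ?thesis using B by simp
      next
        case False
        then have n: "\<Psi> (\<rho> k) (x0, f x0 - \<rho> k * \<tau>) \<noteq> 0" by (simp add: g_def)
        have "0 < \<rho> k * \<tau>"
        proof (rule ccontr)
          assume "\<not> 0 < \<rho> k * \<tau>"
          then have "f x0 \<le> f x0 - \<rho> k * \<tau>" by simp
          from Psi_above_graph[OF x0_in this, of "\<rho> k"] n show False by simp
        qed
        then have \<tau>: "0 < \<tau>" using \<rho>(2)[of k] by (simp add: zero_less_mult_iff)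
        have "\<rho> k * \<tau> / sl \<le> \<rho> k" using dist_below_ge[of "\<rho> k * \<tau>"] Psi_nonzero(2)[OF n] \<open>0 < \<rho> k * \<tau>\<close> by simp
        then have "\<rho> k * \<tau> \<le> \<rho> k * sl" using sl(1) by (simp add: pos_divide_le_eq)
        then have "\<tau> \<le> sl" using \<rho>(2)[of k] by simp
        moreover have "\<bar>g k \<tau>\<bar> \<le> B" unfolding g_def using Psi_bound[OF B(2,1), of "\<rho> k" "(x0, f x0 - \<rho> k * \<tau>)"] B(1)
          by (cases "(x0, f x0 - \<rho> k * \<tau>) \<in> shell K 0 (\<rho> k) UNIV") auto
        ultimately show ?thesis using \<tau> by simp
      qed
    qed
    \<comment> \<open>The end points of the interval are exceptional and form a null set.\<close>
    have "AE \<tau> in lborel. \<tau> \<noteq> 0 \<and> \<tau> \<noteq> sl"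
      using AE_lborel_singleton[of 0] AE_lborel_singleton[of sl] by eventually_elim simp
    then show "AE \<tau> in lborel. (\<lambda>k. g k \<tau>) \<longlonglongrightarrow> \<eta> (lower_normal y) * indicator {0..sl} \<tau>"
    proof eventually_elim
      case (elim \<tau>)
      show ?case
      proof (cases "0 < \<tau>")
        case False
        have "g k \<tau> = 0" for k unfolding g_def
          using False \<rho>(2)[of k] by (intro Psi_above_graph x0_in) (simp add: mult_le_0_iff)
        then show ?thesis using False elim by (simp add: indicator_def)
      next
        case True
        note lims = blow_up_contact[OF \<rho> True]
        let ?q = "\<lambda>k. (x0, f x0 - \<rho> k * \<tau>)"
        have dpos: "0 < d (?q k)" for k
          using dist_below_ge[of "\<rho> k * \<tau>"] \<rho>(2)[of k] True sl(1)
          by (meson divide_pos_pos less_le_trans mult_pos_pos less_imp_le)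
        show ?thesis
        proof (cases "\<tau> < sl")
          case lt: True
          have "\<tau> / sl < 1" using lt sl(1) by simp
          from order_tendstoD(2)[OF lims(1) this]
          have ev: "\<forall>\<^sub>F k in sequentially. \<eta> (\<nu> (?q k)) = g k \<tau>"
          proof eventually_elim
            case (elim k)
            then have "d (?q k) \<le> \<rho> k" using \<rho>(2)[of k] by (simp add: divide_less_eq)
            then have "?q k \<in> shell K 0 (\<rho> k) UNIV" using dpos by (simp add: shell_def)
            then show ?case by (simp add: g_def \<Psi>_def)
          qed
          have "(\<lambda>k. \<eta> (\<nu> (?q k))) \<longlonglongrightarrow> \<eta> (lower_normal y)"
            by (rule continuous_on_tendsto_compose[OF cont lims(2)])
              (use dpos norm_nu norm_lower_normal in auto)
          from Lim_transform_eventually[OF this ev] show ?thesis using lt True by simp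
        next
          case False
          then have "1 < \<tau> / sl" using elim sl(1) by simp
          from order_tendstoD(1)[OF lims(1) this]
          have "\<forall>\<^sub>F k in sequentially. g k \<tau> = 0"
          proof eventually_elim
            case (elim k)
            then have "\<rho> k < d (?q k)" using \<rho>(2)[of k] by (simp add: less_divide_eq)
            then show ?case by (simp add: g_def \<Psi>_def shell_def)
          qed
          then show ?thesis using False elim by (simp add: tendsto_eventually)
        qed
      qed
    qed
  qed
  moreover have "(LINT \<tau>|lborel. \<eta> (lower_normal y) * indicator {0..sl} \<tau>) = \<eta> (lower_normal y) * sl"
    using sl(1) by simp
  ultimately show ?thesis using sl(1) unfolding subst[symmetric] by (simp add: \<rho>_def less_imp_le)
qed

end

theorem integral_surface_area_measure:
  "(LINT v|surface_area_measure K. \<eta> v) =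
    (LINT x|lebesgue. indicator (edom u) x * (\<eta> (lower_normal (grad u x)) * sqrt (1 + (norm (grad u x))\<^sup>2)))"
proof -
  obtain B where B: "0 \<le> B" "\<forall>v\<in>sphere 0 1. \<bar>\<eta> v\<bar> \<le> B" using eta_bounded by blast
  obtain R where R: "\<And>x. x \<in> edom u \<Longrightarrow> norm x \<le> R"
    using Conv_cdD(5)[OF u] compact_imp_bounded bounded_iff by metis
  define \<rho> where "\<rho> k = 1 / real (Suc k)" for k
  have \<rho>: "0 < \<rho> k" "\<rho> k \<le> 1" for k by (auto simp: \<rho>_def)
  have \<rho>0: "\<rho> \<longlonglongrightarrow> 0" unfolding \<rho>_def using LIMSEQ_inverse_real_of_nat by (simp add: inverse_eq_divide)
  define g where "g k x = (LINT t|lborel. \<Psi> (\<rho> k) (x, t)) * Suc k" for k x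
  have Pi: "integrable (lborel \<Otimes>\<^sub>M lborel) (\<Psi> r)" for r using Psi_integrable by (simp add: lborel_prod)
  have gi: "integrable lborel (g k)" for k
    unfolding g_def by (intro integrable_mult_left lborel_pair.integrable_fst' Pi)
  have gL: "(LINT x|lebesgue. g k x) = (LINT q|lborel. \<Psi> (\<rho> k) q) * Suc k" for k
  proof -
    have "(LINT x|lebesgue. g k x) = (LINT x|lborel. g k x)"
      using gi by (intro integral_completion) auto
    also have "\<dots> = (LINT x|lborel. LINT t|lborel. \<Psi> (\<rho> k) (x, t)) * Suc k" by (simp add: g_def)
    also have "(LINT x|lborel. LINT t|lborel. \<Psi> (\<rho> k) (x, t)) = (LINT q|lborel. \<Psi> (\<rho> k) q)"
      using lborel_pair.integral_fst'[OF Pi] by (simp add: lborel_prod)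
    finally show ?thesis .
  qed
  have lim1: "(\<lambda>k. LINT x|lebesgue. g k x) \<longlonglongrightarrow> (LINT v|surface_area_measure K. \<eta> v)"
    unfolding gL using integral_surface_area_measure_LIMSEQ[OF cont] by (simp add: \<Psi>_def[abs_def] \<rho>_def)
  have off: "g k x = 0" if "\<And>z. z \<in> edom u \<Longrightarrow> \<rho> k < dist x z" for k x
  proof -
    have "\<Psi> (\<rho> k) (x, t) = 0" for t
    proof (rule ccontr)
      assume n: "\<Psi> (\<rho> k) (x, t) \<noteq> 0"
      have "fst (p (x, t)) \<in> edom u" using K_above[of "fst (p (x, t))" "snd (p (x, t))"] p_in by simp
      from that[OF this] show False using fst_contact_near[of x t] Psi_nonzero(2)[OF n] by (simp add: dist_norm)
    qed
    then show ?thesis by (simp add: g_def)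
  qed
  \<comment> \<open>The fiber bound for radius \<open>\<rho> k\<close>, with \<open>\<rho> k\<close>
    cancelled against the factor \<open>Suc k\<close>.\<close>
  define C where "C = B * (2 * (2 + 2 / c))"
  have C0: "0 \<le> C" using B c by (simp add: C_def)
  have gb: "\<bar>g k x\<bar> \<le> C" for k x
  proof -
    have "\<bar>g k x\<bar> \<le> B * (2 * ((2 + 2 / c) * \<rho> k)) * Suc k"
      unfolding g_def abs_mult abs_of_nat using fiber_integral_bound[OF B(2,1) \<rho>(1), of k x] by (intro mult_right_mono) auto
    also have "\<dots> = C" by (simp add: C_def \<rho>_def field_simps)
    finally show ?thesis .
  qed
  have lim2: "(\<lambda>k. LINT x|lebesgue. g k x) \<longlonglongrightarrow>
    (LINT x|lebesgue. indicator (edom u) x * (\<eta> (lower_normal (grad u x)) * sqrt (1 + (norm (grad u x))\<^sup>2)))"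
  proof (rule lebesgue_dominated_convergence(2))
    show "g k \<in> borel_measurable lebesgue" for k
      using gi[of k] by (intro measurable_completion) auto
    \<comment> \<open>A vertical line on which \<open>\<Psi> (\<rho> k)\<close> does not vanish
      passes within \<open>\<rho> k \<le> 1\<close> of the domain, hence the radius
      \<open>R + 1\<close>.\<close>
    show "integrable lebesgue (\<lambda>x. C * indicator (cball 0 (R + 1)) x)"
      by (intro integrable_mult_right integrable_real_indicator) (use lmeasurable_cball[of 0 "R + 1"] in \<open>auto simp: fmeasurable_def\<close>)
    show "AE x in lebesgue. norm (g k x) \<le> C * indicator (cball 0 (R + 1)) x" for k
    proof (intro AE_I2)
      fix x
      show "norm (g k x) \<le> C * indicator (cball 0 (R + 1)) x"
      proof (cases "norm x \<le> R + 1")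
        case True
        then show ?thesis using gb[of k x] by simp
      next
        case False
        have "g k x = 0"
        proof (rule off)
          fix z assume "z \<in> edom u"
          from R[OF this] show "\<rho> k < dist x z"
            unfolding dist_norm using False \<rho>(2)[of k] norm_triangle_ineq2[of x z] by linarith
        qed
        then show ?thesis using C0 by simp
      qed
    qed
    show "AE x in lebesgue. (\<lambda>k. g k x) \<longlonglongrightarrow>
      indicator (edom u) x * (\<eta> (lower_normal (grad u x)) * sqrt (1 + (norm (grad u x))\<^sup>2))"
      using AE_differentiable[OF u]
    proof eventually_elim
      case (elim x)
      show ?case
      proof (cases "x \<in> edom u")
        case False
        have "closed (edom u)" using Conv_cdD(5)[OF u] by (rule compact_imp_closed)
        then obtain \<delta> where \<delta>: "0 < \<delta>" "\<And>z. z \<in> edom u \<Longrightarrow> \<delta> \<le> dist x z"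
          using separate_point_closed[OF _ False] by blast
        have "\<forall>\<^sub>F k in sequentially. g k x = 0"
          using order_tendstoD(2)[OF \<rho>0 \<delta>(1)]
          by eventually_elim (rule off, use \<delta>(2) in \<open>auto intro: less_le_trans\<close>)
        then show ?thesis using False by (simp add: tendsto_eventually)
      next
        case True
        then have "x \<in> interior (edom u)" "GDERIV f x :> grad u x" using elim by auto
        from fiber_integral_tendsto[OF this] show ?thesis
          using True sl_def[OF \<open>x \<in> interior (edom u)\<close> \<open>GDERIV f x :> grad u x\<close>] by (simp add: g_def \<rho>_def)
      qed
    qed
  qed
  show ?thesis by (rule LIMSEQ_unique[OF lim1 lim2])
qed

end

section \<open>Representation by the surface area measure\<close>

lemma lower_normal_fst_snd:
  fixes y :: "'a::euclidean_space"
  defines "s \<equiv> sqrt (1 + (norm y)\<^sup>2)"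
  shows "0 < s" "fst (lower_normal y) = y /\<^sub>R s" "snd (lower_normal y) = - (1 / s)"
proof -
  have "0 < 1 + (norm y)\<^sup>2" by (simp add: add_pos_nonneg)
  then show "0 < s" by (simp add: s_def)
  show "fst (lower_normal y) = y /\<^sub>R s" "snd (lower_normal y) = - (1 / s)"
    by (simp_all add: lower_normal_def s_def divide_inverse)
qed

text \<open>Central projection onto the hyperplane at height \<open>- 1\<close> inverts
  \<open>lower_normal\<close>.\<close>

lemma lower_normal_of_sphere:
  assumes v: "v \<in> sphere 0 1" "snd v < 0"
  shows "lower_normal (fst v /\<^sub>R (- snd v)) = v"
proof -
  define b where "b = - snd v"
  have b: "0 < b" using v by (simp add: b_def)
  have "norm v = 1" using v by simp
  then have n: "(norm (fst v))\<^sup>2 + b\<^sup>2 = 1" by (simp add: norm_prod_def b_def)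
  have "1 + (norm (fst v /\<^sub>R b))\<^sup>2 = (b\<^sup>2 + (norm (fst v))\<^sup>2) / b\<^sup>2"
    using b by (simp add: power_mult_distrib field_simps)
  also have "\<dots> = (1 / b)\<^sup>2" using n by (simp add: power_divide add.commute)
  finally have "sqrt (1 + (norm (fst v /\<^sub>R b))\<^sup>2) = 1 / b" using b by (simp only: real_sqrt_abs abs_of_pos divide_pos_pos zero_less_one)
  then have "lower_normal (fst v /\<^sub>R b) = (fst v, - b)"
    unfolding lower_normal_def using b by simp
  then show ?thesis by (simp add: b_def)
qed

text \<open>The condition \<open>represents\<close> of the theorem, as a constant about which lemmas
  can be stated.\<close>

definition surface_representation :: "(('a::euclidean_space \<Rightarrow> ereal) \<Rightarrow> real) \<Rightarrow> ('a \<times> real \<Rightarrow> real) \<Rightarrow> bool" where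
  "surface_representation Z \<eta> \<longleftrightarrow> continuous_on (sphere 0 1) \<eta> \<and>
      compact (closure (support_on (sphere 0 1) \<eta>)) \<and>
      closure (support_on (sphere 0 1) \<eta>) \<subseteq> lower_half_sphere \<and>
      (\<forall>K\<in>convex_bodies. Z \<lfloor>K\<rfloor>\<^sub>b = (LINT \<nu>|surface_area_measure K. \<eta> \<nu>))"

text \<open>The last component attains its maximum on the compact support, and this maximum is
  negative.\<close>

lemma surface_representation_support:
  assumes "surface_representation Z \<eta>"
  obtains c where "0 < c" "\<And>v. v \<in> sphere 0 1 \<Longrightarrow> \<eta> v \<noteq> 0 \<Longrightarrow> snd v \<le> - c"
proof (cases "support_on (sphere 0 1) \<eta> = {}")
  case True
  then show ?thesis by (intro that[of 1]) (auto simp: support_on_def)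
next
  case False
  let ?S = "closure (support_on (sphere 0 1) \<eta>)"
  have S: "compact ?S" "?S \<subseteq> lower_half_sphere" "?S \<noteq> {}"
    using assms False by (auto simp: surface_representation_def closure_eq_empty)
  have "continuous_on ?S snd" by (intro continuous_intros)
  from continuous_attains_sup[OF S(1,3) this]
  obtain w where w: "w \<in> ?S" "\<And>v. v \<in> ?S \<Longrightarrow> snd v \<le> snd w" by blast
  have "snd w < 0" using w(1) S(2) by (auto simp: lower_half_sphere_def inner_prod_def)
  then show ?thesis
    using w(2) closure_subset[of "support_on (sphere 0 1) \<eta>"]
    by (intro that[of "- snd w"]) (auto simp: support_on_def)
qed

text \<open>The gradient is constant and the unit cube has volume 1, so one test function recovers
  the density at one point of the half-sphere. This is the source of uniqueness.\<close>

lemma surface_representation_linear: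
  fixes Z :: "('a::euclidean_space \<Rightarrow> ereal) \<Rightarrow> real"
  assumes r: "surface_representation Z \<eta>"
  shows "Z (restr (\<lambda>x. ereal (y \<bullet> x)) unit_cube) = \<eta> (lower_normal y) * sqrt (1 + (norm y)\<^sup>2)"
proof -
  let ?v = "restr (\<lambda>x. ereal (y \<bullet> x)) (unit_cube :: 'a set)"
  have v: "?v \<in> Conv_cd" by (rule linear_Conv_cd[OF unit_cube(1-3)])
  \<comment> \<open>The truncation height bounds \<open>y \<bullet> x\<close> on the unit
    cube.\<close>
  define K where "K = {(x, t). ?v x \<le> ereal t \<and> t \<le> norm y * DIM('a)}"
  have body_K: "K \<in> convex_bodies" "\<lfloor>K\<rfloor>\<^sub>b = ?v"
  proof -
    have "?v x \<le> ereal (norm y * DIM('a))" if "x \<in> edom ?v" for x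
    proof -
      have x: "x \<in> unit_cube" using that by (simp add: edom_restr)
      then have "norm x \<le> DIM('a)" using unit_cube(4) by auto
      have "y \<bullet> x \<le> norm y * norm x" by (rule norm_cauchy_schwarz)
      also have "\<dots> \<le> norm y * DIM('a)" by (intro mult_left_mono norm_ge_zero) fact
      finally show ?thesis using x by (simp add: restr_def)
    qed
    from epi_body[OF v this] show "K \<in> convex_bodies" "\<lfloor>K\<rfloor>\<^sub>b = ?v" by (simp_all add: K_def)
  qed
  obtain c where c: "0 < c" "\<And>w. w \<in> sphere 0 1 \<Longrightarrow> \<eta> w \<noteq> 0 \<Longrightarrow> snd w \<le> - c"
    using surface_representation_support[OF r] by blast
  interpret lower_surface K \<eta> c
    using body_K(1) c r by unfold_locales (auto simp: convex_bodies_def surface_representation_def)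
  have "Z ?v = (LINT \<nu>|surface_area_measure K. \<eta> \<nu>)" using r body_K(1) unfolding surface_representation_def body_K(2)[symmetric] by blast
  also have "\<dots> = (LINT x|lebesgue. indicator (edom ?v) x * (\<eta> (lower_normal (grad ?v x)) * sqrt (1 + (norm (grad ?v x))\<^sup>2)))"
    unfolding integral_surface_area_measure body_K(2) ..
  also have "\<dots> = \<eta> (lower_normal y) * sqrt (1 + (norm y)\<^sup>2) * measure lebesgue (unit_cube :: 'a set)"
    by (rule integral_grad_linear[OF unit_cube(1-3)])
  finally show ?thesis by (simp add: unit_cube_eq)
qed

context epi_valuation
begin

text \<open>If \<open>v = lower_normal y\<close>, then \<open>y = fst v /\<^sub>R (- snd v)\<close>
  and \<open>- snd v = 1 / sqrt (1 + (norm y)\<^sup>2)\<close>, so the last factor compensates the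
  area element.\<close>

definition \<eta> :: "'a \<times> real \<Rightarrow> real" where
  "\<eta> v = (if snd v < 0 then \<zeta> (fst v /\<^sub>R (- snd v)) * (- snd v) else 0)"

lemma eta_lower_normal: "\<eta> (lower_normal y) * sqrt (1 + (norm y)\<^sup>2) = \<zeta> y"
  using lower_normal_fst_snd[of y] by (simp add: \<eta>_def)

text \<open>A downward unit vector whose slope has norm at most \<open>R'\<close> has last component
  at most \<open>- (1 / sqrt (1 + R'\<^sup>2))\<close>.\<close>

lemma eta_support: "\<exists>c>0. \<forall>v\<in>sphere 0 1. \<eta> v \<noteq> 0 \<longrightarrow> snd v \<le> - c"
proof -
  obtain R where R: "\<And>y. R < norm y \<Longrightarrow> \<zeta> y = 0" using zeta_support by blast
  \<comment> \<open>\<open>R\<close> may be negative, whereas the estimate below squares it.\<close>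
  define R' where "R' = max R 0"
  have "0 < 1 + R'\<^sup>2" by (simp add: add_pos_nonneg)
  then have s: "0 < sqrt (1 + R'\<^sup>2)" by simp
  have "snd v \<le> - (1 / sqrt (1 + R'\<^sup>2))" if v: "v \<in> sphere 0 1" "\<eta> v \<noteq> 0" for v
  proof -
    define b where "b = - snd v"
    have b: "0 < b" and z: "\<zeta> (fst v /\<^sub>R b) \<noteq> 0" using v(2) by (auto simp: \<eta>_def b_def split: if_splits)
    have "norm (fst v /\<^sub>R b) \<le> R'" using R[of "fst v /\<^sub>R b"] z by (force simp: R'_def)
    then have "norm (fst v) \<le> R' * b" using b by (simp add: field_simps)
    then have "(norm (fst v))\<^sup>2 \<le> (R' * b)\<^sup>2" by (intro power_mono) auto
    moreover have "norm v = 1" using v(1) by simp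
    then have "(norm (fst v))\<^sup>2 + b\<^sup>2 = 1" by (simp add: norm_prod_def b_def)
    ultimately have "1 \<le> (1 + R'\<^sup>2) * b\<^sup>2" by (simp add: power_mult_distrib algebra_simps)
    then have "sqrt 1 \<le> sqrt ((1 + R'\<^sup>2) * b\<^sup>2)" by (rule real_sqrt_le_mono)
    then have "1 \<le> sqrt (1 + R'\<^sup>2) * b" using b by (simp add: real_sqrt_mult)
    then have "1 / sqrt (1 + R'\<^sup>2) \<le> b" using s by (simp add: pos_divide_le_eq mult.commute)
    then show ?thesis by (simp add: b_def)
  qed
  then show ?thesis using s by (intro exI[of _ "1 / sqrt (1 + R'\<^sup>2)"]) auto
qed

text \<open>The quotient in the definition is continuous away from the equator. Cutting at height
  \<open>- (c / 2)\<close> gives two closed sets: on \<open>A\<close> the denominator is bounded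
  away from 0, and on \<open>B\<close> the function vanishes.\<close>

lemma continuous_on_eta: "continuous_on (sphere 0 1) \<eta>"
proof -
  obtain c where c: "0 < c" "\<forall>v\<in>sphere 0 1. \<eta> v \<noteq> 0 \<longrightarrow> snd v \<le> - c" using eta_support by blast
  define A where "A = sphere 0 1 \<inter> {v :: 'a \<times> real. snd v \<le> - (c / 2)}"
  define B where "B = sphere 0 1 \<inter> {v :: 'a \<times> real. - (c / 2) \<le> snd v}"
  have "closed A" "closed B" unfolding A_def B_def
    by (intro closed_Int closed_Collect_le continuous_intros closed_sphere)+
  moreover have "continuous_on A \<eta>"
  proof (rule continuous_on_eq)
    show "continuous_on A (\<lambda>v. \<zeta> (fst v /\<^sub>R (- snd v)) * (- snd v))"
      by (intro continuous_intros continuous_on_compose2[OF continuous_on_zeta]) (use c(1) in \<open>auto simp: A_def\<close>)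
    show "\<zeta> (fst v /\<^sub>R (- snd v)) * (- snd v) = \<eta> v" if "v \<in> A" for v
      using that c(1) by (auto simp: A_def \<eta>_def)
  qed
  moreover have "continuous_on B \<eta>"
  proof (rule continuous_on_eq)
    show "continuous_on B (\<lambda>_. 0 :: real)" by (rule continuous_on_const)
    show "0 = \<eta> v" if "v \<in> B" for v
    proof (rule ccontr)
      assume "0 \<noteq> \<eta> v"
      then have "snd v \<le> - c" using c(2) that by (auto simp: B_def)
      then show False using that c(1) by (simp add: B_def)
    qed
  qed
  ultimately have "continuous_on (A \<union> B) \<eta>" by (rule continuous_on_closed_Un)
  moreover have "A \<union> B = sphere 0 1" by (auto simp: A_def B_def)
  ultimately show ?thesis by simp
qed

theorem surface_representation_eta: "surface_representation Z \<eta>"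
proof -
  obtain c where c: "0 < c" "\<forall>v\<in>sphere 0 1. \<eta> v \<noteq> 0 \<longrightarrow> snd v \<le> - c" using eta_support by blast
  let ?T = "sphere 0 1 \<inter> {v :: 'a \<times> real. snd v \<le> - c}"
  have "compact ?T" by (intro compact_Int_closed closed_Collect_le continuous_intros) auto
  then have T: "closed ?T" by (rule compact_imp_closed)
  have sub: "closure (support_on (sphere 0 1) \<eta>) \<subseteq> ?T"
    using c(2) T by (intro closure_minimal) (auto simp: support_on_def)
  have "compact (closure (support_on (sphere 0 1) \<eta>))"
    using compact_Int_closed[OF \<open>compact ?T\<close> closed_closure[of "support_on (sphere 0 1) \<eta>"]] sub by (simp add: Int_absorb1)
  moreover have "?T \<subseteq> lower_half_sphere" using c(1) by (auto simp: lower_half_sphere_def inner_prod_def)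
  moreover have "Z \<lfloor>K\<rfloor>\<^sub>b = (LINT \<nu>|surface_area_measure K. \<eta> \<nu>)" if K: "K \<in> convex_bodies" for K
  proof -
    interpret S: lower_surface K \<eta> c
      using K c continuous_on_eta by unfold_locales (auto simp: convex_bodies_def)
    show ?thesis
      unfolding S.integral_surface_area_measure eta_lower_normal
      by (rule representation[OF lower_boundary_Conv_cd[OF K]])
  qed
  ultimately show ?thesis using continuous_on_eta sub by (auto simp: surface_representation_def)
qed

theorem surface_representation_unique:
  assumes r: "surface_representation Z \<eta>'" and v: "v \<in> sphere 0 1"
  shows "\<eta>' v = \<eta> v"
proof (cases "snd v < 0")
  case True
  define y where "y = fst v /\<^sub>R (- snd v)"
  have vy: "v = lower_normal y" using lower_normal_of_sphere[OF v True] by (simp add: y_def)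
  have "\<eta>' (lower_normal y) * sqrt (1 + (norm y)\<^sup>2) = \<eta> (lower_normal y) * sqrt (1 + (norm y)\<^sup>2)"
    by (rule trans[OF surface_representation_linear[OF r, symmetric] surface_representation_linear[OF surface_representation_eta]])
  moreover have "sqrt (1 + (norm y)\<^sup>2) \<noteq> 0" using lower_normal_fst_snd(1)[of y] by (rule less_imp_neq[symmetric])
  ultimately show ?thesis unfolding vy by (metis mult_right_cancel)
next
  case False
  \<comment> \<open>Off the open lower half-sphere both densities vanish, one by its support
    condition and the other by definition.\<close>
  obtain c where c: "0 < c" "\<And>w. w \<in> sphere 0 1 \<Longrightarrow> \<eta>' w \<noteq> 0 \<Longrightarrow> snd w \<le> - c"
    using surface_representation_support[OF r] by blast
  have "\<eta>' v = 0" using c(2)[OF v] c(1) False by force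
  then show ?thesis using False by (simp add: \<eta>_def)
qed

theorem integral_representation:
  assumes "u \<in> Conv_cd"
  shows "Z u = (LINT x:edom u|lebesgue. \<eta> ((grad u x, -1) /\<^sub>R sqrt (1 + (norm (grad u x))\<^sup>2)) * sqrt (1 + (norm (grad u x))\<^sup>2))"
  unfolding set_lebesgue_integral_def lower_normal_def[symmetric] eta_lower_normal
  using representation[OF assms] by simp

theorem compact_support_zeta:
  "compact (closure (support_on UNIV
    (\<lambda>y. \<eta> ((y, -1) /\<^sub>R sqrt (1 + (norm y)\<^sup>2)) * sqrt (1 + (norm y)\<^sup>2))))"
proof -
  obtain R where R: "\<And>y. R < norm y \<Longrightarrow> \<zeta> y = 0" using zeta_support by blast
  have "support_on UNIV \<zeta> \<subseteq> cball 0 R" using R by (force simp: support_on_def)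
  then have "bounded (support_on UNIV \<zeta>)" by (rule bounded_subset[OF bounded_cball])
  then show ?thesis unfolding lower_normal_def[symmetric] eta_lower_normal
    by (simp add: compact_closure)
qed

end

theorem theorem1p4:
  fixes Z :: "(real ^ 'n \<Rightarrow> ereal) \<Rightarrow> real"
  assumes "epi_continuous Z"
    and "epi_translation_invariant Z"
    and "valuation Z"
    and "epi_homogeneous CARD('n) Z"
  defines "represents \<equiv> \<lambda>\<eta> :: (real ^ 'n) \<times> real \<Rightarrow> real.
      continuous_on (sphere 0 1) \<eta> \<and>
      compact (closure (support_on (sphere 0 1) \<eta>)) \<and>
      closure (support_on (sphere 0 1) \<eta>) \<subseteq> lower_half_sphere \<and>
      (\<forall>K\<in>convex_bodies. Z \<lfloor>K\<rfloor>\<^sub>b = (LINT \<nu>|surface_area_measure K. \<eta> \<nu>))"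
  shows "\<exists>\<eta>. represents \<eta> \<and>
      (\<forall>\<eta>'. represents \<eta>' \<longrightarrow> (\<forall>\<nu>\<in>sphere 0 1. \<eta>' \<nu> = \<eta> \<nu>)) \<and>
      (\<forall>u\<in>Conv_cd.
         Z u = (LINT x:edom u|lebesgue.
                  \<eta> ((grad u x, -1) /\<^sub>R sqrt (1 + (norm (grad u x))\<^sup>2))
                    * sqrt (1 + (norm (grad u x))\<^sup>2))) \<and>
      compact (closure (support_on UNIV
        (\<lambda>y :: real ^ 'n. \<eta> ((y, -1) /\<^sub>R sqrt (1 + (norm y)\<^sup>2)) * sqrt (1 + (norm y)\<^sup>2))))"
proof -
  \<comment> \<open>The locale measures the degree by \<open>DIM\<close>, which is
    \<open>CARD('n)\<close> for \<open>real ^ 'n\<close>.\<close>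
  interpret epi_valuation Z
    using assms(1-4) by unfold_locales simp_all
  have eq: "represents = surface_representation Z"
    unfolding represents_def surface_representation_def[abs_def] ..
  show ?thesis
    unfolding eq using surface_representation_eta surface_representation_unique integral_representation compact_support_zeta by blast
qed

end
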